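(* Let $R$ be a noetherian ring, let $M$ be a finitely generated Gorenstein projective $R^{\circ}$-module and let $N$ be an $R$-module. Then there is an exact sequence $$0 \to \widehat{\operatorname{Tor}}{}^{R}_{0}(M,N) \to M\otimes_R N \to \operatorname{Hom}_R(\operatorname{Hom}_{R^{\circ}}(M,R),N)\to \widehat{\operatorname{Tor}}{}^{R}_{-1}(M,N) \to 0.$$
   Context: $R$ is an associative algebra over a commutative ring $\Bbbk$; noetherian means noetherian on both sides. $R$-modules are left $R$-modules; $R^{\circ}$ is the opposite ring and $R^{\circ}$-modules are right $R$-modules. Modules are identified with complexes concentrated in degree $0$; complexes are homologically graded. An acyclic complex $T$ of projective $R^{\circ}$-modules is totally acyclic if $\operatorname{Hom}_{R^{\circ}}(T,P)$ is acyclic for every projective $R^{\circ}$-module $P$. An $R^{\circ}$-module $G$ is Gorenstein projective if $G\cong\operatorname{Coker}(T_1\to T_0)$ for some totally acyclic complex $T$ of projective $R^{\circ}$-modules. A complete projective resolution of $M$ is a diagram $T\xrightarrow{\tau}P\xrightarrow{\simeq}M$ where $T$ is a totally acyclic complex of projective $R^{\circ}$-modules, $P\xrightarrow{\simeq}M$ is a semi-projective resolution (a quasi-isomorphism from a complex $P$ of projective modules such that $\operatorname{Hom}(P,-)$ preserves quasi-isomorphisms; for a module, e.g. an ordinary projective resolution), and $\tau_i$ is an isomorphism for $i\gg0$. A Gorenstein projective module has a complete projective resolution, and the Tate homology is $\widehat{\operatorname{Tor}}{}^{R}_{i}(M,N)=\operatorname{H}_i(T\otimes_RN)$ for $i\in\mathbb{Z}$.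 *)

theory Defs
  imports "HOL-Algebra.Module" "HOL-Algebra.AbelCoset"
begin

section \<open>Rings, algebras and modules\<close>

text \<open>
  The library locale \<^locale>\<open>module\<close> asks the ring of scalars to be commutative. Here is the same
  notion over an arbitrary ring. The ring structure on the record type of modules is not used: only
  \<^term>\<open>carrier\<close>, \<^term>\<open>add\<close>, \<^term>\<open>zero\<close> and \<^term>\<open>smult\<close> matter for a module.
\<close>

locale lmodule = R?: ring R + M?: abelian_group M
  for R :: "('r, 'e) ring_scheme" (structure) and M :: "('r, 'a, 'm) module_scheme" (structure) +
  assumes smult_closed [simp, intro]:
      "\<lbrakk>a \<in> carrier R; x \<in> carrier M\<rbrakk> \<Longrightarrow> a \<odot>\<^bsub>M\<^esub> x \<in> carrier M"
    and smult_l_distr: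
      "\<lbrakk>a \<in> carrier R; b \<in> carrier R; x \<in> carrier M\<rbrakk> \<Longrightarrow>
        (a \<oplus>\<^bsub>R\<^esub> b) \<odot>\<^bsub>M\<^esub> x = a \<odot>\<^bsub>M\<^esub> x \<oplus>\<^bsub>M\<^esub> b \<odot>\<^bsub>M\<^esub> x"
    and smult_r_distr:
      "\<lbrakk>a \<in> carrier R; x \<in> carrier M; y \<in> carrier M\<rbrakk> \<Longrightarrow>
        a \<odot>\<^bsub>M\<^esub> (x \<oplus>\<^bsub>M\<^esub> y) = a \<odot>\<^bsub>M\<^esub> x \<oplus>\<^bsub>M\<^esub> a \<odot>\<^bsub>M\<^esub> y"
    and smult_assoc1:
      "\<lbrakk>a \<in> carrier R; b \<in> carrier R; x \<in> carrier M\<rbrakk> \<Longrightarrow>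
        (a \<otimes>\<^bsub>R\<^esub> b) \<odot>\<^bsub>M\<^esub> x = a \<odot>\<^bsub>M\<^esub> (b \<odot>\<^bsub>M\<^esub> x)"
    and smult_one [simp]:
      "x \<in> carrier M \<Longrightarrow> \<one>\<^bsub>R\<^esub> \<odot>\<^bsub>M\<^esub> x = x"

text \<open>
  An associative algebra over a commutative ring. (The library locale \<^locale>\<open>algebra\<close> is for
  commutative algebras.)
\<close>

locale assoc_algebra = module K R + ring R
  for K :: "('k, 'e) ring_scheme" (structure) and R :: "('k, 'r, 'm) module_scheme" (structure) +
  assumes smult_mult_left:
      "\<lbrakk>c \<in> carrier K; x \<in> carrier R; y \<in> carrier R\<rbrakk> \<Longrightarrow>
        (c \<odot>\<^bsub>R\<^esub> x) \<otimes>\<^bsub>R\<^esub> y = c \<odot>\<^bsub>R\<^esub> (x \<otimes>\<^bsub>R\<^esub> y)"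
    and smult_mult_right:
      "\<lbrakk>c \<in> carrier K; x \<in> carrier R; y \<in> carrier R\<rbrakk> \<Longrightarrow>
        x \<otimes>\<^bsub>R\<^esub> (c \<odot>\<^bsub>R\<^esub> y) = c \<odot>\<^bsub>R\<^esub> (x \<otimes>\<^bsub>R\<^esub> y)"

text \<open>
  A right \<open>R\<close>-module \<open>M\<close> is an \<open>lmodule\<close> over \<open>opp_ring R\<close>; then \<open>r \<odot>\<^bsub>M\<^esub> x\<close> stands for the
  product \<open>x r\<close>. The record update keeps the scalar multiplication if \<open>R\<close> is an algebra.
\<close>

definition opp_ring :: "('r, 'e) ring_scheme \<Rightarrow> ('r, 'e) ring_scheme" where
  "opp_ring R = R\<lparr>mult := (\<lambda>x y. y \<otimes>\<^bsub>R\<^esub> x)\<rparr>"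

definition regular_module :: "('r, 'e) ring_scheme \<Rightarrow> ('r, 'r) module" where
  "regular_module R = \<lparr>carrier = carrier R, mult = mult R, one = one R,
     zero = zero R, add = add R, smult = mult R\<rparr>"

definition module_span :: "('r, 'e) ring_scheme \<Rightarrow> ('r, 'a) module \<Rightarrow> 'a set \<Rightarrow> 'a set" where
  "module_span R M A = \<Inter>{H. submodule H R M \<and> A \<subseteq> H}"

definition finitely_generated :: "('r, 'e) ring_scheme \<Rightarrow> ('r, 'a) module \<Rightarrow> bool" where
  "finitely_generated R M \<longleftrightarrow> (\<exists>A. finite A \<and> A \<subseteq> carrier M \<and> module_span R M A = carrier M)"

definition left_noetherian :: "('r, 'e) ring_scheme \<Rightarrow> bool" where
  "left_noetherian R \<longleftrightarrow> (\<forall>I. submodule I R (regular_module R) \<longrightarrow>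
     (\<exists>A. finite A \<and> A \<subseteq> carrier R \<and> module_span R (regular_module R) A = I))"

text \<open>The locale \<open>noetherian_ring\<close> of \<open>HOL-Algebra.Ring_Divisibility\<close> only concerns two-sided ideals.\<close>

definition noetherian :: "('r, 'e) ring_scheme \<Rightarrow> bool" where
  "noetherian R \<longleftrightarrow> left_noetherian R \<and> left_noetherian (opp_ring R)"

definition linear_map ::
  "('r, 'e) ring_scheme \<Rightarrow> ('r, 'a) module \<Rightarrow> ('r, 'b) module \<Rightarrow> ('a \<Rightarrow> 'b) \<Rightarrow> bool" where
  "linear_map R M N f \<longleftrightarrow> f \<in> carrier M \<rightarrow> carrier N \<and>
     (\<forall>x\<in>carrier M. \<forall>y\<in>carrier M. f (x \<oplus>\<^bsub>M\<^esub> y) = f x \<oplus>\<^bsub>N\<^esub> f y) \<and>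
     (\<forall>r\<in>carrier R. \<forall>x\<in>carrier M. f (r \<odot>\<^bsub>M\<^esub> x) = r \<odot>\<^bsub>N\<^esub> f x)"

definition module_iso ::
  "('r, 'e) ring_scheme \<Rightarrow> ('r, 'a) module \<Rightarrow> ('r, 'b) module \<Rightarrow> bool" where
  "module_iso R M N \<longleftrightarrow> (\<exists>f. linear_map R M N f \<and> bij_betw f (carrier M) (carrier N))"

definition quot_module :: "('r, 'a) module \<Rightarrow> 'a set \<Rightarrow> ('r, 'a set) module" where
  "quot_module M H = \<lparr>carrier = a_rcosets\<^bsub>M\<^esub> H, mult = undefined, one = undefined,
     zero = H, add = set_add M, smult = (\<lambda>r X. \<Union>x\<in>X. H +>\<^bsub>M\<^esub> (r \<odot>\<^bsub>M\<^esub> x))\<rparr>"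

text \<open>The map of cosets induced by \<open>f\<close>, for a map \<open>f\<close> into \<open>N\<close> and a submodule \<open>H\<close> of \<open>N\<close>.\<close>

definition coset_map :: "('r, 'b) module \<Rightarrow> 'b set \<Rightarrow> ('a \<Rightarrow> 'b) \<Rightarrow> 'a set \<Rightarrow> 'b set" where
  "coset_map N H f X = (\<Union>x\<in>X. H +>\<^bsub>N\<^esub> f x)"

definition prod_module :: "('i \<Rightarrow> ('r, 'a) module) \<Rightarrow> ('r, 'i \<Rightarrow> 'a) module" where
  "prod_module M = \<lparr>carrier = {f. \<forall>i. f i \<in> carrier (M i)}, mult = undefined, one = undefined,
     zero = (\<lambda>i. \<zero>\<^bsub>M i\<^esub>), add = (\<lambda>f g i. f i \<oplus>\<^bsub>M i\<^esub> g i), smult = (\<lambda>r f i. r \<odot>\<^bsub>M i\<^esub> f i)\<rparr>"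

text \<open>
  \<open>Hom\<^sub>S(M, N)\<close> for an algebra \<open>S\<close> over \<open>K\<close>, as a \<open>K\<close>-module. Homomorphisms are represented by
  extensional functions, so that each of them is represented once.
\<close>

definition hom_module ::
  "('k, 'r) module \<Rightarrow> ('r, 'a) module \<Rightarrow> ('r, 'b) module \<Rightarrow> ('k, 'a \<Rightarrow> 'b) module" where
  "hom_module S M N = \<lparr>carrier = {f \<in> extensional (carrier M). linear_map S M N f},
     mult = undefined, one = undefined,
     zero = (\<lambda>x\<in>carrier M. \<zero>\<^bsub>N\<^esub>),
     add = (\<lambda>f g. \<lambda>x\<in>carrier M. f x \<oplus>\<^bsub>N\<^esub> g x),
     smult = (\<lambda>c f. \<lambda>x\<in>carrier M. (c \<odot>\<^bsub>S\<^esub> \<one>\<^bsub>S\<^esub>) \<odot>\<^bsub>N\<^esub> f x)\<rparr>"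

text \<open>The left \<open>R\<close>-module \<open>Hom(M, R)\<close> of a right \<open>R\<close>-module \<open>M\<close>, with action \<open>(r f)(x) = r f(x)\<close>.\<close>

definition dual_module ::
  "('k, 'r) module \<Rightarrow> ('r, 'a) module \<Rightarrow> ('r, 'a \<Rightarrow> 'r) module" where
  "dual_module R M = \<lparr>carrier = carrier (hom_module (opp_ring R) M (regular_module (opp_ring R))),
     mult = undefined, one = undefined,
     zero = (\<lambda>x\<in>carrier M. \<zero>\<^bsub>R\<^esub>),
     add = (\<lambda>f g. \<lambda>x\<in>carrier M. f x \<oplus>\<^bsub>R\<^esub> g x),
     smult = (\<lambda>r f. \<lambda>x\<in>carrier M. r \<otimes>\<^bsub>R\<^esub> f x)\<rparr>"


section \<open>Tensor products\<close>

definition free_module :: "('k, 'e) ring_scheme \<Rightarrow> 'x set \<Rightarrow> ('k, 'x \<Rightarrow> 'k) module" where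
  "free_module K X = \<lparr>carrier = {a. (\<forall>x\<in>X. a x \<in> carrier K) \<and> (\<forall>x. x \<notin> X \<longrightarrow> a x = \<zero>\<^bsub>K\<^esub>) \<and>
       finite {x. a x \<noteq> \<zero>\<^bsub>K\<^esub>}},
     mult = undefined, one = undefined,
     zero = (\<lambda>x. \<zero>\<^bsub>K\<^esub>), add = (\<lambda>a b x. a x \<oplus>\<^bsub>K\<^esub> b x), smult = (\<lambda>c a x. c \<otimes>\<^bsub>K\<^esub> a x)\<rparr>"

definition free_gen :: "('k, 'e) ring_scheme \<Rightarrow> 'x \<Rightarrow> 'x \<Rightarrow> 'k" where
  "free_gen K x = (\<lambda>y. if y = x then \<one>\<^bsub>K\<^esub> else \<zero>\<^bsub>K\<^esub>)"

text \<open>The linear extension of a map \<open>h\<close> of bases.\<close>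

definition free_map :: "('k, 'e) ring_scheme \<Rightarrow> ('x \<Rightarrow> 'y) \<Rightarrow> ('x \<Rightarrow> 'k) \<Rightarrow> 'y \<Rightarrow> 'k" where
  "free_map K h a = (\<lambda>y. finsum K a {x. a x \<noteq> \<zero>\<^bsub>K\<^esub> \<and> h x = y})"

text \<open>
  For a \<open>K\<close>-algebra \<open>R\<close>, a right \<open>R\<close>-module \<open>M\<close> and a left \<open>R\<close>-module \<open>N\<close>, the tensor product is
  the \<open>K\<close>-module generated by the symbols \<open>(m, n)\<close>, subject to biadditivity, \<open>(m r, n) = (m, r n)\<close>
  and \<open>c (m, n) = (m, c n)\<close>. The last relation gives the \<open>K\<close>-module structure; with \<open>K\<close> the
  integers it is redundant.
\<close>

definition tensor_relations ::
  "('k, 'e) ring_scheme \<Rightarrow> ('k, 'r) module \<Rightarrow> ('r, 'a) module \<Rightarrow> ('r, 'b) module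
    \<Rightarrow> ('a \<times> 'b \<Rightarrow> 'k) set" where
  "tensor_relations K R M N =
    (let F = free_module K (carrier M \<times> carrier N); e = (\<lambda>m n. free_gen K (m, n)) in
      {e (m \<oplus>\<^bsub>M\<^esub> m') n \<ominus>\<^bsub>F\<^esub> (e m n \<oplus>\<^bsub>F\<^esub> e m' n) | m m' n.
         m \<in> carrier M \<and> m' \<in> carrier M \<and> n \<in> carrier N} \<union>
      {e m (n \<oplus>\<^bsub>N\<^esub> n') \<ominus>\<^bsub>F\<^esub> (e m n \<oplus>\<^bsub>F\<^esub> e m n') | m n n'.
         m \<in> carrier M \<and> n \<in> carrier N \<and> n' \<in> carrier N} \<union>
      {e (r \<odot>\<^bsub>M\<^esub> m) n \<ominus>\<^bsub>F\<^esub> e m (r \<odot>\<^bsub>N\<^esub> n) | r m n.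
         r \<in> carrier R \<and> m \<in> carrier M \<and> n \<in> carrier N} \<union>
      {c \<odot>\<^bsub>F\<^esub> e m n \<ominus>\<^bsub>F\<^esub> e m ((c \<odot>\<^bsub>R\<^esub> \<one>\<^bsub>R\<^esub>) \<odot>\<^bsub>N\<^esub> n) | c m n.
         c \<in> carrier K \<and> m \<in> carrier M \<and> n \<in> carrier N})"

definition tensor_submodule ::
  "('k, 'e) ring_scheme \<Rightarrow> ('k, 'r) module \<Rightarrow> ('r, 'a) module \<Rightarrow> ('r, 'b) module
    \<Rightarrow> ('a \<times> 'b \<Rightarrow> 'k) set" where
  "tensor_submodule K R M N =
    module_span K (free_module K (carrier M \<times> carrier N)) (tensor_relations K R M N)"

definition tensor ::
  "('k, 'e) ring_scheme \<Rightarrow> ('k, 'r) module \<Rightarrow> ('r, 'a) module \<Rightarrow> ('r, 'b) module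
    \<Rightarrow> ('k, ('a \<times> 'b \<Rightarrow> 'k) set) module" where
  "tensor K R M N =
    quot_module (free_module K (carrier M \<times> carrier N)) (tensor_submodule K R M N)"

text \<open>The map \<open>f \<otimes> N\<close> induced by a homomorphism \<open>f\<close> into the right \<open>R\<close>-module \<open>M\<close>.\<close>

definition tensor_map ::
  "('k, 'e) ring_scheme \<Rightarrow> ('k, 'r) module \<Rightarrow> ('r, 'a) module \<Rightarrow> ('r, 'b) module
    \<Rightarrow> ('c \<Rightarrow> 'a) \<Rightarrow> ('c \<times> 'b \<Rightarrow> 'k) set \<Rightarrow> ('a \<times> 'b \<Rightarrow> 'k) set" where
  "tensor_map K R M N f =
    coset_map (free_module K (carrier M \<times> carrier N)) (tensor_submodule K R M N)
      (free_map K (map_prod f id))"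


section \<open>Complexes\<close>

text \<open>
  Complexes are indexed by the integers and graded homologically: \<open>bd C i\<close> maps \<open>obj C i\<close> to
  \<open>obj C (i - 1)\<close>.
\<close>

record ('r, 'a) mcomplex =
  obj :: "int \<Rightarrow> ('r, 'a) module"
  bd :: "int \<Rightarrow> 'a \<Rightarrow> 'a"

definition chain_complex :: "('r, 'e) ring_scheme \<Rightarrow> ('r, 'a) mcomplex \<Rightarrow> bool" where
  "chain_complex S C \<longleftrightarrow> (\<forall>i. lmodule S (obj C i)) \<and>
     (\<forall>i. linear_map S (obj C i) (obj C (i - 1)) (bd C i)) \<and>
     (\<forall>i. \<forall>x\<in>carrier (obj C i). bd C (i - 1) (bd C i x) = \<zero>\<^bsub>obj C (i - 2)\<^esub>)"

definition chain_map ::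
  "('r, 'e) ring_scheme \<Rightarrow> ('r, 'a) mcomplex \<Rightarrow> ('r, 'b) mcomplex \<Rightarrow> (int \<Rightarrow> 'a \<Rightarrow> 'b) \<Rightarrow> bool" where
  "chain_map S C D f \<longleftrightarrow> (\<forall>i. linear_map S (obj C i) (obj D i) (f i)) \<and>
     (\<forall>i. \<forall>x\<in>carrier (obj C i). f (i - 1) (bd C i x) = bd D i (f i x))"

definition cycles :: "('r, 'a) mcomplex \<Rightarrow> int \<Rightarrow> 'a set" where
  "cycles C i = a_kernel (obj C i) (obj C (i - 1)) (bd C i)"

definition boundaries :: "('r, 'a) mcomplex \<Rightarrow> int \<Rightarrow> 'a set" where
  "boundaries C i = bd C (i + 1) ` carrier (obj C (i + 1))"

definition acyclic_complex :: "('r, 'a) mcomplex \<Rightarrow> bool" where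
  "acyclic_complex C \<longleftrightarrow> (\<forall>i. cycles C i = boundaries C i)"

definition homology :: "('r, 'a) mcomplex \<Rightarrow> int \<Rightarrow> ('r, 'a set) module" where
  "homology C i = quot_module ((obj C i)\<lparr>carrier := cycles C i\<rparr>) (boundaries C i)"

definition homology_map ::
  "('r, 'b) mcomplex \<Rightarrow> (int \<Rightarrow> 'a \<Rightarrow> 'b) \<Rightarrow> int \<Rightarrow> 'a set \<Rightarrow> 'b set" where
  "homology_map D f i = coset_map (obj D i) (boundaries D i) (f i)"

definition quasi_iso ::
  "('r, 'a) mcomplex \<Rightarrow> ('r, 'b) mcomplex \<Rightarrow> (int \<Rightarrow> 'a \<Rightarrow> 'b) \<Rightarrow> bool" where
  "quasi_iso C D f \<longleftrightarrow>
     (\<forall>i. bij_betw (homology_map D f i) (carrier (homology C i)) (carrier (homology D i)))"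

text \<open>A module as a complex concentrated in degree \<open>0\<close>.\<close>

definition stalk :: "('r, 'a) module \<Rightarrow> ('r, 'a) mcomplex" where
  "stalk M = \<lparr>obj = (\<lambda>i. if i = 0 then M else M\<lparr>carrier := {\<zero>\<^bsub>M\<^esub>}\<rparr>), bd = (\<lambda>i x. \<zero>\<^bsub>M\<^esub>)\<rparr>"

text \<open>
  The complex \<open>Hom\<^sub>S(C, D)\<close>. In degree \<open>n\<close> its elements are the families \<open>f\<close> of homomorphisms
  \<open>f i\<close> from \<open>obj C i\<close> to \<open>obj D (i + n)\<close>, and the differential sends \<open>f\<close> to
  \<open>bd D \<circ> f - (-1)\<^sup>n f \<circ> bd C\<close>.
\<close>

definition hom_complex ::
  "('k, 'r) module \<Rightarrow> ('r, 'a) mcomplex \<Rightarrow> ('r, 'b) mcomplex \<Rightarrow> ('k, int \<Rightarrow> 'a \<Rightarrow> 'b) mcomplex" where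
  "hom_complex S C D = \<lparr>
     obj = (\<lambda>n. prod_module (\<lambda>i. hom_module S (obj C i) (obj D (i + n)))),
     bd = (\<lambda>n f i. \<lambda>x\<in>carrier (obj C i).
       if even n then bd D (i + n) (f i x) \<ominus>\<^bsub>obj D (i + n - 1)\<^esub> f (i - 1) (bd C i x)
       else bd D (i + n) (f i x) \<oplus>\<^bsub>obj D (i + n - 1)\<^esub> f (i - 1) (bd C i x))\<rparr>"

definition hom_complex_map ::
  "('r, 'a) mcomplex \<Rightarrow> (int \<Rightarrow> 'b \<Rightarrow> 'c) \<Rightarrow> int \<Rightarrow> (int \<Rightarrow> 'a \<Rightarrow> 'b) \<Rightarrow> int \<Rightarrow> 'a \<Rightarrow> 'c" where
  "hom_complex_map C \<alpha> = (\<lambda>n f i. \<lambda>x\<in>carrier (obj C i). \<alpha> (i + n) (f i x))"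

definition tensor_complex ::
  "('k, 'e) ring_scheme \<Rightarrow> ('k, 'r) module \<Rightarrow> ('r, 'a) mcomplex \<Rightarrow> ('r, 'b) module
    \<Rightarrow> ('k, ('a \<times> 'b \<Rightarrow> 'k) set) mcomplex" where
  "tensor_complex K R C N = \<lparr>
     obj = (\<lambda>i. tensor K R (obj C i) N),
     bd = (\<lambda>i. tensor_map K R (obj C (i - 1)) N (bd C i))\<rparr>"


section \<open>Projectivity, total acyclicity and complete resolutions\<close>

text \<open>
  A formula cannot quantify over types, so in the next definitions "every module" is read as
  "every module with carrier in the type \<open>'a list \<Rightarrow> 'r\<close>", where \<open>'a\<close> is the type of elements of
  the object being tested and \<open>'r\<close> that of the ring. This is no restriction. Over the zero
  ring all modules are zero; over any other ring, the type has a copy of every module with at most \<open>max(|'a|, |'r|, \<aleph>\<^sub>0)\<close> elements, for example of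
  the free module on any set of words over \<open>'a\<close>, and those are enough:

  \<^item> A module \<open>P\<close> with the lifting property for such modules is a direct summand of the free module
    on its carrier, hence it has the lifting property for all modules.

  \<^item> A cocycle in \<open>Hom(T, Q)\<close>, \<open>Q\<close> being a summand of a free module, takes values in the free module
    on at most \<open>max(|'a|, \<aleph>\<^sub>0)\<close> of the basis elements. If it bounds there, then it bounds in \<open>Q\<close>.

  \<^item> A complex \<open>P\<close> of projective modules has a semi-free resolution \<open>F \<rightarrow> P\<close> within the cardinality
    bound. If \<open>Hom(P, -)\<close> takes it to a quasi-isomorphism, then \<open>P\<close> is a homotopy retract of \<open>F\<close>,
    so \<open>Hom(P, -)\<close> preserves all quasi-isomorphisms.
\<close>

definition projective :: "('r, 'e) ring_scheme \<Rightarrow> ('r, 'a) module \<Rightarrow> bool" where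
  "projective S P \<longleftrightarrow> lmodule S P \<and>
     (\<forall>(A :: ('r, 'a list \<Rightarrow> 'r) module) (B :: ('r, 'a list \<Rightarrow> 'r) module) g f.
        lmodule S A \<and> lmodule S B \<and> linear_map S A B g \<and> g ` carrier A = carrier B \<and>
        linear_map S P B f \<longrightarrow>
        (\<exists>h. linear_map S P A h \<and> (\<forall>x\<in>carrier P. g (h x) = f x)))"

definition totally_acyclic :: "('k, 'r) module \<Rightarrow> ('r, 'a) mcomplex \<Rightarrow> bool" where
  "totally_acyclic S T \<longleftrightarrow> chain_complex S T \<and> (\<forall>i. projective S (obj T i)) \<and>
     acyclic_complex T \<and>
     (\<forall>Q :: ('r, 'a list \<Rightarrow> 'r) module. projective S Q \<longrightarrow>
        acyclic_complex (hom_complex S T (stalk Q)))"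

text \<open>
  The definition asks for a totally acyclic complex in the given type \<open>'t\<close>. As a hypothesis with
  \<open>'t\<close> a type variable, it says that there is such a complex in some type.
\<close>

definition gorenstein_projective ::
  "'t itself \<Rightarrow> ('k, 'r) module \<Rightarrow> ('r, 'a) module \<Rightarrow> bool" where
  "gorenstein_projective _ S G \<longleftrightarrow> lmodule S G \<and>
     (\<exists>T :: ('r, 't) mcomplex. totally_acyclic S T \<and>
        module_iso S G (quot_module (obj T 0) (bd T 1 ` carrier (obj T 1))))"

definition semi_projective :: "('k, 'r) module \<Rightarrow> ('r, 'a) mcomplex \<Rightarrow> bool" where
  "semi_projective S P \<longleftrightarrow> chain_complex S P \<and> (\<forall>i. projective S (obj P i)) \<and>
     (\<forall>(C :: ('r, 'a list \<Rightarrow> 'r) mcomplex) (D :: ('r, 'a list \<Rightarrow> 'r) mcomplex) \<alpha>.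
        chain_complex S C \<and> chain_complex S D \<and> chain_map S C D \<alpha> \<and> quasi_iso C D \<alpha> \<longrightarrow>
        quasi_iso (hom_complex S P C) (hom_complex S P D) (hom_complex_map P \<alpha>))"

definition semi_projective_resolution ::
  "('k, 'r) module \<Rightarrow> ('r, 'm) module \<Rightarrow> ('r, 'p) mcomplex \<Rightarrow> (int \<Rightarrow> 'p \<Rightarrow> 'm) \<Rightarrow> bool" where
  "semi_projective_resolution S M P \<pi> \<longleftrightarrow> semi_projective S P \<and>
     chain_map S P (stalk M) \<pi> \<and> quasi_iso P (stalk M) \<pi>"

definition complete_projective_resolution ::
  "('k, 'r) module \<Rightarrow> ('r, 'm) module \<Rightarrow> ('r, 't) mcomplex \<Rightarrow> (int \<Rightarrow> 't \<Rightarrow> 'p)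
    \<Rightarrow> ('r, 'p) mcomplex \<Rightarrow> (int \<Rightarrow> 'p \<Rightarrow> 'm) \<Rightarrow> bool" where
  "complete_projective_resolution S M T \<tau> P \<pi> \<longleftrightarrow> totally_acyclic S T \<and>
     semi_projective_resolution S M P \<pi> \<and> chain_map S T P \<tau> \<and>
     (\<exists>n. \<forall>i\<ge>n. bij_betw (\<tau> i) (carrier (obj T i)) (carrier (obj P i)))"

text \<open>
  Tate homology of \<open>M\<close> with coefficients in \<open>N\<close>, computed from the totally acyclic complex \<open>T\<close> of
  a complete projective resolution of \<open>M\<close>. It does not depend on the resolution, up to isomorphism.
\<close>

definition tate_tor ::
  "('k, 'e) ring_scheme \<Rightarrow> ('k, 'r) module \<Rightarrow> ('r, 't) mcomplex \<Rightarrow> ('r, 'n) module \<Rightarrow> int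
    \<Rightarrow> ('k, ('t \<times> 'n \<Rightarrow> 'k) set set) module" where
  "tate_tor K R T N i = homology (tensor_complex K R T N) i"

end

theory Submission
  imports Defs
begin

text \<open>
  Up to maps which factor through projective modules, \<open>M\<close> is the image of \<open>T\<^sub>0 \<rightarrow> T\<^sub>-\<^sub>1\<close>: since \<open>M\<close>
  is Gorenstein projective, cocycles of positive degree in \<open>Hom(P, X)\<close> bound for projective \<open>X\<close>, so
  the inverse of \<open>\<tau>\<close> in high degrees extends downwards to a chain map \<open>P \<rightarrow> T\<close>, and the homotopies
  extend downwards likewise. This gives \<open>\<alpha> : T\<^sub>0 \<rightarrow> M\<close> and \<open>\<beta> : M \<rightarrow> T\<^sub>-\<^sub>1\<close>.

  The first map of the sequence is induced by \<open>\<alpha> \<otimes> N\<close> and the second is evaluation. As \<open>M\<close> is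
  finitely generated, \<open>\<beta> m\<close> is a finite sum of terms \<open>\<phi>\<^sub>j(m) j\<close> with functionals \<open>\<phi>\<^sub>j\<close> on \<open>M\<close> and \<open>j\<close> in
  \<open>T\<^sub>-\<^sub>1\<close>, and the third map sends \<open>\<xi>\<close> to the class of the sum of \<open>j \<otimes> \<xi>(\<phi>\<^sub>j)\<close>. Exactness follows from two
  facts: an element of \<open>X \<otimes> N\<close>, \<open>X\<close> projective, vanishes if all functionals on \<open>X\<close> annihilate it, and
  by total acyclicity functionals on the images of the differentials of \<open>T\<close> extend.
\<close>

section \<open>Linear maps and free modules\<close>

text \<open>\<open>T\<close> is tied to \<open>M\<close> only through isomorphisms in high degrees,
  so \<open>M\<close> need not be the cokernel of \<open>T_1 -> T_0\<close>. This is why the two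
  composites of \<open>\<alpha>\<close> and \<open>\<beta>\<close> carry error terms. One of them
  contains a differential of \<open>T\<close>: it vanishes on cycles or is a boundary. The other
  passes through the projective module \<open>Q\<close> and is detected, or corrected, by
  functionals on \<open>M\<close>. The vanishing of positive cohomology with projective coefficients
  comes from the second totally acyclic complex, the one hidden in Gorenstein projectivity. The
  given \<open>P\<close> may be nonzero in negative degrees and is replaced by an ordinary
  resolution, for which its cycles of degree 0 must be projective. Finite generation acts twice: on
  \<open>\<beta>\<close>, to define the third map, and on the map from \<open>M\<close> to
  \<open>Q\<close>, to show exactness at the Hom module. The definitions quantify over one type of
  test modules; therefore projectivity is converted into a dual basis and total acyclicity into a
  factorization, both valid for modules of any type.\<close>

lemma linear_mapI:
  assumes "\<And>x. x \<in> carrier A \<Longrightarrow> f x \<in> carrier B"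
    and "\<And>x y. \<lbrakk>x \<in> carrier A; y \<in> carrier A\<rbrakk> \<Longrightarrow> f (x \<oplus>\<^bsub>A\<^esub> y) = f x \<oplus>\<^bsub>B\<^esub> f y"
    and "\<And>r x. \<lbrakk>r \<in> carrier S; x \<in> carrier A\<rbrakk> \<Longrightarrow> f (r \<odot>\<^bsub>A\<^esub> x) = r \<odot>\<^bsub>B\<^esub> f x"
  shows "linear_map S A B f"
  using assms by (auto simp: linear_map_def)

lemma linear_map_closed: "\<lbrakk>linear_map S A B f; x \<in> carrier A\<rbrakk> \<Longrightarrow> f x \<in> carrier B"
  by (auto simp: linear_map_def)

lemma linear_map_add:
  "\<lbrakk>linear_map S A B f; x \<in> carrier A; y \<in> carrier A\<rbrakk> \<Longrightarrow> f (x \<oplus>\<^bsub>A\<^esub> y) = f x \<oplus>\<^bsub>B\<^esub> f y"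
  by (auto simp: linear_map_def)

lemma linear_map_smult:
  "\<lbrakk>linear_map S A B f; r \<in> carrier S; x \<in> carrier A\<rbrakk> \<Longrightarrow> f (r \<odot>\<^bsub>A\<^esub> x) = r \<odot>\<^bsub>B\<^esub> f x"
  by (auto simp: linear_map_def)

lemma lmodule_ring: "lmodule S A \<Longrightarrow> ring S"
  by (simp add: lmodule_def)

lemma (in lmodule) smult_l_null [simp]:
  assumes "x \<in> carrier M" shows "\<zero> \<odot>\<^bsub>M\<^esub> x = \<zero>\<^bsub>M\<^esub>"
proof -
  have "\<zero> \<odot>\<^bsub>M\<^esub> x \<oplus>\<^bsub>M\<^esub> \<zero> \<odot>\<^bsub>M\<^esub> x = \<zero> \<odot>\<^bsub>M\<^esub> x"
    using assms smult_l_distr[of \<zero> \<zero> x] by simp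
  then show ?thesis using assms by (simp add: M.add.r_cancel_one')
qed

lemma (in lmodule) smult_r_null [simp]:
  assumes "a \<in> carrier R" shows "a \<odot>\<^bsub>M\<^esub> \<zero>\<^bsub>M\<^esub> = \<zero>\<^bsub>M\<^esub>"
proof -
  have "a \<odot>\<^bsub>M\<^esub> \<zero>\<^bsub>M\<^esub> \<oplus>\<^bsub>M\<^esub> a \<odot>\<^bsub>M\<^esub> \<zero>\<^bsub>M\<^esub> = a \<odot>\<^bsub>M\<^esub> \<zero>\<^bsub>M\<^esub>"
    using assms smult_r_distr[of a "\<zero>\<^bsub>M\<^esub>" "\<zero>\<^bsub>M\<^esub>"] by simp
  then show ?thesis using assms by (simp add: M.add.r_cancel_one')
qed

lemma (in lmodule) smult_r_minus:
  assumes "a \<in> carrier R" "x \<in> carrier M" shows "a \<odot>\<^bsub>M\<^esub> (\<ominus>\<^bsub>M\<^esub> x) = \<ominus>\<^bsub>M\<^esub> (a \<odot>\<^bsub>M\<^esub> x)"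
proof -
  have "a \<odot>\<^bsub>M\<^esub> (\<ominus>\<^bsub>M\<^esub> x) \<oplus>\<^bsub>M\<^esub> a \<odot>\<^bsub>M\<^esub> x = \<zero>\<^bsub>M\<^esub>"
    using assms by (simp add: smult_r_distr[symmetric] M.l_neg)
  then show ?thesis
    using assms by (simp add: M.minus_equality)
qed

lemma linear_map_zero:
  assumes "lmodule S A" "lmodule S B" "linear_map S A B f"
  shows "f \<zero>\<^bsub>A\<^esub> = \<zero>\<^bsub>B\<^esub>"
proof -
  interpret A: lmodule S A by fact
  interpret B: lmodule S B by fact
  have "f \<zero>\<^bsub>A\<^esub> \<oplus>\<^bsub>B\<^esub> f \<zero>\<^bsub>A\<^esub> = f \<zero>\<^bsub>A\<^esub>"
    using linear_map_add[OF assms(3), of "\<zero>\<^bsub>A\<^esub>" "\<zero>\<^bsub>A\<^esub>"] by simp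
  then show ?thesis using linear_map_closed[OF assms(3)] by (simp add: B.M.add.r_cancel_one')
qed

lemma linear_map_uminus:
  assumes "lmodule S A" "lmodule S B" "linear_map S A B f" "x \<in> carrier A"
  shows "f (\<ominus>\<^bsub>A\<^esub> x) = \<ominus>\<^bsub>B\<^esub> f x"
proof -
  interpret A: lmodule S A by fact
  interpret B: lmodule S B by fact
  have "f (\<ominus>\<^bsub>A\<^esub> x) \<oplus>\<^bsub>B\<^esub> f x = \<zero>\<^bsub>B\<^esub>"
    using assms(4) linear_map_zero[OF assms(1-3)]
    by (simp add: linear_map_add[OF assms(3), symmetric] A.M.l_neg)
  then show ?thesis using assms(4) linear_map_closed[OF assms(3)] by (simp add: B.M.minus_equality)
qed

lemma linear_map_minus:
  assumes "lmodule S A" "lmodule S B" "linear_map S A B f" "x \<in> carrier A" "y \<in> carrier A"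
  shows "f (x \<ominus>\<^bsub>A\<^esub> y) = f x \<ominus>\<^bsub>B\<^esub> f y"
proof -
  interpret A: lmodule S A by fact
  show ?thesis
    using assms(4,5) by (simp add: a_minus_def linear_map_add[OF assms(3)] linear_map_uminus[OF assms(1-3)])
qed

lemma linear_map_comp:
  "\<lbrakk>linear_map S A B f; linear_map S B C g\<rbrakk> \<Longrightarrow> linear_map S A C (\<lambda>x. g (f x))"
  by (auto simp: linear_map_def Pi_def)

lemma linear_map_ident: "linear_map S A A (\<lambda>x. x)"
  by (auto simp: linear_map_def)

lemma linear_map_inv_into:
  assumes "lmodule S A" "linear_map S A B f" "bij_betw f (carrier A) (carrier B)"
  shows "linear_map S B A (inv_into (carrier A) f)"
proof (rule linear_mapI)
  interpret A: lmodule S A by fact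
  let ?g = "inv_into (carrier A) f"
  have g: "?g y \<in> carrier A" "f (?g y) = y" if "y \<in> carrier B" for y
    using assms(3) that by (auto simp: bij_betw_def f_inv_into_f inv_into_into)
  have gf: "?g (f x) = x" if "x \<in> carrier A" for x
    using assms(3) that by (auto simp: bij_betw_def)
  fix x y assume x: "x \<in> carrier B" and y: "y \<in> carrier B"
  show "?g x \<in> carrier A" using g x by simp
  have "?g (f (?g x \<oplus>\<^bsub>A\<^esub> ?g y)) = ?g x \<oplus>\<^bsub>A\<^esub> ?g y" using g x y gf by simp
  then show "?g (x \<oplus>\<^bsub>B\<^esub> y) = ?g x \<oplus>\<^bsub>A\<^esub> ?g y"
    using linear_map_add[OF assms(2)] g x y by simp
next
  interpret A: lmodule S A by fact
  let ?g = "inv_into (carrier A) f"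
  fix r x assume r: "r \<in> carrier S" and "x \<in> carrier B"
  then have g: "?g x \<in> carrier A" "f (?g x) = x"
    using assms(3) by (auto simp: bij_betw_def f_inv_into_f inv_into_into)
  have "?g (f (r \<odot>\<^bsub>A\<^esub> ?g x)) = r \<odot>\<^bsub>A\<^esub> ?g x"
    using assms(3) g r by (auto simp: bij_betw_def)
  then show "?g (r \<odot>\<^bsub>B\<^esub> x) = r \<odot>\<^bsub>A\<^esub> ?g x"
    using linear_map_smult[OF assms(2) r] g by simp
qed

lemma linear_map_cong:
  assumes "lmodule S A" "\<And>x. x \<in> carrier A \<Longrightarrow> f x = g x"
  shows "linear_map S A B f \<longleftrightarrow> linear_map S A B g"
proof -
  interpret A: lmodule S A by fact
  show ?thesis by (auto simp: linear_map_def assms(2) Pi_def)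
qed

lemma linear_map_const_zero:
  assumes "lmodule S B" shows "linear_map S A B (\<lambda>x. \<zero>\<^bsub>B\<^esub>)"
proof -
  interpret B: lmodule S B by fact
  show ?thesis by (auto intro!: linear_mapI)
qed

lemma linear_map_plus:
  assumes "lmodule S B" "linear_map S A B f" "linear_map S A B g"
  shows "linear_map S A B (\<lambda>x. f x \<oplus>\<^bsub>B\<^esub> g x)"
proof -
  interpret B: lmodule S B by fact
  show ?thesis
    by (rule linear_mapI) (simp_all add: assms(2,3)[THEN linear_map_closed] assms(2,3)[THEN linear_map_add]
        assms(2,3)[THEN linear_map_smult] B.smult_r_distr B.M.a_ac)
qed

lemma linear_map_diff:
  assumes "lmodule S B" "linear_map S A B f" "linear_map S A B g"
  shows "linear_map S A B (\<lambda>x. f x \<ominus>\<^bsub>B\<^esub> g x)"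
proof -
  interpret B: lmodule S B by fact
  show ?thesis
    by (rule linear_mapI) (simp_all add: assms(2,3)[THEN linear_map_closed] assms(2,3)[THEN linear_map_add]
        assms(2,3)[THEN linear_map_smult] B.smult_r_distr B.smult_r_minus B.M.a_ac a_minus_def B.M.minus_add)
qed

lemma (in lmodule) smult_finsum:
  assumes "f \<in> X \<rightarrow> carrier M" "r \<in> carrier R"
  shows "r \<odot>\<^bsub>M\<^esub> finsum M f X = finsum M (\<lambda>i. r \<odot>\<^bsub>M\<^esub> f i) X"
  using assms(1)
proof (induction X rule: infinite_finite_induct)
  case (insert i X)
  then have "finsum M f X \<in> carrier M" "f i \<in> carrier M" by auto
  with insert show ?case using assms(2) by (simp add: Pi_def smult_r_distr)
qed (use assms(2) in \<open>auto\<close>)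

lemma linear_map_finsum:
  assumes "lmodule S A" "lmodule S B" "linear_map S A B f" "g \<in> X \<rightarrow> carrier A"
  shows "f (finsum A g X) = finsum B (\<lambda>i. f (g i)) X"
proof -
  interpret A: lmodule S A by fact
  interpret B: lmodule S B by fact
  show ?thesis using assms(4)
  proof (induction X rule: infinite_finite_induct)
    case (insert i X)
    then have "finsum A g X \<in> carrier A" "g i \<in> carrier A" by auto
    with insert show ?case
      using linear_map_add[OF assms(3)] by (simp add: Pi_def linear_map_closed[OF assms(3)])
  qed (use linear_map_zero[OF assms(1-3)] in auto)
qed

lemma lmodule_regular:
  assumes "ring S" shows "lmodule S (regular_module S)"
proof -
  interpret ring S by fact
  have "\<exists>y\<in>carrier S. y \<oplus>\<^bsub>S\<^esub> x = \<zero>\<^bsub>S\<^esub>" if "x \<in> carrier S" for x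
    using that l_neg by blast
  then show ?thesis
    by (intro lmodule.intro lmodule_axioms.intro abelian_groupI)
      (simp_all add: regular_module_def a_ac l_distr r_distr m_assoc ring_axioms)
qed

text \<open>The sum runs over the support of \<open>c\<close> since \<open>finsum\<close> over an
  infinite set is zero by default. With \<open>y\<close> the identity on the carrier this is the
  canonical map from the free module on the carrier of \<open>W\<close> onto
  \<open>W\<close>.\<close>

definition lin_comb ::
  "('r, 'e) ring_scheme \<Rightarrow> ('r, 'a) module \<Rightarrow> ('x \<Rightarrow> 'a) \<Rightarrow> ('x \<Rightarrow> 'r) \<Rightarrow> 'a" where
  "lin_comb S W y c = finsum W (\<lambda>p. c p \<odot>\<^bsub>W\<^esub> y p) {p. c p \<noteq> \<zero>\<^bsub>S\<^esub>}"

lemma lin_comb_superset: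
  assumes "lmodule S W" "finite F" "{p. c p \<noteq> \<zero>\<^bsub>S\<^esub>} \<subseteq> F"
    "\<And>p. p \<in> F \<Longrightarrow> c p \<in> carrier S" "\<And>p. p \<in> F \<Longrightarrow> y p \<in> carrier W"
  shows "lin_comb S W y c = finsum W (\<lambda>p. c p \<odot>\<^bsub>W\<^esub> y p) F"
proof -
  interpret W: lmodule S W by fact
  show ?thesis unfolding lin_comb_def
    by (rule W.M.add.finprod_mono_neutral_cong_left) (use assms in auto)
qed

lemma lmodule_free:
  assumes "ring S" shows "lmodule S (free_module S X)"
proof -
  interpret ring S by fact
  have fin: "finite {x. a x \<oplus>\<^bsub>S\<^esub> b x \<noteq> \<zero>\<^bsub>S\<^esub>}" if "finite {x. a x \<noteq> \<zero>\<^bsub>S\<^esub>}"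
    "finite {x. b x \<noteq> \<zero>\<^bsub>S\<^esub>}" for a b :: "_ \<Rightarrow> _"
    by (rule finite_subset[of _ "{x. a x \<noteq> \<zero>\<^bsub>S\<^esub>} \<union> {x. b x \<noteq> \<zero>\<^bsub>S\<^esub>}"]) (use that in auto)
  have fin2: "finite {x. c \<otimes>\<^bsub>S\<^esub> a x \<noteq> \<zero>\<^bsub>S\<^esub>}" if "finite {x. a x \<noteq> \<zero>\<^bsub>S\<^esub>}" "c \<in> carrier S" for a :: "_ \<Rightarrow> _" and c
    by (rule finite_subset[of _ "{x. a x \<noteq> \<zero>\<^bsub>S\<^esub>}"]) (use that in auto)
  have mem: "a x \<in> carrier S" if "a \<in> carrier (free_module S X)" for a x
    using that by (cases "x \<in> X") (auto simp: free_module_def)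
  have neg: "\<exists>b \<in> carrier (free_module S X). b \<oplus>\<^bsub>free_module S X\<^esub> a = \<zero>\<^bsub>free_module S X\<^esub>"
    if a: "a \<in> carrier (free_module S X)" for a
  proof (intro bexI[of _ "\<lambda>x. \<ominus>\<^bsub>S\<^esub> a x"])
    show "(\<lambda>x. \<ominus>\<^bsub>S\<^esub> a x) \<oplus>\<^bsub>free_module S X\<^esub> a = \<zero>\<^bsub>free_module S X\<^esub>"
      using mem[OF a] by (auto simp: free_module_def l_neg)
    have "finite {x. \<ominus>\<^bsub>S\<^esub> a x \<noteq> \<zero>\<^bsub>S\<^esub>}"
      by (rule finite_subset[of _ "{x. a x \<noteq> \<zero>\<^bsub>S\<^esub>}"]) (use a in \<open>auto simp: free_module_def\<close>)
    then show "(\<lambda>x. \<ominus>\<^bsub>S\<^esub> a x) \<in> carrier (free_module S X)"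
      using a by (auto simp: free_module_def)
  qed
  let ?F = "free_module S X"
  show ?thesis
  proof (intro lmodule.intro lmodule_axioms.intro abelian_groupI)
    show "\<And>a b. \<lbrakk>a \<in> carrier S; b \<in> carrier (free_module S X)\<rbrakk> \<Longrightarrow>
      a \<odot>\<^bsub>free_module S X\<^esub> b \<in> carrier (free_module S X)"
      using fin2 by (auto simp: free_module_def)
    show "\<And>a b. \<lbrakk>a \<in> carrier (free_module S X); b \<in> carrier (free_module S X)\<rbrakk> \<Longrightarrow>
      a \<oplus>\<^bsub>free_module S X\<^esub> b \<in> carrier (free_module S X)"
      using fin by (auto simp: free_module_def)
    show "\<zero>\<^bsub>free_module S X\<^esub> \<in> carrier (free_module S X)"
      by (auto simp: free_module_def)
    show "\<exists>b\<in>carrier (free_module S X). b \<oplus>\<^bsub>free_module S X\<^esub> a = \<zero>\<^bsub>free_module S X\<^esub>"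
      if "a \<in> carrier (free_module S X)" for a by (rule neg[OF that])
    show "ring S" by fact
  next
    fix a b c assume "a \<in> carrier ?F" "b \<in> carrier ?F" "c \<in> carrier ?F"
    note m = mem[OF this(1)] mem[OF this(2)] mem[OF this(3)]
    show "a \<oplus>\<^bsub>?F\<^esub> b \<oplus>\<^bsub>?F\<^esub> c = a \<oplus>\<^bsub>?F\<^esub> (b \<oplus>\<^bsub>?F\<^esub> c)"
      using m by (simp add: free_module_def a_assoc)
  next
    fix a b assume "a \<in> carrier ?F" "b \<in> carrier ?F"
    note m = mem[OF this(1)] mem[OF this(2)]
    show "a \<oplus>\<^bsub>?F\<^esub> b = b \<oplus>\<^bsub>?F\<^esub> a"
      using m by (simp add: free_module_def a_comm)
    fix r assume "r \<in> carrier S"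
    then show "r \<odot>\<^bsub>?F\<^esub> (a \<oplus>\<^bsub>?F\<^esub> b) = r \<odot>\<^bsub>?F\<^esub> a \<oplus>\<^bsub>?F\<^esub> r \<odot>\<^bsub>?F\<^esub> b"
      using m by (simp add: free_module_def r_distr)
  next
    fix a assume "a \<in> carrier ?F"
    note m = mem[OF this]
    show "\<zero>\<^bsub>?F\<^esub> \<oplus>\<^bsub>?F\<^esub> a = a" "\<one>\<^bsub>S\<^esub> \<odot>\<^bsub>?F\<^esub> a = a"
      using m by (simp_all add: free_module_def)
    fix r s assume "r \<in> carrier S" "s \<in> carrier S"
    then show "(r \<oplus>\<^bsub>S\<^esub> s) \<odot>\<^bsub>?F\<^esub> a = r \<odot>\<^bsub>?F\<^esub> a \<oplus>\<^bsub>?F\<^esub> s \<odot>\<^bsub>?F\<^esub> a"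
      "(r \<otimes>\<^bsub>S\<^esub> s) \<odot>\<^bsub>?F\<^esub> a = r \<odot>\<^bsub>?F\<^esub> (s \<odot>\<^bsub>?F\<^esub> a)"
      using m by (simp_all add: free_module_def l_distr m_assoc)
  qed
qed

lemma free_mem: "\<lbrakk>ring S; a \<in> carrier (free_module S X)\<rbrakk> \<Longrightarrow> a x \<in> carrier S"
  using ring.ring_simprules(2) by (cases "x \<in> X") (fastforce simp: free_module_def)+

lemma free_gen_closed: "\<lbrakk>ring S; x \<in> X\<rbrakk> \<Longrightarrow> free_gen S x \<in> carrier (free_module S X)"
  using ring.ring_simprules(2,6)[of S]
  by (auto simp: free_module_def free_gen_def intro: rev_finite_subset[of "{x}"])

text \<open>Existence half of the universal property of a free module: \<open>lin_comb_gen\<close>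
  shows that the map extends \<open>y\<close>, and \<open>linear_eq_on_free\<close> is the
  uniqueness half.\<close>

lemma lin_comb_linear:
  assumes "lmodule S W" "\<And>x. x \<in> X \<Longrightarrow> y x \<in> carrier W"
  shows "linear_map S (free_module S X) W (lin_comb S W y)"
proof (rule linear_mapI)
  interpret W: lmodule S W by fact
  let ?F = "free_module S X"
  have S: "ring S" by (rule W.R.ring_axioms)
  have mem: "\<And>a x. a \<in> carrier ?F \<Longrightarrow> a x \<in> carrier S" using free_mem[OF S] .
  have sup: "\<And>a. a \<in> carrier ?F \<Longrightarrow> {x. a x \<noteq> \<zero>\<^bsub>S\<^esub>} \<subseteq> X \<and> finite {x. a x \<noteq> \<zero>\<^bsub>S\<^esub>}"
    by (auto simp: free_module_def)
  fix a b assume a: "a \<in> carrier ?F" and b: "b \<in> carrier ?F"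
  show "lin_comb S W y a \<in> carrier W"
    unfolding lin_comb_def using mem[OF a] sup[OF a] assms(2) by (intro W.M.finsum_closed) auto
  \<comment> \<open>Cancellation can make the support of the sum differ from the supports of
    \<open>a\<close> and \<open>b\<close>, so all three sums are taken over the union and compared
    by \<open>lin_comb_superset\<close>.\<close>
  define Q where "Q = {x. a x \<noteq> \<zero>\<^bsub>S\<^esub>} \<union> {x. b x \<noteq> \<zero>\<^bsub>S\<^esub>}"
  have Q: "finite Q" "Q \<subseteq> X" using sup[OF a] sup[OF b] by (auto simp: Q_def)
  have ab: "(a \<oplus>\<^bsub>?F\<^esub> b) x = a x \<oplus>\<^bsub>S\<^esub> b x" for x by (simp add: free_module_def)
  have "lin_comb S W y (a \<oplus>\<^bsub>?F\<^esub> b) = finsum W (\<lambda>p. (a \<oplus>\<^bsub>?F\<^esub> b) p \<odot>\<^bsub>W\<^esub> y p) Q"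
    by (rule lin_comb_superset[OF assms(1) Q(1)]) (use mem[OF a] mem[OF b] Q assms(2) in \<open>auto simp: ab Q_def\<close>)
  also have "\<dots> = finsum W (\<lambda>p. a p \<odot>\<^bsub>W\<^esub> y p \<oplus>\<^bsub>W\<^esub> b p \<odot>\<^bsub>W\<^esub> y p) Q"
    using mem[OF a] mem[OF b] Q assms(2)
    by (intro W.M.finsum_cong') (auto simp: ab W.smult_l_distr Pi_def subset_iff)
  also have "\<dots> = finsum W (\<lambda>p. a p \<odot>\<^bsub>W\<^esub> y p) Q \<oplus>\<^bsub>W\<^esub> finsum W (\<lambda>p. b p \<odot>\<^bsub>W\<^esub> y p) Q"
    using mem[OF a] mem[OF b] Q assms(2) by (intro W.M.finsum_addf) (auto simp: Pi_def subset_iff)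
  also have "finsum W (\<lambda>p. a p \<odot>\<^bsub>W\<^esub> y p) Q = lin_comb S W y a"
    by (rule lin_comb_superset[OF assms(1) Q(1), symmetric]) (use mem[OF a] Q assms(2) in \<open>auto simp: Q_def\<close>)
  also have "finsum W (\<lambda>p. b p \<odot>\<^bsub>W\<^esub> y p) Q = lin_comb S W y b"
    by (rule lin_comb_superset[OF assms(1) Q(1), symmetric]) (use mem[OF b] Q assms(2) in \<open>auto simp: Q_def\<close>)
  finally show "lin_comb S W y (a \<oplus>\<^bsub>?F\<^esub> b) = lin_comb S W y a \<oplus>\<^bsub>W\<^esub> lin_comb S W y b" .
next
  interpret W: lmodule S W by fact
  let ?F = "free_module S X"
  have S: "ring S" by (rule W.R.ring_axioms)
  fix r a assume r: "r \<in> carrier S" and a: "a \<in> carrier ?F"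
  define Q where "Q = {x. a x \<noteq> \<zero>\<^bsub>S\<^esub>}"
  have Q: "finite Q" "Q \<subseteq> X" using a by (auto simp: free_module_def Q_def)
  have ra: "(r \<odot>\<^bsub>?F\<^esub> a) x = r \<otimes>\<^bsub>S\<^esub> a x" for x by (simp add: free_module_def)
  have "lin_comb S W y (r \<odot>\<^bsub>?F\<^esub> a) = finsum W (\<lambda>p. (r \<odot>\<^bsub>?F\<^esub> a) p \<odot>\<^bsub>W\<^esub> y p) Q"
    by (rule lin_comb_superset[OF assms(1) Q(1)]) (use free_mem[OF S a] r Q assms(2) in \<open>auto simp: ra Q_def\<close>)
  also have "\<dots> = finsum W (\<lambda>p. r \<odot>\<^bsub>W\<^esub> (a p \<odot>\<^bsub>W\<^esub> y p)) Q"
    using free_mem[OF S a] r Q assms(2) by (intro W.M.finsum_cong') (auto simp: ra W.smult_assoc1 Pi_def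
      subset_iff)
  also have "\<dots> = r \<odot>\<^bsub>W\<^esub> lin_comb S W y a"
    unfolding lin_comb_def Q_def[symmetric]
    using free_mem[OF S a] r Q assms(2) by (intro W.smult_finsum[symmetric]) (auto simp: Pi_def subset_iff)
  finally show "lin_comb S W y (r \<odot>\<^bsub>?F\<^esub> a) = r \<odot>\<^bsub>W\<^esub> lin_comb S W y a" .
qed

lemma lin_comb_gen:
  assumes "lmodule S W" "y x \<in> carrier W"
  shows "lin_comb S W y (free_gen S x) = y x"
proof -
  interpret W: lmodule S W by fact
  have "lin_comb S W y (free_gen S x) = finsum W (\<lambda>p. free_gen S x p \<odot>\<^bsub>W\<^esub> y p) {x}"
    by (rule lin_comb_superset[OF assms(1)]) (use assms in \<open>auto simp: free_gen_def\<close>)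
  also have "\<dots> = y x" using assms by (simp add: free_gen_def)
  finally show ?thesis .
qed

lemma free_expand:
  assumes "ring S" "a \<in> carrier (free_module S X)"
  shows "lin_comb S (free_module S X) (free_gen S) a = a"
proof -
  let ?F = "free_module S X"
  interpret F: lmodule S ?F by (rule lmodule_free) fact
  define Q where "Q = {x. a x \<noteq> \<zero>\<^bsub>S\<^esub>}"
  have Q: "finite Q" "Q \<subseteq> X" using assms(2) by (auto simp: free_module_def Q_def)
  note mem = free_mem[OF assms]
  have gen: "p \<in> Q \<Longrightarrow> free_gen S p \<in> carrier ?F" for p
    using free_gen_closed[OF assms(1), of p X] Q by auto
  \<comment> \<open>A partial sum over a subset of the support is \<open>a\<close> truncated to that
    subset; the case of the whole support is the claim.\<close>
  have ind: "finsum ?F (\<lambda>p. a p \<odot>\<^bsub>?F\<^esub> free_gen S p) Q' = (\<lambda>x. if x \<in> Q' then a x else \<zero>\<^bsub>S\<^esub>)"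
    if "finite Q'" "Q' \<subseteq> Q" for Q'
    using that
  proof (induction rule: finite_induct)
    case empty
    then show ?case by (simp only: F.M.finsum_empty) (simp add: free_module_def)
  next
    case (insert i Q')
    have "finsum ?F (\<lambda>p. a p \<odot>\<^bsub>?F\<^esub> free_gen S p) (insert i Q')
      = a i \<odot>\<^bsub>?F\<^esub> free_gen S i \<oplus>\<^bsub>?F\<^esub> finsum ?F (\<lambda>p. a p \<odot>\<^bsub>?F\<^esub> free_gen S p) Q'"
      using insert gen mem by (intro F.M.finsum_insert) (auto simp: Pi_def)
    also have "\<dots> = (\<lambda>x. if x \<in> insert i Q' then a x else \<zero>\<^bsub>S\<^esub>)"
      using insert mem by (auto simp: free_module_def free_gen_def fun_eq_iff)
    finally show ?case .
  qed
  show ?thesis unfolding lin_comb_def Q_def[symmetric] using ind[OF Q(1)] by (auto simp: Q_def)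
qed

lemma linear_map_lin_comb:
  assumes "lmodule S A" "lmodule S B" "linear_map S A B f"
    "a \<in> carrier (free_module S X)" "\<And>x. x \<in> X \<Longrightarrow> y x \<in> carrier A"
  shows "f (lin_comb S A y a) = lin_comb S B (\<lambda>x. f (y x)) a"
proof -
  interpret A: lmodule S A by fact
  interpret B: lmodule S B by fact
  have X: "{x. a x \<noteq> \<zero>\<^bsub>S\<^esub>} \<subseteq> X" using assms(4) by (auto simp: free_module_def)
  note mem = free_mem[OF A.R.ring_axioms assms(4)]
  have c: "p \<in> {x. a x \<noteq> \<zero>\<^bsub>S\<^esub>} \<Longrightarrow> y p \<in> carrier A" for p using X assms(5) by auto
  show ?thesis unfolding lin_comb_def
    using c mem linear_map_closed[OF assms(3)]
    by (subst linear_map_finsum[OF assms(1-3)]) (auto simp: linear_map_smult[OF assms(3)] intro!: B.M.finsum_cong')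
qed

lemma linear_eq_on_free:
  assumes "lmodule S B" "linear_map S (free_module S X) B f" "linear_map S (free_module S X) B g"
    "\<And>x. x \<in> X \<Longrightarrow> f (free_gen S x) = g (free_gen S x)" "a \<in> carrier (free_module S X)"
  shows "f a = g a"
proof -
  have S: "ring S" using assms(1) lmodule_ring by blast
  note F = lmodule_free[OF S, of X]
  have "f a = lin_comb S B (\<lambda>x. f (free_gen S x)) a"
    using linear_map_lin_comb[OF F assms(1,2,5), of "free_gen S", OF free_gen_closed[OF S]]
    by (simp add: free_expand[OF S assms(5)])
  also have "\<dots> = lin_comb S B (\<lambda>x. g (free_gen S x)) a"
  proof -
    interpret B: lmodule S B by fact
    have X: "{x. a x \<noteq> \<zero>\<^bsub>S\<^esub>} \<subseteq> X" using assms(5) by (auto simp: free_module_def)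
    have "g (free_gen S x) \<in> carrier B" if "x \<in> X" for x
      using linear_map_closed[OF assms(3)] free_gen_closed[OF S that] by blast
    then show ?thesis
      unfolding lin_comb_def using X assms(4) free_mem[OF S assms(5)]
      by (intro B.M.finsum_cong') (auto simp: subset_iff)
  qed
  also have "\<dots> = g a"
    using linear_map_lin_comb[OF F assms(1,3,5), of "free_gen S", OF free_gen_closed[OF S]]
    by (simp add: free_expand[OF S assms(5)])
  finally show ?thesis .
qed

section \<open>Projective modules\<close>

lemma lin_comb_cong:
  assumes "lmodule S A" "a \<in> carrier (free_module S X)"
    "\<And>x. x \<in> X \<Longrightarrow> y x = z x" "\<And>x. x \<in> X \<Longrightarrow> z x \<in> carrier A"
  shows "lin_comb S A y a = lin_comb S A z a"
proof -
  interpret A: lmodule S A by fact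
  have "{x. a x \<noteq> \<zero>\<^bsub>S\<^esub>} \<subseteq> X" using assms(2) by (auto simp: free_module_def)
  then show ?thesis
    unfolding lin_comb_def using assms(3,4) free_mem[OF A.R.ring_axioms assms(2)]
    by (intro A.M.finsum_cong') (auto simp: subset_iff)
qed

text \<open>Transport of structure along a map that is injective on the carrier. It carries a module
  into the type over which \<open>projective\<close> and \<open>semi_projective\<close>
  quantify.\<close>

definition copy_module :: "('a \<Rightarrow> 'b) \<Rightarrow> ('r, 'a) module \<Rightarrow> ('r, 'b) module" where
  "copy_module e A = (let d = inv_into (carrier A) e in
     \<lparr>carrier = e ` carrier A, mult = undefined, one = undefined, zero = e \<zero>\<^bsub>A\<^esub>,
      add = (\<lambda>x y. e (d x \<oplus>\<^bsub>A\<^esub> d y)), smult = (\<lambda>r x. e (r \<odot>\<^bsub>A\<^esub> d x))\<rparr>)"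

lemma copy_module:
  assumes "lmodule S A" "inj_on e (carrier A)"
  shows lmodule_copy: "lmodule S (copy_module e A)"
    and linear_copy: "linear_map S A (copy_module e A) e"
    and linear_copy_inv: "linear_map S (copy_module e A) A (inv_into (carrier A) e)"
proof -
  interpret A: lmodule S A by fact
  have e: "inv_into (carrier A) e (e x) = x" if "x \<in> carrier A" for x
    using assms(2) that by simp
  have neg: "\<exists>y\<in>e ` carrier A. e (inv_into (carrier A) e y \<oplus>\<^bsub>A\<^esub> inv_into (carrier A) e x) = e \<zero>\<^bsub>A\<^esub>"
    if x: "x \<in> e ` carrier A" for x
  proof -
    from x obtain a where a: "a \<in> carrier A" "x = e a" by auto
    show ?thesis
      by (rule bexI[of _ "e (\<ominus>\<^bsub>A\<^esub> a)"]) (use a e in \<open>auto simp: A.M.l_neg\<close>)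
  qed
  have neg2: "\<exists>y\<in>carrier A. e (x \<oplus>\<^bsub>A\<^esub> y) = e \<zero>\<^bsub>A\<^esub>" if "x \<in> carrier A" for x
    by (rule bexI[of _ "\<ominus>\<^bsub>A\<^esub> x"]) (use that in \<open>auto simp: A.M.r_neg\<close>)
  show "lmodule S (copy_module e A)"
    by (intro lmodule.intro lmodule_axioms.intro abelian_groupI A.R.ring_axioms)
      (auto simp: copy_module_def Let_def e A.M.a_ac A.smult_l_distr A.smult_r_distr A.smult_assoc1 neg neg2)
  show "linear_map S A (copy_module e A) e"
    by (rule linear_mapI) (auto simp: copy_module_def Let_def e)
  show "linear_map S (copy_module e A) A (inv_into (carrier A) e)"
    by (rule linear_mapI) (auto simp: copy_module_def Let_def e)
qed

lemma carrier_copy [simp]: "carrier (copy_module e A) = e ` carrier A"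
  by (simp add: copy_module_def Let_def)

lemma zero_copy: "\<zero>\<^bsub>copy_module e A\<^esub> = e \<zero>\<^bsub>A\<^esub>"
  by (simp add: copy_module_def Let_def)

text \<open>Over a nonzero ring \<open>x\<close> can be read off from the indicator function of the
  word \<open>[x]\<close>; over the zero ring a module has one element and a constant map will
  do.\<close>

lemma ex_embedding:
  fixes A :: "('r, 'a) module"
  assumes "lmodule S A"
  shows "\<exists>e :: 'a \<Rightarrow> 'a list \<Rightarrow> 'r. inj_on e (carrier A)"
proof -
  interpret A: lmodule S A by fact
  show ?thesis
  proof (cases "\<one>\<^bsub>S\<^esub> = \<zero>\<^bsub>S\<^esub>")
    case True
    have "x = \<zero>\<^bsub>A\<^esub>" if "x \<in> carrier A" for x
      using A.smult_one[OF that] A.smult_l_null[OF that] True by simp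
    then have "inj_on (\<lambda>x l. undefined) (carrier A)" by (auto simp: inj_on_def)
    then show ?thesis by blast
  next
    case False
    have "inj_on (\<lambda>x. free_gen S [x]) (carrier A)"
    proof (rule inj_onI)
      fix x y assume "free_gen S [x] = free_gen S [y]"
      then have "free_gen S [x] [x] = free_gen S [y] [x]" by simp
      with False show "x = y" by (auto simp: free_gen_def split: if_splits)
    qed
    then show ?thesis by blast
  qed
qed

lemma projective_lmodule: "projective S P \<Longrightarrow> lmodule S P"
  by (simp add: projective_def)

text \<open>The canonical map from the free module on the carrier of \<open>P\<close> onto
  \<open>P\<close> splits, and \<open>q\<close> is a splitting: the coordinates
  \<open>\<lambda>x. q x p\<close> are functionals, finitely many of them nonzero at each
  \<open>x\<close>. The later uses of projectivity rest on this form, which mentions no type of test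
  modules.\<close>

lemma dual_basis:
  fixes P :: "('r, 'p) module"
  assumes "projective S P"
  obtains q where "linear_map S P (free_module S (carrier P)) q"
    "\<And>x. x \<in> carrier P \<Longrightarrow> lin_comb S P (\<lambda>p. p) (q x) = x"
proof -
  have P: "lmodule S P" by (rule projective_lmodule) fact
  then have S: "ring S" by (rule lmodule_ring)
  obtain e :: "'p \<Rightarrow> 'p list \<Rightarrow> 'r" where e: "inj_on e (carrier P)"
    using ex_embedding[OF P] by blast
  \<comment> \<open>Naming the basis element \<open>p\<close> by the one-letter word
    \<open>[p]\<close> puts the free module into the type of the test modules. The map
    \<open>e\<close> does the same for \<open>P\<close>, and \<open>r\<close> below takes the words
    off again.\<close>
  define F where "F = free_module S ((\<lambda>p. [p]) ` carrier P)"
  define B where "B = copy_module e P"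
  have F: "lmodule S F" unfolding F_def by (rule lmodule_free[OF S])
  have B: "lmodule S B" "linear_map S P B e" "linear_map S B P (inv_into (carrier P) e)"
    unfolding B_def by (rule copy_module[OF P e])+
  have l: "linear_map S F P (lin_comb S P hd)"
    unfolding F_def by (rule lin_comb_linear[OF P]) auto
  have g: "linear_map S F B (\<lambda>a. e (lin_comb S P hd a))"
    by (rule linear_map_comp[OF l B(2)])
  have surj: "(\<lambda>a. e (lin_comb S P hd a)) ` carrier F = carrier B"
  proof
    show "(\<lambda>a. e (lin_comb S P hd a)) ` carrier F \<subseteq> carrier B"
      using linear_map_closed[OF g] by auto
    show "carrier B \<subseteq> (\<lambda>a. e (lin_comb S P hd a)) ` carrier F"
    proof
      fix x assume "x \<in> carrier B"
      then obtain p where p: "p \<in> carrier P" "x = e p" by (auto simp: B_def)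
      have "e (lin_comb S P hd (free_gen S [p])) = x"
        using p by (simp add: lin_comb_gen[OF P])
      then show "x \<in> (\<lambda>a. e (lin_comb S P hd a)) ` carrier F"
        using free_gen_closed[OF S, of "[p]" "(\<lambda>p. [p]) ` carrier P"] p by (force simp: F_def)
    qed
  qed
  obtain h where h: "linear_map S P F h" "\<And>x. x \<in> carrier P \<Longrightarrow> e (lin_comb S P hd (h x)) = e x"
    using assms[unfolded projective_def, THEN conjunct2, rule_format, OF
      conjI[OF F conjI[OF B(1) conjI[OF g conjI[OF surj B(2)]]]]]
    by blast
  have hx: "lin_comb S P hd (h x) = x" if "x \<in> carrier P" for x
    using h(2)[OF that] e linear_map_closed[OF l] linear_map_closed[OF h(1)] that by (auto dest: inj_onD)
  define r where "r = (\<lambda>(a :: 'p list \<Rightarrow> 'r) p. a [p])"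
  interpret S: ring S by fact
  have r: "linear_map S F (free_module S (carrier P)) r"
  proof (rule linear_mapI)
    fix a assume a: "a \<in> carrier F"
    have "finite ((\<lambda>p. [p]) -` {x. a x \<noteq> \<zero>\<^bsub>S\<^esub>})"
      using a by (intro finite_vimageI) (auto simp: F_def free_module_def inj_on_def)
    then show "r a \<in> carrier (free_module S (carrier P))"
      using a by (auto simp: F_def free_module_def r_def vimage_def image_iff)
  qed (auto simp: F_def free_module_def r_def)
  have "lin_comb S P (\<lambda>p. p) (r a) = lin_comb S P hd a" if "a \<in> carrier F" for a
  proof -
    show ?thesis
    proof (rule linear_eq_on_free[OF P _ l[unfolded F_def] _ that[unfolded F_def],
          where f = "\<lambda>a. lin_comb S P (\<lambda>p. p) (r a)"])
      show "linear_map S (free_module S ((\<lambda>p. [p]) ` carrier P)) P (\<lambda>a. lin_comb S P (\<lambda>p. p) (r a))"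
        using linear_map_comp[OF r lin_comb_linear[OF P, of "carrier P" "\<lambda>p. p"]] by (simp add: F_def)
      fix x assume "x \<in> (\<lambda>p. [p]) ` carrier P"
      then obtain p where p: "p \<in> carrier P" "x = [p]" by auto
      have "r (free_gen S [p]) = free_gen S p" by (auto simp: r_def free_gen_def)
      then show "lin_comb S P (\<lambda>p. p) (r (free_gen S x)) = lin_comb S P hd (free_gen S x)"
        using p by (simp add: lin_comb_gen[OF P])
    qed
  qed
  then show thesis
    using that[OF linear_map_comp[OF h(1) r]] hx linear_map_closed[OF h(1)] by simp
qed

text \<open>A lift can be written down with a dual basis: choose preimages under \<open>g\<close> of
  the values of \<open>f\<close> and extend linearly. So the modules may lie in any types, and it is
  enough that \<open>g\<close> reaches the values of \<open>f\<close>.\<close>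

lemma projective_lift:
  assumes "projective S P" "lmodule S A" "lmodule S B" "linear_map S A B g" "linear_map S P B f"
    "\<And>x. x \<in> carrier P \<Longrightarrow> f x \<in> g ` carrier A"
  obtains h where "linear_map S P A h" "\<And>x. x \<in> carrier P \<Longrightarrow> g (h x) = f x"
proof -
  have P: "lmodule S P" by (rule projective_lmodule) fact
  obtain q where q: "linear_map S P (free_module S (carrier P)) q"
    "\<And>x. x \<in> carrier P \<Longrightarrow> lin_comb S P (\<lambda>p. p) (q x) = x"
    using dual_basis[OF assms(1)] by blast
  have "\<forall>x\<in>carrier P. \<exists>y\<in>carrier A. g y = f x" using assms(6) by fastforce
  then obtain y where y: "\<And>x. x \<in> carrier P \<Longrightarrow> y x \<in> carrier A \<and> g (y x) = f x" by metis
  have l: "linear_map S (free_module S (carrier P)) A (lin_comb S A y)"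
    by (rule lin_comb_linear[OF assms(2)]) (use y in blast)
  show thesis
  proof (rule that[OF linear_map_comp[OF q(1) l]])
    fix x assume x: "x \<in> carrier P"
    note qx = linear_map_closed[OF q(1) x]
    have "g (lin_comb S A y (q x)) = lin_comb S B (\<lambda>p. g (y p)) (q x)"
      by (rule linear_map_lin_comb[OF assms(2-4) qx]) (use y in blast)
    also have "\<dots> = lin_comb S B f (q x)"
      by (rule lin_comb_cong[OF assms(3) qx]) (use y linear_map_closed[OF assms(5)] in auto)
    also have "\<dots> = f (lin_comb S P (\<lambda>p. p) (q x))"
      by (rule linear_map_lin_comb[OF P assms(3,5) qx, symmetric])
    finally show "g (lin_comb S A y (q x)) = f x" using q(2)[OF x] by simp
  qed
qed

text \<open>Lift \<open>f\<close> after \<open>r\<close> and restrict the lift along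
  \<open>i\<close>. The applications are the cycles of degree 0 of a semi-projective resolution and
  the regular module.\<close>

lemma projective_retract:
  fixes P :: "('r, 'p) module" and Q :: "('r, 'q) module"
  assumes "projective S P" "lmodule S Q" "linear_map S Q P i" "linear_map S P Q r"
    "\<And>x. x \<in> carrier Q \<Longrightarrow> r (i x) = x"
  shows "projective S Q"
  unfolding projective_def
proof (intro conjI allI impI assms(2), elim conjE)
  fix A B :: "('r, 'q list \<Rightarrow> 'r) module" and g f
  assume h: "lmodule S A" "lmodule S B" "linear_map S A B g" "g ` carrier A = carrier B" "linear_map S Q B f"
  obtain k where k: "linear_map S P A k" "\<And>x. x \<in> carrier P \<Longrightarrow> g (k x) = f (r x)"
    using projective_lift[OF assms(1) h(1-3) linear_map_comp[OF assms(4) h(5)]] h(4)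
      linear_map_closed[OF linear_map_comp[OF assms(4) h(5)]] by metis
  show "\<exists>h. linear_map S Q A h \<and> (\<forall>x\<in>carrier Q. g (h x) = f x)"
    using linear_map_comp[OF assms(3) k(1)] k(2) linear_map_closed[OF assms(3)] assms(5) by metis
qed

lemma projective_free:
  fixes S :: "('r, 'e) ring_scheme" and X :: "'x set"
  assumes "ring S" shows "projective S (free_module S X)"
  unfolding projective_def
proof (intro conjI allI impI lmodule_free assms, elim conjE)
  let ?F = "free_module S X"
  fix A B :: "('r, ('x \<Rightarrow> 'r) list \<Rightarrow> 'r) module" and g f
  assume h: "lmodule S A" "lmodule S B" "linear_map S A B g" "g ` carrier A = carrier B" "linear_map S ?F B f"
  have "\<forall>x\<in>X. \<exists>y\<in>carrier A. g y = f (free_gen S x)"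
    using h(4) linear_map_closed[OF h(5)] free_gen_closed[OF assms] by (metis imageE)
  then obtain y where y: "\<And>x. x \<in> X \<Longrightarrow> y x \<in> carrier A \<and> g (y x) = f (free_gen S x)" by metis
  have l: "linear_map S ?F A (lin_comb S A y)"
    by (rule lin_comb_linear[OF h(1)]) (use y in blast)
  have "g (lin_comb S A y a) = f a" if "a \<in> carrier ?F" for a
  proof (rule linear_eq_on_free[OF h(2) linear_map_comp[OF l h(3)] h(5) _ that])
    fix x assume x: "x \<in> X"
    have "lin_comb S A y (free_gen S x) = y x" by (rule lin_comb_gen[OF h(1)]) (use y x in blast)
    then show "g (lin_comb S A y (free_gen S x)) = f (free_gen S x)" using y x by simp
  qed
  then show "\<exists>h. linear_map S ?F A h \<and> (\<forall>x\<in>carrier ?F. g (h x) = f x)"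
    using l by blast
qed

lemma projective_regular:
  assumes "ring S" shows "projective S (regular_module S)"
proof (rule projective_retract[OF projective_free[OF assms, of "UNIV :: unit set"] lmodule_regular[OF assms],
      where i = "\<lambda>r x. r" and r = "\<lambda>a. a ()"])
qed (auto intro!: linear_mapI simp: free_module_def regular_module_def)

section \<open>Submodules\<close>

lemma (in lmodule) minus_eq_zero_iff:
  assumes "x \<in> carrier M" "y \<in> carrier M"
  shows "x \<ominus>\<^bsub>M\<^esub> y = \<zero>\<^bsub>M\<^esub> \<longleftrightarrow> x = y"
  using assms by (metis a_minus_def M.minus_equality M.minus_minus M.r_neg M.a_inv_closed)

lemma (in lmodule) submodule_iff:
  "submodule H R M \<longleftrightarrow> H \<subseteq> carrier M \<and> \<zero>\<^bsub>M\<^esub> \<in> H \<and> (\<forall>x\<in>H. \<forall>y\<in>H. x \<oplus>\<^bsub>M\<^esub> y \<in> H) \<and>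
     (\<forall>r\<in>carrier R. \<forall>x\<in>H. r \<odot>\<^bsub>M\<^esub> x \<in> H)" (is "_ = ?r")
proof
  assume "submodule H R M"
  then show ?r
    by (auto simp: submodule_def submodule_axioms_def subgroup_def)
next
  assume r: ?r
  \<comment> \<open>\<open>subgroup\<close> asks for negatives; they come from multiplication by
    \<open>\<ominus> \<one>\<close>.\<close>
  have neg: "\<ominus>\<^bsub>M\<^esub> x \<in> H" if "x \<in> H" for x
  proof -
    have x: "x \<in> carrier M" using that r by blast
    have "(\<ominus> \<one>) \<odot>\<^bsub>M\<^esub> x \<oplus>\<^bsub>M\<^esub> x = (\<ominus> \<one> \<oplus> \<one>) \<odot>\<^bsub>M\<^esub> x"
      using x by (simp add: smult_l_distr del: R.l_neg)
    also have "\<dots> = \<zero>\<^bsub>M\<^esub>" using x by (simp add: R.l_neg)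
    finally have "\<ominus>\<^bsub>M\<^esub> x = (\<ominus> \<one>) \<odot>\<^bsub>M\<^esub> x" using x by (simp add: M.minus_equality)
    then show ?thesis using r that by simp
  qed
  show "submodule H R M"
    using r neg unfolding submodule_def submodule_axioms_def subgroup_def a_inv_def[symmetric] by auto
qed

lemma (in lmodule) submodule_minus:
  assumes "submodule H R M" "x \<in> H" "y \<in> H" shows "x \<ominus>\<^bsub>M\<^esub> y \<in> H"
proof -
  have "\<ominus>\<^bsub>M\<^esub> y \<in> H"
    using subgroup.m_inv_closed[OF submodule.axioms(1)[OF assms(1)] assms(3)] by (simp add: a_inv_def)
  then show ?thesis using assms by (simp add: submodule_iff a_minus_def)
qed

lemma (in lmodule) lmodule_submodule:
  assumes "submodule H R M" shows "lmodule R (M\<lparr>carrier := H\<rparr>)"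
proof -
  have H: "H \<subseteq> carrier M" and c: "\<zero>\<^bsub>M\<^esub> \<in> H" "\<And>x y. \<lbrakk>x \<in> H; y \<in> H\<rbrakk> \<Longrightarrow> x \<oplus>\<^bsub>M\<^esub> y \<in> H"
    "\<And>r x. \<lbrakk>r \<in> carrier R; x \<in> H\<rbrakk> \<Longrightarrow> r \<odot>\<^bsub>M\<^esub> x \<in> H"
    using assms by (auto simp: submodule_iff)
  have i: "\<And>x. x \<in> H \<Longrightarrow> x \<in> carrier M" using H by blast
  have neg: "\<exists>y\<in>H. y \<oplus>\<^bsub>M\<^esub> x = \<zero>\<^bsub>M\<^esub>" if "x \<in> H" for x
    using submodule_minus[OF assms c(1) that] i[OF that] by (auto intro!: bexI simp: a_minus_def M.l_neg)
  show ?thesis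
    by (intro lmodule.intro lmodule_axioms.intro abelian_groupI R.ring_axioms)
      (simp_all add: c i neg M.a_assoc smult_l_distr smult_r_distr smult_assoc1, simp add: i M.a_comm)
qed

lemma linear_map_into_submodule:
  "\<lbrakk>linear_map S A B f; \<And>x. x \<in> carrier A \<Longrightarrow> f x \<in> H\<rbrakk> \<Longrightarrow> linear_map S A (B\<lparr>carrier := H\<rparr>) f"
  by (auto simp: linear_map_def)

lemma linear_map_restrict:
  "\<lbrakk>linear_map S A B f; H \<subseteq> carrier A\<rbrakk> \<Longrightarrow> linear_map S (A\<lparr>carrier := H\<rparr>) B f"
  by (auto simp: linear_map_def subset_iff)

lemma submodule_image:
  assumes "lmodule S A" "lmodule S B" "linear_map S A B f"
  shows "submodule (f ` carrier A) S B"
proof -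
  interpret A: lmodule S A by fact
  interpret B: lmodule S B by fact
  show ?thesis unfolding B.submodule_iff
    using linear_map_closed[OF assms(3)] linear_map_zero[OF assms]
    by (auto simp: linear_map_add[OF assms(3), symmetric] linear_map_smult[OF assms(3), symmetric]
        intro: image_eqI[of _ _ "\<zero>\<^bsub>A\<^esub>"])
qed

lemma submodule_kernel:
  assumes "lmodule S A" "lmodule S B" "linear_map S A B f"
  shows "submodule {x \<in> carrier A. f x = \<zero>\<^bsub>B\<^esub>} S A"
proof -
  interpret A: lmodule S A by fact
  interpret B: lmodule S B by fact
  show ?thesis unfolding A.submodule_iff
    using linear_map_closed[OF assms(3)] linear_map_zero[OF assms]
    by (auto simp: linear_map_add[OF assms(3)] linear_map_smult[OF assms(3)])
qed

lemma module_span_least: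
  "\<lbrakk>submodule H S A; X \<subseteq> H\<rbrakk> \<Longrightarrow> module_span S A X \<subseteq> H"
  by (auto simp: module_span_def)

lemma module_span_superset: "X \<subseteq> module_span S A X"
  by (auto simp: module_span_def)

lemma submodule_span:
  assumes "lmodule S A" "X \<subseteq> carrier A" shows "submodule (module_span S A X) S A"
proof -
  interpret A: lmodule S A by fact
  have "submodule (carrier A) S A" by (simp add: A.submodule_iff)
  then show ?thesis
    unfolding A.submodule_iff module_span_def using assms(2) by (auto 4 3 simp: A.submodule_iff)
qed

section \<open>Quotients\<close>

lemma (in lmodule) abelian_subgroup_submodule:
  assumes "submodule H R M" shows "abelian_subgroup H M"
  using submodule.axioms(1)[OF assms] M.abelian_group_axioms
  by (intro abelian_subgroupI3) (auto simp: additive_subgroup_def)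

lemma (in lmodule) quot_eq_iff:
  assumes "submodule H R M" "x \<in> carrier M" "y \<in> carrier M"
  shows "H +>\<^bsub>M\<^esub> x = H +>\<^bsub>M\<^esub> y \<longleftrightarrow> x \<ominus>\<^bsub>M\<^esub> y \<in> H"
proof -
  interpret H: abelian_subgroup H M by (rule abelian_subgroup_submodule) fact
  have "H +>\<^bsub>M\<^esub> x = H +>\<^bsub>M\<^esub> y \<longleftrightarrow> x \<in> H +>\<^bsub>M\<^esub> y"
    using H.a_repr_independence' H.a_rcos_self assms(2,3) by blast
  also have "\<dots> \<longleftrightarrow> x \<ominus>\<^bsub>M\<^esub> y \<in> H"
    using H.a_rcos_module[OF assms(3,2)] by (simp add: a_minus_def)
  finally show ?thesis .
qed

lemma (in lmodule) coset_mem_iff: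
  assumes "submodule H R M" "x \<in> carrier M"
  shows "y \<in> H +>\<^bsub>M\<^esub> x \<longleftrightarrow> y \<in> carrier M \<and> H +>\<^bsub>M\<^esub> y = H +>\<^bsub>M\<^esub> x"
proof -
  interpret H: abelian_subgroup H M by (rule abelian_subgroup_submodule) fact
  show ?thesis
    using H.a_repr_independence' H.a_rcos_self assms(2) H.a_elemrcos_carrier by metis
qed

lemma (in lmodule) coset_eq_iff:
  assumes "submodule H R M" "x \<in> carrier M"
  shows "H +>\<^bsub>M\<^esub> x = H \<longleftrightarrow> x \<in> H"
proof -
  interpret H: abelian_subgroup H M by (rule abelian_subgroup_submodule) fact
  show ?thesis using H.a_rcos_const H.a_rcos_self[OF assms(2)] by blast
qed

lemma carrier_quot: "carrier (quot_module M H) = (\<lambda>x. H +>\<^bsub>M\<^esub> x) ` carrier M"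
  by (auto simp: quot_module_def A_RCOSETS_def')

lemma zero_quot: "\<zero>\<^bsub>quot_module M H\<^esub> = H"
  by (simp add: quot_module_def)

text \<open>\<open>quot_module\<close> and \<open>coset_map\<close> are written as unions over all
  representatives. When \<open>f\<close> respects the congruence, all members of the union are the
  same coset; this is the usual well-definedness.\<close>

lemma (in lmodule) Union_cosets:
  assumes "submodule H R M" "submodule H' S N" "lmodule S N" "x \<in> carrier M"
    "\<And>z. z \<in> carrier M \<Longrightarrow> f z \<in> carrier N"
    "\<And>z. z \<in> carrier M \<Longrightarrow> H +>\<^bsub>M\<^esub> z = H +>\<^bsub>M\<^esub> x \<Longrightarrow> f z \<ominus>\<^bsub>N\<^esub> f x \<in> H'"
  shows "(\<Union>z\<in>H +>\<^bsub>M\<^esub> x. H' +>\<^bsub>N\<^esub> f z) = H' +>\<^bsub>N\<^esub> f x"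
proof -
  have "H' +>\<^bsub>N\<^esub> f z = H' +>\<^bsub>N\<^esub> f x" if "z \<in> H +>\<^bsub>M\<^esub> x" for z
    using that lmodule.quot_eq_iff[OF assms(3,2)] assms(4,5,6)
    unfolding coset_mem_iff[OF assms(1,4)] by metis
  moreover have "x \<in> H +>\<^bsub>M\<^esub> x" using assms(4) by (simp add: coset_mem_iff[OF assms(1)])
  ultimately show ?thesis by blast
qed

lemma quot_module:
  assumes "lmodule S A" "submodule H S A"
  shows lmodule_quot: "lmodule S (quot_module A H)"
    and linear_quot: "linear_map S A (quot_module A H) (\<lambda>x. H +>\<^bsub>A\<^esub> x)"
proof -
  interpret A: lmodule S A by fact
  interpret H: abelian_subgroup H A by (rule A.abelian_subgroup_submodule) fact
  let ?Q = "quot_module A H" and ?p = "\<lambda>x. H +>\<^bsub>A\<^esub> x"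
  have add: "?p x \<oplus>\<^bsub>?Q\<^esub> ?p y = ?p (x \<oplus>\<^bsub>A\<^esub> y)" if "x \<in> carrier A" "y \<in> carrier A" for x y
    using H.a_rcos_sum[OF that] by (simp add: quot_module_def)
  have smult: "r \<odot>\<^bsub>?Q\<^esub> ?p x = ?p (r \<odot>\<^bsub>A\<^esub> x)" if "r \<in> carrier S" "x \<in> carrier A" for r x
  proof -
    have "(\<Union>z\<in>H +>\<^bsub>A\<^esub> x. H +>\<^bsub>A\<^esub> (r \<odot>\<^bsub>A\<^esub> z)) = H +>\<^bsub>A\<^esub> (r \<odot>\<^bsub>A\<^esub> x)"
    proof (rule A.Union_cosets[OF assms(2) assms(2) assms(1) that(2)])
      fix z assume z: "z \<in> carrier A" "H +>\<^bsub>A\<^esub> z = H +>\<^bsub>A\<^esub> x"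
      then have "z \<ominus>\<^bsub>A\<^esub> x \<in> H" using A.quot_eq_iff[OF assms(2)] that by blast
      then have "r \<odot>\<^bsub>A\<^esub> (z \<ominus>\<^bsub>A\<^esub> x) \<in> H" using assms(2) that by (simp add: A.submodule_iff)
      then show "r \<odot>\<^bsub>A\<^esub> z \<ominus>\<^bsub>A\<^esub> r \<odot>\<^bsub>A\<^esub> x \<in> H"
        using that z by (simp add: a_minus_def A.smult_r_distr A.smult_r_minus)
    qed (use that in auto)
    then show ?thesis by (simp add: quot_module_def)
  qed
  have zero: "\<zero>\<^bsub>?Q\<^esub> = ?p \<zero>\<^bsub>A\<^esub>"
    using H.a_rcos_const[of "\<zero>\<^bsub>A\<^esub>"] by (simp add: zero_quot)
  have neg: "\<exists>y\<in>carrier ?Q. y \<oplus>\<^bsub>?Q\<^esub> x = \<zero>\<^bsub>?Q\<^esub>" if x: "x \<in> carrier ?Q" for x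
  proof -
    from x obtain a where a: "a \<in> carrier A" "x = ?p a" by (auto simp: carrier_quot)
    show ?thesis
      by (rule bexI[of _ "?p (\<ominus>\<^bsub>A\<^esub> a)"]) (use a in \<open>auto simp: add zero carrier_quot A.M.l_neg\<close>)
  qed
  show "lmodule S ?Q"
  proof (intro lmodule.intro lmodule_axioms.intro abelian_groupI A.R.ring_axioms)
    show "\<And>x. x \<in> carrier ?Q \<Longrightarrow> \<exists>y\<in>carrier ?Q. y \<oplus>\<^bsub>?Q\<^esub> x = \<zero>\<^bsub>?Q\<^esub>" by (rule neg)
  qed (auto simp: carrier_quot add smult zero A.smult_l_distr A.smult_r_distr A.smult_assoc1 A.M.a_ac)
  show "linear_map S A ?Q ?p"
    by (rule linear_mapI) (auto simp: carrier_quot add smult)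
qed

lemma coset_map_coset:
  assumes "lmodule S A" "lmodule S B" "submodule H S A" "submodule H' S B" "linear_map S A B f"
    "f ` H \<subseteq> H'" "x \<in> carrier A"
  shows "coset_map B H' f (H +>\<^bsub>A\<^esub> x) = H' +>\<^bsub>B\<^esub> f x"
  unfolding coset_map_def
proof (rule lmodule.Union_cosets[OF assms(1,3,4,2,7)])
  fix z assume z: "z \<in> carrier A" "H +>\<^bsub>A\<^esub> z = H +>\<^bsub>A\<^esub> x"
  then have "z \<ominus>\<^bsub>A\<^esub> x \<in> H" using lmodule.quot_eq_iff[OF assms(1,3)] assms(7) by blast
  then have "f (z \<ominus>\<^bsub>A\<^esub> x) \<in> H'" using assms(6) by blast
  then show "f z \<ominus>\<^bsub>B\<^esub> f x \<in> H'"
    using linear_map_minus[OF assms(1,2,5) z(1) assms(7)] by simp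
qed (rule linear_map_closed[OF assms(5)])

lemma quot_lift:
  assumes "lmodule S A" "lmodule S B" "submodule H S A" "linear_map S A B f"
    "\<And>x. x \<in> H \<Longrightarrow> f x = \<zero>\<^bsub>B\<^esub>"
  obtains g where "linear_map S (quot_module A H) B g"
    "\<And>x. x \<in> carrier A \<Longrightarrow> g (H +>\<^bsub>A\<^esub> x) = f x"
proof -
  interpret A: lmodule S A by fact
  interpret B: lmodule S B by fact
  let ?Q = "quot_module A H" and ?p = "\<lambda>x. H +>\<^bsub>A\<^esub> x"
  define g where "g X = f (SOME x. x \<in> X)" for X
  have g: "g (?p x) = f x" if x: "x \<in> carrier A" for x
  proof -
    have "x \<in> ?p x" by (simp add: A.coset_mem_iff[OF assms(3) x] x)
    then have s: "(SOME z. z \<in> ?p x) \<in> ?p x" by (rule someI)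
    then have "(SOME z. z \<in> ?p x) \<ominus>\<^bsub>A\<^esub> x \<in> H" and c: "(SOME z. z \<in> ?p x) \<in> carrier A"
      using A.coset_mem_iff[OF assms(3) x] A.quot_eq_iff[OF assms(3) _ x] by auto
    then have "g (?p x) \<ominus>\<^bsub>B\<^esub> f x = \<zero>\<^bsub>B\<^esub>"
      unfolding g_def using assms(5) linear_map_minus[OF assms(1,2,4) c x] by simp
    then show ?thesis
      using linear_map_closed[OF assms(4)] c x by (simp add: g_def B.minus_eq_zero_iff)
  qed
  note lin = linear_quot[OF assms(1,3)]
  have "linear_map S ?Q B g"
    by (rule linear_mapI) (auto simp: carrier_quot g linear_map_closed[OF assms(4)]
        linear_map_add[OF lin, symmetric] linear_map_smult[OF lin, symmetric]
        linear_map_add[OF assms(4)] linear_map_smult[OF assms(4)])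
  then show thesis using that g by blast
qed

section \<open>Total acyclicity\<close>

lemma lmodule_zero_carrier: "lmodule S A \<Longrightarrow> lmodule S (A\<lparr>carrier := {\<zero>\<^bsub>A\<^esub>}\<rparr>)"
  by (rule lmodule.lmodule_submodule) (auto simp: lmodule.submodule_iff lmodule_def abelian_group_def
      abelian_monoid.zero_closed abelian_monoid.l_zero lmodule.smult_r_null)

lemma lmodule_stalk:
  assumes "lmodule S A" shows "lmodule S (obj (stalk A) i)"
  using assms lmodule_zero_carrier[OF assms] by (simp add: stalk_def)

lemma zero_stalk [simp]: "\<zero>\<^bsub>obj (stalk A) i\<^esub> = \<zero>\<^bsub>A\<^esub>"
  by (simp add: stalk_def)

lemma hom_zero_linear:
  assumes "lmodule S A" "lmodule S B"
  shows "linear_map S A B (\<lambda>x\<in>carrier A. \<zero>\<^bsub>B\<^esub>)"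
  using linear_map_const_zero[OF assms(2)]
  by (subst linear_map_cong[OF assms(1)]) auto

text \<open>Placed in one degree of \<open>Hom(T, X)\<close>, \<open>v\<close> is a cycle because it
  kills boundaries. It bounds by total acyclicity, and the component at \<open>i\<close> of a
  bounding family is \<open>u\<close> up to sign. Here \<open>X\<close> still lies in the type over
  which \<open>totally_acyclic\<close> quantifies.\<close>

lemma totally_acyclic_factor_aux:
  fixes S :: "('k, 'r) module" and T :: "('r, 't) mcomplex" and X :: "('r, 't list \<Rightarrow> 'r) module"
  assumes T: "totally_acyclic S T" and X: "projective S X"
    and v: "linear_map S (obj T (i + 1)) X v"
    and vd: "\<And>x. x \<in> carrier (obj T (i + 2)) \<Longrightarrow> v (bd T (i + 2) x) = \<zero>\<^bsub>X\<^esub>"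
  obtains u where "linear_map S (obj T i) X u"
    "\<And>x. x \<in> carrier (obj T (i + 1)) \<Longrightarrow> v x = u (bd T (i + 1) x)"
proof -
  have lX: "lmodule S X" by (rule projective_lmodule) fact
  have cT: "lmodule S (obj T j)" "linear_map S (obj T j) (obj T (j - 1)) (bd T j)" for j
    using T by (simp_all add: totally_acyclic_def chain_complex_def)
  have bdc: "x \<in> carrier (obj T j) \<Longrightarrow> bd T j x \<in> carrier (obj T (j - 1))" for j x
    using linear_map_closed[OF cT(2)] .
  \<comment> \<open>The stalk sits in degree 0 and component \<open>j\<close> of a family of degree
    \<open>n\<close> ends in degree \<open>j + n\<close>, so \<open>n = -(i + 1)\<close> makes
    component \<open>i + 1\<close> take values in \<open>X\<close>. A bounding family has degree
    \<open>n + 1\<close>, and it is its component at \<open>i\<close> that takes values in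
    \<open>X\<close>.\<close>
  define n where "n = - i - 1"
  define H where "H = hom_complex S T (stalk X)"
  define f where "f j = (if j = i + 1 then (\<lambda>x\<in>carrier (obj T j). v x) else (\<lambda>x\<in>carrier (obj T j). \<zero>\<^bsub>X\<^esub>))" for j
  have z: "\<zero>\<^bsub>X\<^esub> \<ominus>\<^bsub>obj (stalk X) j\<^esub> \<zero>\<^bsub>X\<^esub> = \<zero>\<^bsub>X\<^esub>" "\<zero>\<^bsub>X\<^esub> \<oplus>\<^bsub>obj (stalk X) j\<^esub> \<zero>\<^bsub>X\<^esub> = \<zero>\<^bsub>X\<^esub>" for j
  proof -
    interpret lmodule S "obj (stalk X) j" by (rule lmodule_stalk[OF lX])
    show "\<zero>\<^bsub>X\<^esub> \<ominus>\<^bsub>obj (stalk X) j\<^esub> \<zero>\<^bsub>X\<^esub> = \<zero>\<^bsub>X\<^esub>" "\<zero>\<^bsub>X\<^esub> \<oplus>\<^bsub>obj (stalk X) j\<^esub> \<zero>\<^bsub>X\<^esub> = \<zero>\<^bsub>X\<^esub>"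
      using minus_eq_zero_iff[of "\<zero>\<^bsub>obj (stalk X) j\<^esub>" "\<zero>\<^bsub>obj (stalk X) j\<^esub>"] M.l_zero[OF M.zero_closed]
        M.zero_closed by simp_all
  qed
  have "f \<in> cycles H n"
  proof -
    have "linear_map S (obj T j) (obj (stalk X) (j + n)) (f j)" for j
    proof (cases "j = i + 1")
      case True
      have "linear_map S (obj T (i + 1)) X (\<lambda>x\<in>carrier (obj T (i + 1)). v x)"
        using v by (subst linear_map_cong[OF cT(1), where g = v]) simp_all
      with True show ?thesis by (simp add: f_def n_def stalk_def)
    next
      case False
      then show ?thesis using hom_zero_linear[OF cT(1) lmodule_stalk[OF lX], of j "j + n"]
        by (simp add: f_def)
    qed
    then have "f \<in> carrier (obj H n)"
      by (auto simp: H_def hom_complex_def prod_module_def hom_module_def f_def)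
    moreover have "bd H n f = \<zero>\<^bsub>obj H (n - 1)\<^esub>"
    proof (rule ext, rule ext)
      fix j x
      have "f (j - 1) (bd T j x) = \<zero>\<^bsub>X\<^esub>" if "x \<in> carrier (obj T j)"
        using bdc[OF that] vd[of x] that by (auto simp: f_def algebra_simps)
      then show "bd H n f j x = \<zero>\<^bsub>obj H (n - 1)\<^esub> j x"
        by (simp add: H_def hom_complex_def prod_module_def hom_module_def z
          stalk_def[of X, THEN arg_cong[where f = bd], simplified])
    qed
    ultimately show ?thesis by (simp add: cycles_def a_kernel_def')
  qed
  also have "cycles H n = boundaries H n"
    using T X by (simp add: totally_acyclic_def acyclic_complex_def H_def)
  finally obtain g where g: "g \<in> carrier (obj H (n + 1))" "f = bd H (n + 1) g"
    by (auto simp: boundaries_def)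
  have gi: "linear_map S (obj T i) X (g i)"
    using g(1) by (auto simp: H_def hom_complex_def prod_module_def hom_module_def n_def stalk_def dest!:
      spec[of _ i])
  have sX: "obj (stalk X) 0 = X" by (simp add: stalk_def)
  \<comment> \<open>The differential of the stalk is zero, so only the term of the Hom differential
    with \<open>bd T\<close> survives. Its sign depends on the parity of \<open>n + 1\<close> and is
    absorbed into \<open>u\<close> below.\<close>
  have e: "v x = (if even (n + 1) then \<zero>\<^bsub>X\<^esub> \<ominus>\<^bsub>X\<^esub> g i (bd T (i + 1) x) else \<zero>\<^bsub>X\<^esub> \<oplus>\<^bsub>X\<^esub> g i (bd T (i + 1) x))"
    if x: "x \<in> carrier (obj T (i + 1))" for x
  proof -
    have "v x = f (i + 1) x" using x by (simp add: f_def)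
    also have "\<dots> = bd H (n + 1) g (i + 1) x" by (simp add: g(2))
    also have "\<dots> = (if even (n + 1) then \<zero>\<^bsub>X\<^esub> \<ominus>\<^bsub>X\<^esub> g i (bd T (i + 1) x) else \<zero>\<^bsub>X\<^esub> \<oplus>\<^bsub>X\<^esub> g i (bd T (i + 1) x))"
      using x by (simp add: H_def hom_complex_def n_def sX stalk_def[of X, THEN arg_cong[where f = bd],
        simplified])
    finally show ?thesis .
  qed
  show thesis
  proof (cases "even (n + 1)")
    case True
    then show thesis
      using that[OF linear_map_diff[OF lX linear_map_const_zero[OF lX] gi]] e by simp
  next
    case False
    then show thesis
      using that[OF linear_map_plus[OF lX linear_map_const_zero[OF lX] gi]] e by simp
  qed
qed

text \<open>An explicit cardinality bound: an element with number \<open>k\<close> in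
  \<open>B t\<close> is coded by the word of \<open>k + 1\<close> letters \<open>t\<close>. The
  successor keeps the word nonempty, so that its letter can be read off; an element of several
  \<open>B t\<close> uses one chosen \<open>t\<close>.\<close>

lemma ex_inj_words:
  fixes A :: "'a set" and B :: "'a \<Rightarrow> 'b set"
  assumes "\<And>t. t \<in> A \<Longrightarrow> finite (B t)"
  shows "\<exists>\<iota> :: 'b \<Rightarrow> 'a list. inj_on \<iota> (\<Union>t\<in>A. B t)"
proof -
  have "\<forall>t\<in>A. \<exists>f :: 'b \<Rightarrow> nat. inj_on f (B t)"
    using assms finite_imp_inj_to_nat_seg by metis
  then obtain f :: "'a \<Rightarrow> 'b \<Rightarrow> nat" where f: "\<And>t. t \<in> A \<Longrightarrow> inj_on (f t) (B t)" by metis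
  have "\<forall>p\<in>\<Union>t\<in>A. B t. \<exists>t\<in>A. p \<in> B t" by blast
  then obtain t where t: "\<And>p. p \<in> (\<Union>t\<in>A. B t) \<Longrightarrow> t p \<in> A \<and> p \<in> B (t p)" by metis
  have "inj_on (\<lambda>p. replicate (Suc (f (t p) p)) (t p)) (\<Union>t\<in>A. B t)"
  proof (rule inj_onI)
    fix p p' assume p: "p \<in> (\<Union>t\<in>A. B t)" "p' \<in> (\<Union>t\<in>A. B t)"
      and e: "replicate (Suc (f (t p) p)) (t p) = replicate (Suc (f (t p') p')) (t p')"
    then have "t p = t p'" "f (t p) p = f (t p') p'" by (auto simp: replicate_eq_replicate)
    then show "p = p'" using f t[OF p(1)] t[OF p(2)] by (metis inj_onD)
  qed
  then show ?thesis by blast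
qed

text \<open>
  By \<open>ex_inj_words\<close>, the basis elements occurring in the values of \<open>v\<close> can be indexed by words over
  \<open>'t\<close>, which reduces \<open>X\<close> to a free module in the type over which total acyclicity quantifies.
\<close>

lemma totally_acyclic_factor:
  fixes S :: "('k, 'r) module" and T :: "('r, 't) mcomplex" and X :: "('r, 'x) module"
  assumes T: "totally_acyclic S T" and X: "projective S X"
    and v: "linear_map S (obj T (i + 1)) X v"
    and vd: "\<And>x. x \<in> carrier (obj T (i + 2)) \<Longrightarrow> v (bd T (i + 2) x) = \<zero>\<^bsub>X\<^esub>"
  obtains u where "linear_map S (obj T i) X u"
    "\<And>x. x \<in> carrier (obj T (i + 1)) \<Longrightarrow> v x = u (bd T (i + 1) x)"
proof -
  have lX: "lmodule S X" by (rule projective_lmodule) fact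
  then have S: "ring S" by (rule lmodule_ring)
  interpret X: lmodule S X by fact
  obtain q where q: "linear_map S X (free_module S (carrier X)) q"
    "\<And>x. x \<in> carrier X \<Longrightarrow> lin_comb S X (\<lambda>p. p) (q x) = x"
    using dual_basis[OF X] by blast
  define C where "C = carrier (obj T (i + 1))"
  define B where "B t = {p. q (v t) p \<noteq> \<zero>\<^bsub>S\<^esub>}" for t
  have qv: "q (v t) \<in> carrier (free_module S (carrier X))" if "t \<in> C" for t
    using that linear_map_closed[OF q(1)] linear_map_closed[OF v] by (simp add: C_def)
  have B: "finite (B t)" "B t \<subseteq> carrier X" if "t \<in> C" for t
    using qv[OF that] by (auto simp: B_def free_module_def)
  define J where "J = (\<Union>t\<in>C. B t)"
  have J: "J \<subseteq> carrier X" using B by (auto simp: J_def)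
  obtain \<iota> :: "'x \<Rightarrow> 't list" where \<iota>: "inj_on \<iota> J"
    using ex_inj_words[of C B] B unfolding J_def by blast
  define F where "F = free_module S (\<iota> ` J)"
  define k where "k = inv_into J \<iota>"
  have k: "\<And>p. p \<in> J \<Longrightarrow> k (\<iota> p) = p" using \<iota> by (simp add: k_def)
  \<comment> \<open>\<open>r\<close> renames the basis elements in \<open>J\<close> and drops all
    others. In general it is not injective, but the coordinates of the values of \<open>v\<close>
    are supported in \<open>J\<close>, so \<open>lin_comb S X k\<close> recovers these
    values.\<close>
  define r where "r a = (\<lambda>l. if l \<in> \<iota> ` J then a (k l) else \<zero>\<^bsub>S\<^esub>)" for a :: "'x \<Rightarrow> 'r"
  have r: "linear_map S (free_module S (carrier X)) F r"
  proof (rule linear_mapI)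
    fix a assume a: "a \<in> carrier (free_module S (carrier X))"
    have fin: "finite {p. a p \<noteq> \<zero>\<^bsub>S\<^esub>}" using a by (simp add: free_module_def)
    have "{l. r a l \<noteq> \<zero>\<^bsub>S\<^esub>} \<subseteq> \<iota> ` {p. a p \<noteq> \<zero>\<^bsub>S\<^esub>}"
      using k by (auto simp: r_def)
    then have "finite {l. r a l \<noteq> \<zero>\<^bsub>S\<^esub>}"
      using finite_subset finite_imageI[OF fin] by blast
    then show "r a \<in> carrier F"
      using a J k by (auto simp: F_def free_module_def r_def subset_iff)
  qed (use X.R.r_null in \<open>auto simp: F_def free_module_def r_def\<close>)
  have v': "linear_map S (obj T (i + 1)) F (\<lambda>x. r (q (v x)))"
    by (rule linear_map_comp[OF linear_map_comp[OF v q(1)] r])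
  have lF: "lmodule S F" unfolding F_def by (rule lmodule_free[OF S])
  have "r (q \<zero>\<^bsub>X\<^esub>) = \<zero>\<^bsub>F\<^esub>"
    by (rule linear_map_zero[OF lX lF linear_map_comp[OF q(1) r]])
  then obtain u where u: "linear_map S (obj T i) F u"
    "\<And>x. x \<in> C \<Longrightarrow> r (q (v x)) = u (bd T (i + 1) x)"
    using totally_acyclic_factor_aux[OF T projective_free[OF S, of "\<iota> ` J"] v'[unfolded F_def]] vd
    unfolding F_def C_def by metis
  have l: "linear_map S F X (lin_comb S X k)"
    unfolding F_def by (rule lin_comb_linear[OF lX]) (use k J in auto)
  show thesis
  proof (rule that[OF linear_map_comp[OF u(1) l]])
    fix x assume "x \<in> carrier (obj T (i + 1))"
    then have x: "x \<in> C" by (simp add: C_def)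
    have BJ: "B x \<subseteq> J" using x by (auto simp: J_def)
    note qx = free_mem[OF S qv[OF x]]
    have rk: "r (q (v x)) (\<iota> p) = q (v x) p" if "p \<in> B x" for p
    proof -
      have "p \<in> J" using that BJ by blast
      then show ?thesis by (simp add: r_def k)
    qed
    have c: "(\<lambda>l. r (q (v x)) l \<odot>\<^bsub>X\<^esub> k l) \<in> \<iota> ` B x \<rightarrow> carrier X"
      using rk BJ k J qx by (auto simp: subset_iff)
    have "lin_comb S X k (r (q (v x))) = finsum X (\<lambda>l. r (q (v x)) l \<odot>\<^bsub>X\<^esub> k l) (\<iota> ` B x)"
      unfolding lin_comb_def
    proof (rule X.M.finsum_cong'[OF _ c refl])
      show "{l. r (q (v x)) l \<noteq> \<zero>\<^bsub>S\<^esub>} = \<iota> ` B x"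
      proof
        show "{l. r (q (v x)) l \<noteq> \<zero>\<^bsub>S\<^esub>} \<subseteq> \<iota> ` B x"
          using k by (auto simp: B_def r_def split: if_splits)
        show "\<iota> ` B x \<subseteq> {l. r (q (v x)) l \<noteq> \<zero>\<^bsub>S\<^esub>}"
          using rk by (auto simp: B_def)
      qed
    qed
    also have "\<dots> = finsum X (\<lambda>p. r (q (v x)) (\<iota> p) \<odot>\<^bsub>X\<^esub> k (\<iota> p)) (B x)"
      by (rule X.M.finsum_reindex[OF c inj_on_subset[OF \<iota> BJ]])
    also have "\<dots> = finsum X (\<lambda>p. q (v x) p \<odot>\<^bsub>X\<^esub> p) (B x)"
      using rk BJ k J qx by (intro X.M.finsum_cong') (auto simp: subset_iff)
    also have "\<dots> = v x"
      using q(2)[OF linear_map_closed[OF v, folded C_def, OF x]] by (simp add: lin_comb_def B_def)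
    finally show "v x = lin_comb S X k (u (bd T (i + 1) x))" using u(2)[OF x] by simp
  qed
qed

section \<open>Resolutions\<close>

text \<open>Exactness of \<open>... -> A 1 -> A 0 -> M -> 0\<close> with projective
  \<open>A k\<close>. Degrees in the natural numbers leave no room below 0 and allow recursion;
  \<open>d k\<close> leaves degree \<open>Suc k\<close>.\<close>

definition resolution :: "('r, 'e) ring_scheme \<Rightarrow> (nat \<Rightarrow> ('r, 'a) module) \<Rightarrow> (nat \<Rightarrow> 'a \<Rightarrow> 'a) \<Rightarrow>
    ('r, 'm) module \<Rightarrow> ('a \<Rightarrow> 'm) \<Rightarrow> bool" where
  "resolution S A d M \<epsilon> \<longleftrightarrow> lmodule S M \<and> (\<forall>k. projective S (A k)) \<and>
     (\<forall>k. linear_map S (A (Suc k)) (A k) (d k)) \<and> linear_map S (A 0) M \<epsilon> \<and>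
     \<epsilon> ` carrier (A 0) = carrier M \<and>
     {x \<in> carrier (A 0). \<epsilon> x = \<zero>\<^bsub>M\<^esub>} = d 0 ` carrier (A 1) \<and>
     (\<forall>k. {x \<in> carrier (A (Suc k)). d k x = \<zero>\<^bsub>A k\<^esub>} = d (Suc k) ` carrier (A (Suc (Suc k))))"

lemma resolutionD:
  assumes "resolution S A d M \<epsilon>"
  shows "lmodule S M" "projective S (A k)" "lmodule S (A k)" "linear_map S (A (Suc k)) (A k) (d k)"
    "linear_map S (A 0) M \<epsilon>" "\<epsilon> ` carrier (A 0) = carrier M"
    "x \<in> carrier (A (Suc 0)) \<Longrightarrow> \<epsilon> (d 0 x) = \<zero>\<^bsub>M\<^esub>"
    "y \<in> carrier (A 0) \<Longrightarrow> \<epsilon> y = \<zero>\<^bsub>M\<^esub> \<Longrightarrow> y \<in> d 0 ` carrier (A (Suc 0))"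
    "z \<in> carrier (A (Suc (Suc k))) \<Longrightarrow> d k (d (Suc k) z) = \<zero>\<^bsub>A k\<^esub>"
    "w \<in> carrier (A (Suc k)) \<Longrightarrow> d k w = \<zero>\<^bsub>A k\<^esub> \<Longrightarrow> w \<in> d (Suc k) ` carrier (A (Suc (Suc k)))"
proof -
  have 0: "{x \<in> carrier (A 0). \<epsilon> x = \<zero>\<^bsub>M\<^esub>} = d 0 ` carrier (A (Suc 0))"
    and k: "{x \<in> carrier (A (Suc k)). d k x = \<zero>\<^bsub>A k\<^esub>} = d (Suc k) ` carrier (A (Suc (Suc k)))"
    using assms by (auto simp: resolution_def)
  show "lmodule S M" "projective S (A k)" "linear_map S (A (Suc k)) (A k) (d k)"
    "linear_map S (A 0) M \<epsilon>" "\<epsilon> ` carrier (A 0) = carrier M"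
    using assms by (simp_all add: resolution_def)
  then show "lmodule S (A k)" using projective_lmodule by blast
  show "x \<in> carrier (A (Suc 0)) \<Longrightarrow> \<epsilon> (d 0 x) = \<zero>\<^bsub>M\<^esub>"
    "y \<in> carrier (A 0) \<Longrightarrow> \<epsilon> y = \<zero>\<^bsub>M\<^esub> \<Longrightarrow> y \<in> d 0 ` carrier (A (Suc 0))"
    using 0 by blast+
  show "z \<in> carrier (A (Suc (Suc k))) \<Longrightarrow> d k (d (Suc k) z) = \<zero>\<^bsub>A k\<^esub>"
    "w \<in> carrier (A (Suc k)) \<Longrightarrow> d k w = \<zero>\<^bsub>A k\<^esub> \<Longrightarrow> w \<in> d (Suc k) ` carrier (A (Suc (Suc k)))"
    using k by blast+
qed

text \<open>The comparison theorem over the identity of \<open>M\<close>: each component of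
  \<open>a\<close> lifts the preceding one along \<open>dB\<close>.\<close>

lemma resolution_lift:
  assumes A: "resolution S A dA M \<epsilon>A" and B: "resolution S B dB M \<epsilon>B"
  obtains a where "\<And>k. linear_map S (A k) (B k) (a k)"
    "\<And>x. x \<in> carrier (A 0) \<Longrightarrow> \<epsilon>B (a 0 x) = \<epsilon>A x"
    "\<And>k x. x \<in> carrier (A (Suc k)) \<Longrightarrow> a k (dA k x) = dB k (a (Suc k) x)"
proof -
  note A' = resolutionD[OF A] and B' = resolutionD[OF B]
  \<comment> \<open>Besides compatibility in degree \<open>n\<close>, the invariant contains the
    condition under which the next lift exists: \<open>a\<close> after \<open>dA n\<close> has
    values in the image of \<open>dB n\<close>. The relation \<open>Q\<close> holds the commuting
    square between consecutive choices.\<close>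
  define P where "P n a \<longleftrightarrow> linear_map S (A n) (B n) a \<and> (n = 0 \<longrightarrow> (\<forall>x\<in>carrier (A 0). \<epsilon>B (a x) = \<epsilon>A x)) \<and>
    (\<forall>x\<in>carrier (A (Suc n)). a (dA n x) \<in> dB n ` carrier (B (Suc n)))" for n a
  define Q where "Q n a a' \<longleftrightarrow> (\<forall>x\<in>carrier (A (Suc n)). a (dA n x) = dB n (a' x))" for n a a'
  have "\<exists>a. P 0 a"
  proof -
    obtain a where a: "linear_map S (A 0) (B 0) a" "\<And>x. x \<in> carrier (A 0) \<Longrightarrow> \<epsilon>B (a x) = \<epsilon>A x"
      using projective_lift[OF A'(2) B'(3) B'(1) B'(5) A'(5)] linear_map_closed[OF A'(5)] B'(6) by metis
    have "a (dA 0 x) \<in> dB 0 ` carrier (B (Suc 0))" if x: "x \<in> carrier (A (Suc 0))" for x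
      using linear_map_closed[OF A'(4) x] a(2) A'(7)[OF x] linear_map_closed[OF a(1)]
      by (intro B'(8)) auto
    then show ?thesis using a by (auto simp: P_def)
  qed
  moreover have "\<exists>a'. P (Suc n) a' \<and> Q n a a'" if "P n a" for n a
  proof -
    from that have a: "linear_map S (A n) (B n) a"
      "\<And>x. x \<in> carrier (A (Suc n)) \<Longrightarrow> a (dA n x) \<in> dB n ` carrier (B (Suc n))"
      by (auto simp: P_def)
    obtain a' where a': "linear_map S (A (Suc n)) (B (Suc n)) a'"
      "\<And>x. x \<in> carrier (A (Suc n)) \<Longrightarrow> dB n (a' x) = a (dA n x)"
      using projective_lift[OF A'(2) B'(3) B'(3) B'(4) linear_map_comp[OF A'(4) a(1)]] a(2) by metis
    have "a' (dA (Suc n) x) \<in> dB (Suc n) ` carrier (B (Suc (Suc n)))" if x: "x \<in> carrier (A (Suc (Suc n)))" for x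
    proof (rule B'(10))
      note c = linear_map_closed[OF A'(4) x]
      show "a' (dA (Suc n) x) \<in> carrier (B (Suc n))" by (rule linear_map_closed[OF a'(1) c])
      show "dB n (a' (dA (Suc n) x)) = \<zero>\<^bsub>B n\<^esub>"
        using a'(2)[OF c] A'(9)[OF x] linear_map_zero[OF A'(3) B'(3) a(1)] by simp
    qed
    then show ?thesis using a' by (auto simp: P_def Q_def)
  qed
  ultimately obtain a where "\<forall>n. P n (a n) \<and> Q n (a n) (a (Suc n))"
    using dependent_nat_choice[of P Q] by blast
  then show thesis
    using that[of a] by (simp add: P_def Q_def)
qed

text \<open>A chain map over the zero map of \<open>M\<close> is null-homotopic. Two neighbouring
  components of the homotopy are returned, the ones from which \<open>resolution_factor\<close>
  builds its factorization.\<close>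

lemma null_homotopy:
  assumes A: "resolution S A d M \<epsilon>"
    and c: "\<And>k. linear_map S (A k) (A k) (c k)"
      "\<And>k x. x \<in> carrier (A (Suc k)) \<Longrightarrow> c k (d k x) = d k (c (Suc k) x)"
      "\<And>x. x \<in> carrier (A 0) \<Longrightarrow> \<epsilon> (c 0 x) = \<zero>\<^bsub>M\<^esub>"
  shows "\<exists>h h'. linear_map S (A k) (A (Suc k)) h \<and> linear_map S (A (Suc k)) (A (Suc (Suc k))) h' \<and>
    (\<forall>x\<in>carrier (A (Suc k)). c (Suc k) x = h (d k x) \<oplus>\<^bsub>A (Suc k)\<^esub> d (Suc k) (h' x))"
proof -
  note A' = resolutionD[OF A]
  have step: "\<exists>h'. linear_map S (A (Suc k)) (A (Suc (Suc k))) h' \<and>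
      (\<forall>x\<in>carrier (A (Suc k)). c (Suc k) x = h (d k x) \<oplus>\<^bsub>A (Suc k)\<^esub> d (Suc k) (h' x))"
    if h: "linear_map S (A k) (A (Suc k)) h"
      "\<And>x. x \<in> carrier (A (Suc k)) \<Longrightarrow> d k (h (d k x)) = d k (c (Suc k) x)" for k h
  proof -
    interpret K: lmodule S "A (Suc k)" by (rule A'(3))
    interpret K0: lmodule S "A k" by (rule A'(3))
    let ?w = "\<lambda>x. c (Suc k) x \<ominus>\<^bsub>A (Suc k)\<^esub> h (d k x)"
    have hd: "linear_map S (A (Suc k)) (A (Suc k)) (\<lambda>x. h (d k x))" by (rule linear_map_comp[OF A'(4) h(1)])
    have w: "linear_map S (A (Suc k)) (A (Suc k)) ?w"
      by (rule linear_map_diff[OF A'(3) c(1) hd])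
    have "?w x \<in> d (Suc k) ` carrier (A (Suc (Suc k)))" if x: "x \<in> carrier (A (Suc k))" for x
    proof (rule A'(10))
      show "?w x \<in> carrier (A (Suc k))" by (rule linear_map_closed[OF w x])
      have "d k (?w x) = d k (c (Suc k) x) \<ominus>\<^bsub>A k\<^esub> d k (h (d k x))"
        by (rule linear_map_minus[OF A'(3) A'(3) A'(4) linear_map_closed[OF c(1) x] linear_map_closed[OF hd x]])
      then show "d k (?w x) = \<zero>\<^bsub>A k\<^esub>"
        using h(2)[OF x] K0.minus_eq_zero_iff linear_map_closed[OF A'(4) linear_map_closed[OF c(1) x]] by simp
    qed
    then obtain h' where h': "linear_map S (A (Suc k)) (A (Suc (Suc k))) h'"
      "\<And>x. x \<in> carrier (A (Suc k)) \<Longrightarrow> d (Suc k) (h' x) = ?w x"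
      using projective_lift[OF A'(2) A'(3) A'(3) A'(4) w] by metis
    have "c (Suc k) x = h (d k x) \<oplus>\<^bsub>A (Suc k)\<^esub> ?w x" if x: "x \<in> carrier (A (Suc k))" for x
      using linear_map_closed[OF c(1) x] linear_map_closed[OF hd x]
      by (simp add: a_minus_def K.M.a_lcomm K.M.r_neg)
    then show ?thesis using h' by (intro exI[of _ h']) auto
  qed
  \<comment> \<open>The induction does not remember the whole homotopy: \<open>d h d = d c\<close>
    is what puts \<open>c - h d\<close> into the kernel of \<open>d k\<close>, so that it lifts to
    the next component.\<close>
  have "\<exists>h. linear_map S (A k) (A (Suc k)) h \<and> (\<forall>x\<in>carrier (A (Suc k)). d k (h (d k x)) = d k (c (Suc k) x))"
  proof (induction k)
    case 0
    have "c 0 x \<in> d 0 ` carrier (A (Suc 0))" if x: "x \<in> carrier (A 0)" for x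
      using A'(8)[OF linear_map_closed[OF c(1) x] c(3)[OF x]] .
    then obtain h where h: "linear_map S (A 0) (A (Suc 0)) h" "\<And>x. x \<in> carrier (A 0) \<Longrightarrow> d 0 (h x) = c 0 x"
      using projective_lift[OF A'(2) A'(3) A'(3) A'(4) c(1)] by metis
    then show ?case using linear_map_closed[OF A'(4)] c(2) by (intro exI[of _ h]) auto
  next
    case (Suc k)
    then obtain h where h: "linear_map S (A k) (A (Suc k)) h"
      "\<And>x. x \<in> carrier (A (Suc k)) \<Longrightarrow> d k (h (d k x)) = d k (c (Suc k) x)" by blast
    obtain h' where h': "linear_map S (A (Suc k)) (A (Suc (Suc k))) h'"
      "\<And>x. x \<in> carrier (A (Suc k)) \<Longrightarrow> c (Suc k) x = h (d k x) \<oplus>\<^bsub>A (Suc k)\<^esub> d (Suc k) (h' x)"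
      using step[OF h] by blast
    have "d (Suc k) (h' (d (Suc k) x)) = d (Suc k) (c (Suc (Suc k)) x)" if x: "x \<in> carrier (A (Suc (Suc k)))" for x
    proof -
      interpret K: lmodule S "A (Suc k)" by (rule A'(3))
      note cx = linear_map_closed[OF A'(4) x]
      have "c (Suc k) (d (Suc k) x) = h \<zero>\<^bsub>A k\<^esub> \<oplus>\<^bsub>A (Suc k)\<^esub> d (Suc k) (h' (d (Suc k) x))"
        using h'(2)[OF cx] A'(9)[OF x] by simp
      also have "\<dots> = d (Suc k) (h' (d (Suc k) x))"
        using linear_map_zero[OF A'(3) A'(3) h(1)]
          linear_map_closed[OF A'(4) linear_map_closed[OF h'(1) cx]] by simp
      finally show ?thesis using c(2)[OF x] by simp
    qed
    then show ?case using h'(1) by blast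
  qed
  then show ?thesis using step by blast
qed

text \<open>Vanishing of the positive cohomology of \<open>Hom(-, X)\<close> does not depend on the
  resolution. With comparison maps \<open>a\<close>, \<open>b\<close> and a homotopy from
  \<open>b a\<close> to the identity, \<open>v\<close> differs from \<open>v b a\<close> by
  \<open>(v h) dA\<close>, because \<open>v\<close> kills boundaries; and \<open>v b\<close> factors
  over \<open>B\<close> by \<open>fac\<close>.\<close>

lemma resolution_factor:
  assumes A: "resolution S A dA M \<epsilon>A" and B: "resolution S B dB M \<epsilon>B" and X: "lmodule S X"
    and fac: "\<And>k v. \<lbrakk>linear_map S (B (Suc k)) X v;
      \<And>x. x \<in> carrier (B (Suc (Suc k))) \<Longrightarrow> v (dB (Suc k) x) = \<zero>\<^bsub>X\<^esub>\<rbrakk> \<Longrightarrow>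
      \<exists>u. linear_map S (B k) X u \<and> (\<forall>x\<in>carrier (B (Suc k)). v x = u (dB k x))"
    and v: "linear_map S (A (Suc k)) X v"
    and vd: "\<And>x. x \<in> carrier (A (Suc (Suc k))) \<Longrightarrow> v (dA (Suc k) x) = \<zero>\<^bsub>X\<^esub>"
  shows "\<exists>u. linear_map S (A k) X u \<and> (\<forall>x\<in>carrier (A (Suc k)). v x = u (dA k x))"
proof -
  note A' = resolutionD[OF A] and B' = resolutionD[OF B]
  interpret X: lmodule S X by fact
  obtain a where a: "\<And>k. linear_map S (A k) (B k) (a k)"
    "\<And>x. x \<in> carrier (A 0) \<Longrightarrow> \<epsilon>B (a 0 x) = \<epsilon>A x"
    "\<And>k x. x \<in> carrier (A (Suc k)) \<Longrightarrow> a k (dA k x) = dB k (a (Suc k) x)"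
    using resolution_lift[OF A B] by metis
  obtain b where b: "\<And>k. linear_map S (B k) (A k) (b k)"
    "\<And>x. x \<in> carrier (B 0) \<Longrightarrow> \<epsilon>A (b 0 x) = \<epsilon>B x"
    "\<And>k x. x \<in> carrier (B (Suc k)) \<Longrightarrow> b k (dB k x) = dA k (b (Suc k) x)"
    using resolution_lift[OF B A] by metis
  have ba: "linear_map S (A k) (A k) (\<lambda>x. b k (a k x))" for k by (rule linear_map_comp[OF a(1) b(1)])
  note ac = linear_map_closed[OF a(1)] and bc = linear_map_closed[OF b(1)] and dc = linear_map_closed[OF A'(4)]
  define c where "c k = (\<lambda>x. x \<ominus>\<^bsub>A k\<^esub> b k (a k x))" for k
  have c1: "linear_map S (A k) (A k) (c k)" for k
    unfolding c_def by (rule linear_map_diff[OF A'(3) linear_map_ident ba])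
  have c2: "c k (dA k x) = dA k (c (Suc k) x)" if x: "x \<in> carrier (A (Suc k))" for k x
    using x by (simp add: c_def linear_map_minus[OF A'(3) A'(3) A'(4) x bc[OF ac[OF x]]] a(3) b(3) ac)
  have c3: "\<epsilon>A (c 0 x) = \<zero>\<^bsub>M\<^esub>" if x: "x \<in> carrier (A 0)" for x
    using x linear_map_closed[OF A'(5) x]
    by (simp add: c_def linear_map_minus[OF A'(3) A'(1) A'(5) x bc[OF ac[OF x]]] a(2) b(2) ac
      lmodule.minus_eq_zero_iff[OF A'(1)])
  obtain h h' where h: "linear_map S (A k) (A (Suc k)) h" "linear_map S (A (Suc k)) (A (Suc (Suc k))) h'"
    "\<And>x. x \<in> carrier (A (Suc k)) \<Longrightarrow> c (Suc k) x = h (dA k x) \<oplus>\<^bsub>A (Suc k)\<^esub> dA (Suc k) (h' x)"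
    using null_homotopy[OF A c1 c2 c3, of k] by blast
  have vb: "linear_map S (B (Suc k)) X (\<lambda>x. v (b (Suc k) x))" by (rule linear_map_comp[OF b(1) v])
  obtain w where w: "linear_map S (B k) X w" "\<And>x. x \<in> carrier (B (Suc k)) \<Longrightarrow> v (b (Suc k) x) = w (dB k x)"
    using fac[OF vb] b(3) vd bc by metis
  have u: "linear_map S (A k) X (\<lambda>x. v (h x) \<oplus>\<^bsub>X\<^esub> w (a k x))"
    by (rule linear_map_plus[OF X linear_map_comp[OF h(1) v] linear_map_comp[OF a(1) w(1)]])
  moreover have "v x = v (h (dA k x)) \<oplus>\<^bsub>X\<^esub> w (a k (dA k x))" if x: "x \<in> carrier (A (Suc k))" for x
  proof -
    interpret K: lmodule S "A (Suc k)" by (rule A'(3))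
    note bax = bc[OF ac[OF x]] and hx = linear_map_closed[OF h(1) dc[OF x]]
      and hx' = dc[OF linear_map_closed[OF h(2) x]]
    have "x = c (Suc k) x \<oplus>\<^bsub>A (Suc k)\<^esub> b (Suc k) (a (Suc k) x)"
      using x bax by (simp add: c_def a_minus_def K.M.a_assoc K.M.l_neg)
    then have "v x = v (c (Suc k) x) \<oplus>\<^bsub>X\<^esub> v (b (Suc k) (a (Suc k) x))"
      using linear_map_add[OF v linear_map_closed[OF c1 x] bax] by simp
    also have "v (c (Suc k) x) = v (h (dA k x)) \<oplus>\<^bsub>X\<^esub> \<zero>\<^bsub>X\<^esub>"
      using h(3)[OF x] linear_map_add[OF v hx hx'] vd[OF linear_map_closed[OF h(2) x]] by simp
    also have "v (b (Suc k) (a (Suc k) x)) = w (a k (dA k x))"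
      using w(2)[OF ac[OF x]] a(3)[OF x] by simp
    finally show ?thesis using linear_map_closed[OF v hx] by simp
  qed
  ultimately show ?thesis by blast
qed

section \<open>Homology\<close>

lemma coset_carrier_update [simp]: "H +>\<^bsub>A\<lparr>carrier := Z\<rparr>\<^esub> x = H +>\<^bsub>A\<^esub> x"
  by (simp add: a_r_coset_def r_coset_def)

lemma chain_complexD:
  assumes "chain_complex S C"
  shows "lmodule S (obj C i)" "linear_map S (obj C i) (obj C (i - 1)) (bd C i)"
    "linear_map S (obj C (i + 1)) (obj C i) (bd C (i + 1))"
    "x \<in> carrier (obj C (i + 1)) \<Longrightarrow> bd C i (bd C (i + 1) x) = \<zero>\<^bsub>obj C (i - 1)\<^esub>"
proof -
  show "lmodule S (obj C i)" "linear_map S (obj C i) (obj C (i - 1)) (bd C i)"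
    using assms by (simp_all add: chain_complex_def)
  have "linear_map S (obj C (i + 1)) (obj C (i + 1 - 1)) (bd C (i + 1))"
    and "\<forall>x\<in>carrier (obj C (i + 1)). bd C (i + 1 - 1) (bd C (i + 1) x) = \<zero>\<^bsub>obj C (i + 1 - 2)\<^esub>"
    using assms unfolding chain_complex_def by blast+
  then show "linear_map S (obj C (i + 1)) (obj C i) (bd C (i + 1))"
    "x \<in> carrier (obj C (i + 1)) \<Longrightarrow> bd C i (bd C (i + 1) x) = \<zero>\<^bsub>obj C (i - 1)\<^esub>"
    by simp_all
qed

lemma cycles_eq: "cycles C i = {x \<in> carrier (obj C i). bd C i x = \<zero>\<^bsub>obj C (i - 1)\<^esub>}"
  by (simp add: cycles_def a_kernel_def')

lemma submodule_cycles:
  assumes "chain_complex S C" shows "submodule (cycles C i) S (obj C i)"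
  unfolding cycles_eq by (intro submodule_kernel chain_complexD[OF assms])

lemma lmodule_cycles:
  assumes "chain_complex S C" shows "lmodule S (obj C i\<lparr>carrier := cycles C i\<rparr>)"
  by (rule lmodule.lmodule_submodule[OF chain_complexD(1)[OF assms] submodule_cycles[OF assms]])

lemma boundaries_subset_cycles:
  assumes "chain_complex S C" shows "boundaries C i \<subseteq> cycles C i"
  using chain_complexD(4)[OF assms] linear_map_closed[OF chain_complexD(3)[OF assms]]
  by (auto simp: cycles_eq boundaries_def)

lemma submodule_boundaries:
  assumes "chain_complex S C"
  shows "submodule (boundaries C i) S (obj C i\<lparr>carrier := cycles C i\<rparr>)"
proof -
  have "submodule (boundaries C i) S (obj C i)"
    unfolding boundaries_def by (intro submodule_image chain_complexD[OF assms])
  then show ?thesis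
    using boundaries_subset_cycles[OF assms, of i]
    by (auto simp: lmodule.submodule_iff[OF chain_complexD(1)[OF assms]]
      lmodule.submodule_iff[OF lmodule_cycles[OF assms]])
qed

lemma zero_boundaries: "chain_complex S C \<Longrightarrow> \<zero>\<^bsub>obj C i\<^esub> \<in> boundaries C i"
  using submodule_boundaries[of S C i] by (simp add: lmodule.submodule_iff[OF lmodule_cycles])

lemma zero_cycles: "chain_complex S C \<Longrightarrow> \<zero>\<^bsub>obj C i\<^esub> \<in> cycles C i"
  using zero_boundaries boundaries_subset_cycles by blast

lemma carrier_homology: "carrier (homology C i) = (\<lambda>x. boundaries C i +>\<^bsub>obj C i\<^esub> x) ` cycles C i"
  by (simp add: homology_def carrier_quot)

lemma homology_class_eq_iff:
  assumes "chain_complex S C" "x \<in> cycles C i"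
  shows "boundaries C i +>\<^bsub>obj C i\<^esub> x = boundaries C i \<longleftrightarrow> x \<in> boundaries C i"
  using lmodule.coset_eq_iff[OF lmodule_cycles[OF assms(1)] submodule_boundaries[OF assms(1)]] assms(2) by simp

lemma chain_mapD:
  assumes "chain_map S C D f"
  shows "linear_map S (obj C i) (obj D i) (f i)"
    "x \<in> carrier (obj C i) \<Longrightarrow> f (i - 1) (bd C i x) = bd D i (f i x)"
    "y \<in> carrier (obj C (i + 1)) \<Longrightarrow> f i (bd C (i + 1) y) = bd D (i + 1) (f (i + 1) y)"
proof -
  show "linear_map S (obj C i) (obj D i) (f i)"
    "x \<in> carrier (obj C i) \<Longrightarrow> f (i - 1) (bd C i x) = bd D i (f i x)"
    using assms by (simp_all add: chain_map_def)
  have "\<forall>y\<in>carrier (obj C (i + 1)). f (i + 1 - 1) (bd C (i + 1) y) = bd D (i + 1) (f (i + 1) y)"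
    using assms unfolding chain_map_def by blast
  then show "y \<in> carrier (obj C (i + 1)) \<Longrightarrow> f i (bd C (i + 1) y) = bd D (i + 1) (f (i + 1) y)"
    by simp
qed

lemma chain_map_cycles:
  assumes "chain_complex S C" "chain_complex S D" "chain_map S C D f" "z \<in> cycles C i"
  shows "f i z \<in> cycles D i"
proof -
  have z: "z \<in> carrier (obj C i)" "bd C i z = \<zero>\<^bsub>obj C (i - 1)\<^esub>" using assms(4) by (simp_all add: cycles_eq)
  have "bd D i (f i z) = \<zero>\<^bsub>obj D (i - 1)\<^esub>"
    using chain_mapD(2)[OF assms(3) z(1)] z(2)
      linear_map_zero[OF chain_complexD(1)[OF assms(1)] chain_complexD(1)[OF assms(2)]
        chain_mapD(1)[OF assms(3)]] by simp
  then show ?thesis using linear_map_closed[OF chain_mapD(1)[OF assms(3)] z(1)] by (simp add: cycles_eq)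
qed

lemma homology_map_class:
  assumes "chain_complex S C" "chain_complex S D" "chain_map S C D f" "z \<in> cycles C i"
  shows "homology_map D f i (boundaries C i +>\<^bsub>obj C i\<^esub> z) = boundaries D i +>\<^bsub>obj D i\<^esub> f i z"
proof -
  let ?C = "obj C i\<lparr>carrier := cycles C i\<rparr>" and ?D = "obj D i\<lparr>carrier := cycles D i\<rparr>"
  have "linear_map S ?C (obj D i) (f i)"
    by (rule linear_map_restrict[OF chain_mapD(1)[OF assms(3)]]) (auto simp: cycles_eq)
  then have l: "linear_map S ?C ?D (f i)"
    by (rule linear_map_into_submodule) (use chain_map_cycles[OF assms(1-3)] in simp)
  have "f i ` boundaries C i \<subseteq> boundaries D i"
    using chain_mapD(3)[OF assms(3)] linear_map_closed[OF chain_mapD(1)[OF assms(3)]]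
    by (auto simp: boundaries_def)
  then have "coset_map ?D (boundaries D i) (f i) (boundaries C i +>\<^bsub>?C\<^esub> z) = boundaries D i +>\<^bsub>?D\<^esub> f i z"
    using assms(4) by (intro coset_map_coset[OF lmodule_cycles[OF assms(1)] lmodule_cycles[OF assms(2)]
        submodule_boundaries[OF assms(1)] submodule_boundaries[OF assms(2)] l]) simp_all
  then show ?thesis by (simp add: homology_map_def coset_map_def)
qed

lemma quasi_iso_boundary:
  assumes "chain_complex S C" "chain_complex S D" "chain_map S C D f" "quasi_iso C D f"
    "z \<in> cycles C i" "f i z \<in> boundaries D i"
  shows "z \<in> boundaries C i"
proof -
  let ?h = "\<lambda>x. boundaries C i +>\<^bsub>obj C i\<^esub> x"
  have z0: "\<zero>\<^bsub>obj C i\<^esub> \<in> cycles C i" "\<zero>\<^bsub>obj C i\<^esub> \<in> boundaries C i"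
    by (rule zero_cycles[OF assms(1)] zero_boundaries[OF assms(1)])+
  have "homology_map D f i (?h z) = boundaries D i"
    using homology_map_class[OF assms(1-3,5)]
      homology_class_eq_iff[OF assms(2) chain_map_cycles[OF assms(1-3,5)]] assms(6) by simp
  moreover have "homology_map D f i (?h \<zero>\<^bsub>obj C i\<^esub>) = boundaries D i"
  proof -
    have "f i \<zero>\<^bsub>obj C i\<^esub> = \<zero>\<^bsub>obj D i\<^esub>"
      by (rule linear_map_zero[OF chain_complexD(1)[OF assms(1)] chain_complexD(1)[OF assms(2)]
        chain_mapD(1)[OF assms(3)]])
    moreover have "\<zero>\<^bsub>obj D i\<^esub> \<in> boundaries D i" by (rule zero_boundaries[OF assms(2)])
    ultimately show ?thesis
      using homology_map_class[OF assms(1-3) z0(1)]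
        homology_class_eq_iff[OF assms(2) chain_map_cycles[OF assms(1-3) z0(1)]] by simp
  qed
  moreover have "inj_on (homology_map D f i) (carrier (homology C i))"
    using assms(4) by (auto simp: quasi_iso_def bij_betw_def)
  ultimately have "?h z = ?h \<zero>\<^bsub>obj C i\<^esub>"
    using assms(5) z0(1) by (simp add: inj_on_def carrier_homology)
  then show ?thesis
    using homology_class_eq_iff[OF assms(1) assms(5)] homology_class_eq_iff[OF assms(1) z0(1)] z0(2) by simp
qed

lemma quasi_iso_surj:
  assumes "chain_complex S C" "chain_complex S D" "chain_map S C D f" "quasi_iso C D f" "y \<in> cycles D i"
  obtains z where "z \<in> cycles C i" "y \<ominus>\<^bsub>obj D i\<^esub> f i z \<in> boundaries D i"
proof -
  have "homology_map D f i ` carrier (homology C i) = carrier (homology D i)"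
    using assms(4) by (auto simp: quasi_iso_def bij_betw_def)
  moreover have "boundaries D i +>\<^bsub>obj D i\<^esub> y \<in> carrier (homology D i)"
    using assms(5) by (simp add: carrier_homology)
  ultimately have "boundaries D i +>\<^bsub>obj D i\<^esub> y \<in> homology_map D f i ` carrier (homology C i)" by blast
  then obtain z where z: "z \<in> cycles C i"
    "homology_map D f i (boundaries C i +>\<^bsub>obj C i\<^esub> z) = boundaries D i +>\<^bsub>obj D i\<^esub> y"
    unfolding carrier_homology by (elim imageE) metis
  have b: "submodule (boundaries D i) S (obj D i)"
    unfolding boundaries_def by (intro submodule_image chain_complexD[OF assms(2)])
  have "y \<ominus>\<^bsub>obj D i\<^esub> f i z \<in> boundaries D i"
    using z(2) homology_map_class[OF assms(1-3) z(1)] chain_map_cycles[OF assms(1-3) z(1)] assms(5)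
    by (subst lmodule.quot_eq_iff[OF chain_complexD(1)[OF assms(2)] b, symmetric]) (simp_all add: cycles_eq)
  then show thesis using that z(1) by blast
qed

lemma chain_complex_stalk:
  assumes "lmodule S M" shows "chain_complex S (stalk M)"
proof -
  interpret lmodule S M by fact
  show ?thesis
    unfolding chain_complex_def
    using lmodule_stalk[OF assms] by (auto intro!: linear_mapI simp: stalk_def)
qed

text \<open>\<open>P\<close> may be nonzero in negative degrees, so in degree 0 the statements are
  about cycles and not about all of \<open>obj P 0\<close>.\<close>

lemma quasi_iso_stalk:
  assumes P: "chain_complex S P" and M: "lmodule S M" and c: "chain_map S P (stalk M) \<pi>"
    and q: "quasi_iso P (stalk M) \<pi>"
  shows "i \<noteq> 0 \<Longrightarrow> cycles P i = boundaries P i"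
    and "z \<in> cycles P 0 \<Longrightarrow> \<pi> 0 z = \<zero>\<^bsub>M\<^esub> \<longleftrightarrow> z \<in> boundaries P 0"
    and "\<pi> 0 ` cycles P 0 = carrier M"
proof -
  interpret M: lmodule S M by fact
  note st = chain_complex_stalk[OF M]
  have b: "boundaries (stalk M) i = {\<zero>\<^bsub>M\<^esub>}" for i
    by (auto simp: boundaries_def stalk_def image_iff)
  have cy: "cycles (stalk M) i = (if i = 0 then carrier M else {\<zero>\<^bsub>M\<^esub>})" for i
    by (auto simp: cycles_eq stalk_def)
  show "cycles P i = boundaries P i" if "i \<noteq> 0"
  proof
    show "boundaries P i \<subseteq> cycles P i" by (rule boundaries_subset_cycles[OF P])
    show "cycles P i \<subseteq> boundaries P i"
    proof
      fix x assume x: "x \<in> cycles P i"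
      then have "\<pi> i x = \<zero>\<^bsub>M\<^esub>" using chain_map_cycles[OF P st c x] that by (simp add: cy)
      then show "x \<in> boundaries P i" using quasi_iso_boundary[OF P st c q x] by (simp add: b)
    qed
  qed
  have p0: "linear_map S (obj P 0) M (\<pi> 0)" using chain_mapD(1)[OF c, of 0] by (simp add: stalk_def)
  show "\<pi> 0 z = \<zero>\<^bsub>M\<^esub> \<longleftrightarrow> z \<in> boundaries P 0" if z: "z \<in> cycles P 0"
  proof
    show "\<pi> 0 z = \<zero>\<^bsub>M\<^esub> \<Longrightarrow> z \<in> boundaries P 0"
      using quasi_iso_boundary[OF P st c q z] by (simp add: b)
    assume "z \<in> boundaries P 0"
    then obtain w where w: "w \<in> carrier (obj P (0 + 1))" "z = bd P (0 + 1) w" by (auto simp: boundaries_def)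
    show "\<pi> 0 z = \<zero>\<^bsub>M\<^esub>" using chain_mapD(3)[OF c w(1)] w(2) by (simp add: stalk_def)
  qed
  show "\<pi> 0 ` cycles P 0 = carrier M"
  proof
    show "\<pi> 0 ` cycles P 0 \<subseteq> carrier M" using linear_map_closed[OF p0] by (auto simp: cycles_eq)
    show "carrier M \<subseteq> \<pi> 0 ` cycles P 0"
    proof
      fix y assume y: "y \<in> carrier M"
      then obtain z where z: "z \<in> cycles P 0" "y \<ominus>\<^bsub>obj (stalk M) 0\<^esub> \<pi> 0 z \<in> boundaries (stalk M) 0"
        using quasi_iso_surj[OF P st c q, of y 0] cy by auto
      moreover have "\<pi> 0 z \<in> carrier M" using z(1) linear_map_closed[OF p0] by (auto simp: cycles_eq)
      ultimately have "y = \<pi> 0 z" using M.minus_eq_zero_iff[OF y] unfolding b by (simp add: stalk_def)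
      then show "y \<in> \<pi> 0 ` cycles P 0" using z(1) by blast
    qed
  qed
qed

section \<open>Semi-projective complexes\<close>

text \<open>Each homology module consists of the class of zero only, so any chain map induces
  bijections.\<close>

lemma acyclic_quasi_iso:
  assumes "chain_complex S C" "chain_complex S D" "chain_map S C D f" "acyclic_complex C" "acyclic_complex D"
  shows "quasi_iso C D f"
proof -
  have h: "carrier (homology E i) = {boundaries E i}" if "chain_complex S E" "acyclic_complex E" for E ::
    "('a, 'x) mcomplex" and i
  proof -
    have "cycles E i = boundaries E i" using that(2) by (simp add: acyclic_complex_def)
    moreover have "\<zero>\<^bsub>obj E i\<^esub> \<in> boundaries E i" by (rule zero_boundaries[OF that(1)])
    ultimately show ?thesis
      using homology_class_eq_iff[OF that(1), of _ i] unfolding carrier_homology by auto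
  qed
  have "homology_map D f i (boundaries C i) = boundaries D i" for i
  proof -
    have z: "\<zero>\<^bsub>obj C i\<^esub> \<in> cycles C i" "\<zero>\<^bsub>obj C i\<^esub> \<in> boundaries C i"
      by (rule zero_cycles[OF assms(1)] zero_boundaries[OF assms(1)])+
    have "f i \<zero>\<^bsub>obj C i\<^esub> \<in> boundaries D i"
      using chain_map_cycles[OF assms(1-3) z(1)] assms(5) by (simp add: acyclic_complex_def)
    then show ?thesis
      using homology_map_class[OF assms(1-3) z(1)] homology_class_eq_iff[OF assms(1) z(1)] z(2)
        homology_class_eq_iff[OF assms(2) chain_map_cycles[OF assms(1-3) z(1)]] by simp
  qed
  then show ?thesis
    by (simp add: quasi_iso_def bij_betw_def h[OF assms(1,4)] h[OF assms(2,5)])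
qed

text \<open>
  Here \<open>P\<close> has a canonical chain map to the acyclic complex \<open>0 \<rightarrow> B\<^sub>-\<^sub>1 \<rightarrow> P\<^sub>-\<^sub>1 \<rightarrow> P\<^sub>-\<^sub>2 \<rightarrow> \<dots>\<close>, and a
  null-homotopy of it contains a retraction of \<open>P\<^sub>-\<^sub>1\<close> onto the boundaries \<open>B\<^sub>-\<^sub>1\<close>. The complex is copied
  into the type over which semi-projectivity quantifies.
\<close>

lemma semi_projective_split:
  fixes S :: "('k, 'r) module" and P :: "('r, 'p) mcomplex"
  assumes P: "semi_projective S P" and ac: "\<And>i. i < 0 \<Longrightarrow> cycles P i = boundaries P i"
  obtains s where "linear_map S (obj P (- 1)) (obj P (- 1)) s"
    "\<And>y. y \<in> carrier (obj P (- 1)) \<Longrightarrow> s y \<in> bd P 0 ` carrier (obj P 0)"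
    "\<And>x. x \<in> carrier (obj P 0) \<Longrightarrow> s (bd P 0 x) = bd P 0 x"
proof -
  have cP: "chain_complex S P" using P by (simp add: semi_projective_def)
  note P' = chain_complexD[OF cP]
  have "\<forall>i. \<exists>e :: 'p \<Rightarrow> 'p list \<Rightarrow> 'r. inj_on e (carrier (obj P i))"
    using ex_embedding[OF P'(1)] by blast
  then obtain e :: "int \<Rightarrow> 'p \<Rightarrow> 'p list \<Rightarrow> 'r" where e: "\<And>i. inj_on (e i) (carrier (obj P i))" by metis
  define k where "k i = inv_into (carrier (obj P i)) (e i)" for i
  have k: "x \<in> carrier (obj P i) \<Longrightarrow> k i (e i x) = x" for i x using e[of i] by (simp add: k_def)
  define Q where "Q i = copy_module (e i) (obj P i)" for i
  have Q: "lmodule S (Q i)" "linear_map S (obj P i) (Q i) (e i)" "linear_map S (Q i) (obj P i) (k i)" for i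
    unfolding Q_def k_def by (rule copy_module[OF P'(1) e])+
  have cQ: "carrier (Q i) = e i ` carrier (obj P i)" and zQ: "\<zero>\<^bsub>Q i\<^esub> = e i \<zero>\<^bsub>obj P i\<^esub>" for i
    by (simp_all add: Q_def zero_copy)
  define B where "B = e (- 1) ` bd P 0 ` carrier (obj P 0)"
  have d0: "linear_map S (obj P 0) (obj P (- 1)) (bd P 0)" using P'(2)[of 0] by simp
  have "linear_map S (obj P 0) (Q (- 1)) (\<lambda>x. e (- 1) (bd P 0 x))"
    by (rule linear_map_comp[OF d0 Q(2)])
  from submodule_image[OF P'(1) Q(1) this] have Bs: "submodule B S (Q (- 1))"
    by (simp add: B_def image_image)
  interpret Y: lmodule S "Q (- 1)" by (rule Q(1))
  have Bc: "B \<subseteq> carrier (Q (- 1))" "\<zero>\<^bsub>Q (- 1)\<^esub> \<in> B" using Bs by (simp_all add: Y.submodule_iff)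
  \<comment> \<open>In degree 0 the differential is the inclusion of \<open>B\<close> into degree
    -1; in negative degrees \<open>k\<close> undoes the copying before \<open>bd P\<close> is
    applied. Positive degrees hold the zero module.\<close>
  define C where "C = \<lparr>obj = (\<lambda>j. if j < 0 then Q j else (Q (- 1))\<lparr>carrier := if j = 0 then B else {\<zero>\<^bsub>Q (- 1)\<^esub>}\<rparr>),
    bd = (\<lambda>j x. if j < 0 then e (j - 1) (bd P j (k j x)) else x)\<rparr>"
  \<comment> \<open>A zero complex in the same type. Both complexes are acyclic, so the map from
    \<open>C\<close> to \<open>D\<close> is a quasi-isomorphism to which semi-projectivity
    applies.\<close>
  define D where "D = stalk ((Q (- 1))\<lparr>carrier := {\<zero>\<^bsub>Q (- 1)\<^esub>}\<rparr>)"
  have lC: "lmodule S (obj C j)" for j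
    using Q(1) Y.lmodule_submodule[OF Bs] lmodule_zero_carrier[OF Q(1)] by (simp add: C_def)
  have CC: "chain_complex S C"
    unfolding chain_complex_def
  proof (intro conjI allI ballI lC)
    fix j
    show "linear_map S (obj C j) (obj C (j - 1)) (bd C j)"
    proof (cases "j < 0")
      case True
      then show ?thesis
        using linear_map_comp[OF linear_map_comp[OF Q(3) P'(2)] Q(2), of j] by (simp add: C_def)
    next
      case False
      then show ?thesis using Bc by (auto simp: C_def linear_map_def)
    qed
    fix x assume x: "x \<in> carrier (obj C j)"
    show "bd C (j - 1) (bd C j x) = \<zero>\<^bsub>obj C (j - 2)\<^esub>"
    proof (cases "j < 0")
      case True
      then obtain y where y: "y \<in> carrier (obj P j)" "x = e j y" using x by (auto simp: C_def cQ)
      have "bd P (j - 1) (bd P j y) = \<zero>\<^bsub>obj P (j - 2)\<^esub>" using cP y(1) by (simp add: chain_complex_def)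
      then show ?thesis using True y linear_map_closed[OF P'(2) y(1)] by (simp add: C_def k zQ)
    next
      case False
      show ?thesis
      proof (cases "j = 0")
        case True
        then obtain y where y: "y \<in> carrier (obj P 0)" "x = e (- 1) (bd P 0 y)" using x by (auto simp: C_def B_def)
        have "bd P (0 - 1) (bd P 0 y) = \<zero>\<^bsub>obj P (0 - 2)\<^esub>" using cP y(1) unfolding chain_complex_def by blast
        then show ?thesis using True y linear_map_closed[OF d0 y(1)] by (simp add: C_def k zQ)
      next
        case j: False
        then have xz: "x = \<zero>\<^bsub>Q (- 1)\<^esub>" using x False by (simp add: C_def)
        have "obj C (j - 2) = (if j = 1 then Q (- 1) else (Q (- 1))\<lparr>carrier := if j = 2 then B else {\<zero>\<^bsub>Q (- 1)\<^esub>}\<rparr>)"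
          using False j by (auto simp: C_def)
        moreover have "bd C (j - 1) (bd C j x) = x"
          using False j by (simp add: C_def)
        ultimately show ?thesis using xz by simp
      qed
    qed
  qed
  have aC: "acyclic_complex C"
    unfolding acyclic_complex_def
  proof
    fix j
    show "cycles C j = boundaries C j"
    proof (rule antisym[OF _ boundaries_subset_cycles[OF CC]], rule subsetI)
      fix x assume x: "x \<in> cycles C j"
      show "x \<in> boundaries C j"
      proof (cases "j < 0")
        case True
        then obtain y where y: "y \<in> carrier (obj P j)" "x = e j y" using x by (auto simp: C_def cQ cycles_eq)
        have "e (j - 1) (bd P j y) = e (j - 1) \<zero>\<^bsub>obj P (j - 1)\<^esub>"
          using x y True by (simp add: C_def cycles_eq k zQ)
        then have "bd P j y = \<zero>\<^bsub>obj P (j - 1)\<^esub>"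
          using e[of "j - 1"] linear_map_closed[OF P'(2) y(1)]
          by (auto dest!: inj_onD simp: lmodule.axioms(2)[OF P'(1)] abelian_groupE(2)
            abelian_group.axioms(1) abelian_monoid.zero_closed)
        then have "y \<in> boundaries P j" using ac[OF True] y(1) by (auto simp: cycles_eq)
        then obtain w where w: "w \<in> carrier (obj P (j + 1))" "y = bd P (j + 1) w" by (auto simp: boundaries_def)
        show ?thesis
        proof (cases "j = - 1")
          case True
          then have "x \<in> B" using y w by (auto simp: B_def)
          then show ?thesis using True by (simp add: boundaries_def C_def)
        next
          case False
          then have "e (j + 1) w \<in> carrier (obj C (j + 1))" "bd C (j + 1) (e (j + 1) w) = x"
            using True w y by (simp_all add: C_def cQ k)
          then show ?thesis unfolding boundaries_def by blast
        qed
      next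
        case False
        then have "x = \<zero>\<^bsub>Q (- 1)\<^esub>" using x by (cases "j = 0") (auto simp: cycles_eq C_def)
        then show ?thesis using False by (simp add: boundaries_def C_def)
      qed
    qed
  qed
  have lD: "lmodule S ((Q (- 1))\<lparr>carrier := {\<zero>\<^bsub>Q (- 1)\<^esub>}\<rparr>)" by (rule lmodule_zero_carrier[OF Q(1)])
  have cD: "carrier (obj D j) = {\<zero>\<^bsub>Q (- 1)\<^esub>}" for j by (simp add: D_def stalk_def)
  have zD: "\<zero>\<^bsub>obj D j\<^esub> = \<zero>\<^bsub>Q (- 1)\<^esub>" for j by (simp add: D_def)
  have CD: "chain_complex S D" unfolding D_def by (rule chain_complex_stalk[OF lD])
  have aD: "acyclic_complex D"
    unfolding acyclic_complex_def
    by (auto simp: cycles_eq boundaries_def cD zD) (auto simp: D_def stalk_def)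
  define \<alpha> where "\<alpha> = (\<lambda>(j::int) (x :: 'p list \<Rightarrow> 'r). \<zero>\<^bsub>Q (- 1)\<^esub>)"
  have ch: "chain_map S C D \<alpha>"
    unfolding chain_map_def using linear_map_const_zero[OF chain_complexD(1)[OF CD], of "obj C _"]
    by (auto simp: \<alpha>_def zD) (simp add: D_def stalk_def)
  have "quasi_iso (hom_complex S P C) (hom_complex S P D) (hom_complex_map P \<alpha>)"
    using P CC CD ch acyclic_quasi_iso[OF CC CD ch aC aD] unfolding semi_projective_def by blast
  then have bij: "bij_betw (homology_map (hom_complex S P D) (hom_complex_map P \<alpha>) 0)
      (carrier (homology (hom_complex S P C) 0)) (carrier (homology (hom_complex S P D) 0))"
    by (simp add: quasi_iso_def)
  define H where "H = hom_complex S P C"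
  \<comment> \<open>The canonical chain map: up to copying it is the identity in negative degrees
    and the corestricted differential in degree 0; above it is zero.\<close>
  define f where "f j = (\<lambda>x\<in>carrier (obj P j). if j < 0 then e j x else if j
    = 0 then e (- 1) (bd P 0 x) else \<zero>\<^bsub>Q (- 1)\<^esub>)" for j
  define z where "z j = (\<lambda>x\<in>carrier (obj P j). \<zero>\<^bsub>obj C j\<^esub>)" for j
  have linz: "linear_map S (obj P j) (obj C j) (z j)" for j
    unfolding z_def by (rule hom_zero_linear[OF P'(1) lC])
  have linf: "linear_map S (obj P j) (obj C j) (f j)" for j
  proof -
    have "linear_map S (obj P j) (obj C j) (\<lambda>x. if j < 0 then e j x else if j
      = 0 then e (- 1) (bd P 0 x) else \<zero>\<^bsub>Q (- 1)\<^esub>)"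
    proof (cases "j < 0")
      case True
      then show ?thesis using Q(2)[of j] by (simp add: C_def)
    next
      case False
      show ?thesis
      proof (cases "j = 0")
        case True
        have "linear_map S (obj P 0) ((Q (- 1))\<lparr>carrier := B\<rparr>) (\<lambda>x. e (- 1) (bd P 0 x))"
          by (rule linear_map_into_submodule[OF linear_map_comp[OF d0 Q(2)]]) (auto simp: B_def)
        then show ?thesis using True by (simp add: C_def)
      next
        case j: False
        then show ?thesis using False linear_map_const_zero[OF lD, of "obj P j"] by (simp add: C_def)
      qed
    qed
    then show ?thesis
      unfolding f_def
      by (subst linear_map_cong[OF P'(1), where g =
        "\<lambda>x. if j < 0 then e j x else if j = 0 then e (- 1) (bd P 0 x) else \<zero>\<^bsub>Q (- 1)\<^esub>"]) auto
  qed
  have zz: "\<zero>\<^bsub>obj C j\<^esub> \<ominus>\<^bsub>obj C j\<^esub> \<zero>\<^bsub>obj C j\<^esub> = \<zero>\<^bsub>obj C j\<^esub>" "\<zero>\<^bsub>obj C j\<^esub> \<oplus>\<^bsub>obj C j\<^esub> \<zero>\<^bsub>obj C j\<^esub> = \<zero>\<^bsub>obj C j\<^esub>" for j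
  proof -
    interpret C: lmodule S "obj C j" by (rule lC)
    show "\<zero>\<^bsub>obj C j\<^esub> \<ominus>\<^bsub>obj C j\<^esub> \<zero>\<^bsub>obj C j\<^esub> = \<zero>\<^bsub>obj C j\<^esub>" "\<zero>\<^bsub>obj C j\<^esub> \<oplus>\<^bsub>obj C j\<^esub> \<zero>\<^bsub>obj C j\<^esub> = \<zero>\<^bsub>obj C j\<^esub>"
      by (simp_all add: C.minus_eq_zero_iff)
  qed
  have bz: "bd C j \<zero>\<^bsub>obj C j\<^esub> = \<zero>\<^bsub>obj C (j - 1)\<^esub>" for j
    by (rule linear_map_zero[OF lC lC chain_complexD(2)[OF CC]])
  have memH: "g \<in> carrier (obj H n) \<longleftrightarrow> (\<forall>j. g j \<in> extensional (carrier (obj P j))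
    \<and> linear_map S (obj P j) (obj C (j + n)) (g j))" for g n
    by (auto simp: H_def hom_complex_def prod_module_def hom_module_def)
  have zH: "\<zero>\<^bsub>obj H n\<^esub> = (\<lambda>j. \<lambda>x\<in>carrier (obj P j). \<zero>\<^bsub>obj C (j + n)\<^esub>)" for n
    by (simp add: H_def hom_complex_def prod_module_def hom_module_def)
  have z_cyc: "z \<in> cycles H 0"
  proof -
    have "bd H 0 z = \<zero>\<^bsub>obj H (0 - 1)\<^esub>"
    proof (rule ext, rule ext)
      fix j x
      have "z (j - 1) (bd P j x) = \<zero>\<^bsub>obj C (j - 1)\<^esub>" if "x \<in> carrier (obj P j)"
        using linear_map_closed[OF P'(2) that] by (simp add: z_def)
      then show "bd H 0 z j x = \<zero>\<^bsub>obj H (0 - 1)\<^esub> j x"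
        unfolding zH by (simp add: H_def hom_complex_def bz zz) (simp add: z_def bz zz)
    qed
    then show ?thesis using linz by (simp add: cycles_eq memH) (simp add: z_def)
  qed
  have f_cyc: "f \<in> cycles H 0"
  proof -
    have "bd H 0 f = \<zero>\<^bsub>obj H (0 - 1)\<^esub>"
    proof (rule ext, rule ext)
      fix j x
      have "f (j - 1) (bd P j x) = bd C j (f j x)" if x: "x \<in> carrier (obj P j)"
      proof -
        note c = linear_map_closed[OF P'(2) x]
        consider "j < 0" | "j = 0" | "j = 1" | "j > 1" by linarith
        then show ?thesis
        proof cases
          case 1 then show ?thesis using x c by (simp add: f_def C_def k)
        next
          case 2 then show ?thesis using x c by (simp add: f_def C_def)
        next
          case 3
          then have "bd P 0 (bd P 1 x) = \<zero>\<^bsub>obj P (- 1)\<^esub>" using P'(4)[of x 0] x by simp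
          then show ?thesis using 3 x c by (simp add: f_def C_def zQ)
        next
          case 4 then show ?thesis using x c by (simp add: f_def C_def)
        qed
      qed
      moreover have "bd C j (f j x) \<ominus>\<^bsub>obj C (j - 1)\<^esub> bd C j (f j x) = \<zero>\<^bsub>obj C (j - 1)\<^esub>" if x:
        "x \<in> carrier (obj P j)"
      proof -
        interpret C: lmodule S "obj C (j - 1)" by (rule lC)
        show ?thesis
          using linear_map_closed[OF chain_complexD(2)[OF CC] linear_map_closed[OF linf x]]
          by (simp add: C.minus_eq_zero_iff)
      qed
      ultimately show "bd H 0 f j x = \<zero>\<^bsub>obj H (0 - 1)\<^esub> j x"
        unfolding zH by (simp add: H_def hom_complex_def)
    qed
    then show ?thesis using linf by (simp add: cycles_eq memH) (simp add: f_def)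
  qed
  \<comment> \<open>\<open>Hom(P, D)\<close> has one element in degree 0. By the bijection the
    homology of \<open>Hom(P, C)\<close> in degree 0 has only one class, so \<open>f\<close> lies in
    the class of the zero family \<open>z\<close>.\<close>
  have one: "X = Y" if "X \<in> carrier (homology (hom_complex S P D) 0)"
    "Y \<in> carrier (homology (hom_complex S P D) 0)" for X Y
  proof -
    have "x = y" if "x \<in> carrier (obj (hom_complex S P D) 0)" "y \<in> carrier (obj (hom_complex S P D) 0)" for x y
    proof (rule ext)
      fix j
      have "x j \<in> extensional (carrier (obj P j))" "y j \<in> extensional (carrier (obj P j))"
        "x j \<in> carrier (obj P j) \<rightarrow> {\<zero>\<^bsub>Q (- 1)\<^esub>}" "y j \<in> carrier (obj P j) \<rightarrow> {\<zero>\<^bsub>Q (- 1)\<^esub>}"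
        using that by (auto simp: hom_complex_def prod_module_def hom_module_def linear_map_def cD)
      then show "x j = y j"
        by (intro extensionalityI[of _ "carrier (obj P j)"]) (auto dest!: Pi_mem)
    qed
    then show ?thesis using that by (auto simp: carrier_homology cycles_eq)
  qed
  have "boundaries H 0 +>\<^bsub>obj H 0\<^esub> f = boundaries H 0 +>\<^bsub>obj H 0\<^esub> z"
  proof (rule inj_onD[OF bij_betw_imp_inj_on[OF bij]])
    show f: "boundaries H 0 +>\<^bsub>obj H 0\<^esub> f \<in> carrier (homology (hom_complex S P C) 0)"
      and z: "boundaries H 0 +>\<^bsub>obj H 0\<^esub> z \<in> carrier (homology (hom_complex S P C) 0)"
      using f_cyc z_cyc by (auto simp: carrier_homology H_def)
    show "homology_map (hom_complex S P D) (hom_complex_map P \<alpha>) 0 (boundaries H 0 +>\<^bsub>obj H 0\<^esub> f)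
      = homology_map (hom_complex S P D) (hom_complex_map P \<alpha>) 0 (boundaries H 0 +>\<^bsub>obj H 0\<^esub> z)"
      by (intro one bij_betwE[OF bij, rule_format] f z)
  qed
  \<comment> \<open>Cosets are compared as sets, so \<open>f\<close> must be seen to belong to its
    own coset; for that the zero family \<open>z\<close> is exhibited as a boundary.\<close>
  moreover have "f \<in> boundaries H 0 +>\<^bsub>obj H 0\<^esub> f"
  proof -
    define w where "w j = (\<lambda>x\<in>carrier (obj P j). \<zero>\<^bsub>obj C (j + 1)\<^esub>)" for j
    have "w \<in> carrier (obj H 1)"
      using hom_zero_linear[OF P'(1) lC] by (simp add: memH w_def)
    moreover have "bd H 1 w = z"
    proof (rule ext, rule ext)
      fix j x
      have "w (j - 1) (bd P j x) = \<zero>\<^bsub>obj C j\<^esub>" if "x \<in> carrier (obj P j)"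
        using linear_map_closed[OF P'(2) that] by (simp add: w_def)
      moreover have "bd C (j + 1) \<zero>\<^bsub>obj C (j + 1)\<^esub> = \<zero>\<^bsub>obj C j\<^esub>" using bz[of "j + 1"] by simp
      ultimately show "bd H 1 w j x = z j x"
        by (simp add: H_def hom_complex_def z_def zz) (simp add: w_def zz)
    qed
    ultimately have "z \<in> boundaries H 0" by (force simp: boundaries_def)
    moreover have "f = z \<oplus>\<^bsub>obj H 0\<^esub> f"
    proof (rule ext, rule ext)
      fix j x
      interpret C: lmodule S "obj C j" by (rule lC)
      show "f j x = (z \<oplus>\<^bsub>obj H 0\<^esub> f) j x"
        using linear_map_closed[OF linf, of x j]
        by (cases "x \<in> carrier (obj P j)") (simp_all add: H_def hom_complex_def prod_module_def
          hom_module_def z_def, simp add: f_def)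
    qed
    ultimately show ?thesis by (auto simp: a_r_coset_def')
  qed
  ultimately obtain h where h: "h \<in> boundaries H 0" "f = h \<oplus>\<^bsub>obj H 0\<^esub> z" by (auto simp: a_r_coset_def')
  then obtain g where g: "g \<in> carrier (obj H 1)" "h = bd H 1 g" by (auto simp: boundaries_def)
  have gl: "linear_map S (obj P j) (obj C (j + 1)) (g j)" for j using g(1) by (simp add: memH)
  have g1: "linear_map S (obj P (- 1)) ((Q (- 1))\<lparr>carrier := B\<rparr>) (g (- 1))"
    using gl[of "- 1"] by (simp add: C_def)
  then have g1': "linear_map S (obj P (- 1)) (Q (- 1)) (g (- 1))"
    using Bc by (auto simp: linear_map_def)
  have gB: "g (- 1) y \<in> B" if "y \<in> carrier (obj P (- 1))" for y
    using linear_map_closed[OF g1 that] by simp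
  show thesis
  proof (rule that[of "\<lambda>y. k (- 1) (g (- 1) y)"])
    show "linear_map S (obj P (- 1)) (obj P (- 1)) (\<lambda>y. k (- 1) (g (- 1) y))"
      by (rule linear_map_comp[OF g1' Q(3)])
    show "k (- 1) (g (- 1) y) \<in> bd P 0 ` carrier (obj P 0)" if y: "y \<in> carrier (obj P (- 1))" for y
      using gB[OF y] linear_map_closed[OF d0] by (auto simp: B_def k)
    fix x assume x: "x \<in> carrier (obj P 0)"
    note dx = linear_map_closed[OF d0 x]
    \<comment> \<open>In degree 0 the homotopy formula has two terms. The one through
      \<open>obj C 1\<close> vanishes, so \<open>g (- 1)\<close> after \<open>bd P 0\<close> is
      \<open>f 0\<close>; the degree 1 of \<open>g\<close> is odd, whence the plus sign.\<close>
    have "g 0 x \<in> carrier (obj C 1)" using linear_map_closed[OF gl[of 0] x] by simp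
    then have g0: "g 0 x = \<zero>\<^bsub>Q (- 1)\<^esub>" by (simp add: C_def)
    have c: "g (- 1) (bd P 0 x) \<in> carrier (Q (- 1))" using gB[OF dx] Bc by blast
    have "f 0 x = h 0 x \<oplus>\<^bsub>Q (- 1)\<^esub> \<zero>\<^bsub>Q (- 1)\<^esub>"
      using x by (simp add: h(2) H_def hom_complex_def prod_module_def hom_module_def z_def C_def)
    moreover have "h 0 x = \<zero>\<^bsub>Q (- 1)\<^esub> \<oplus>\<^bsub>Q (- 1)\<^esub> g (- 1) (bd P 0 x)"
      using x g0 by (simp add: g(2) H_def hom_complex_def C_def)
    ultimately have "f 0 x = g (- 1) (bd P 0 x)" using c by simp
    then have "g (- 1) (bd P 0 x) = e (- 1) (bd P 0 x)" using x by (simp add: f_def)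
    then show "k (- 1) (g (- 1) (bd P 0 x)) = bd P 0 x" using k[OF dx] by simp
  qed
qed

section \<open>Comparison of the complete resolution with the module\<close>

text \<open>The cycles of degree 0 are a direct summand of \<open>obj P 0\<close>, since the
  boundaries below split off. Replacing \<open>obj P 0\<close> by these cycles and forgetting the
  negative degrees leaves a projective resolution; in degree 0, \<open>\<rho>\<close> is
  \<open>\<tau>\<close> followed by the retraction.\<close>

lemma ordinary_resolution:
  fixes S :: "('k, 'r) module" and M :: "('r, 'm) module"
    and T :: "('r, 't) mcomplex" and P :: "('r, 'p) mcomplex"
  assumes cpr: "complete_projective_resolution S M T \<tau> P \<pi>" and M: "lmodule S M"
  obtains A :: "nat \<Rightarrow> ('r, 'p) module" and d \<epsilon> \<rho> n where "resolution S A d M \<epsilon>"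
    "\<And>k. linear_map S (obj T (int k)) (A k) (\<rho> k)"
    "\<And>k x. x \<in> carrier (obj T (int k + 1)) \<Longrightarrow> \<rho> k (bd T (int k + 1) x) = d k (\<rho> (Suc k) x)"
    "\<And>k. k \<ge> n \<Longrightarrow> bij_betw (\<rho> k) (carrier (obj T (int k))) (carrier (A k))"
proof -
  have sP: "semi_projective S P" and cm: "chain_map S P (stalk M) \<pi>" and qi: "quasi_iso P (stalk M) \<pi>"
    and tau: "chain_map S T P \<tau>" and cT: "chain_complex S T"
    using cpr by (simp_all add: complete_projective_resolution_def semi_projective_resolution_def
      totally_acyclic_def)
  obtain n where n: "\<And>i. i \<ge> n \<Longrightarrow> bij_betw (\<tau> i) (carrier (obj T i)) (carrier (obj P i))"
    using cpr by (auto simp: complete_projective_resolution_def)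
  have cP: "chain_complex S P" and pP: "projective S (obj P i)" for i
    using sP by (simp_all add: semi_projective_def)
  note P' = chain_complexD[OF cP] and T' = chain_complexD[OF cT] and t' = chain_mapD[OF tau]
    and q = quasi_iso_stalk[OF cP M cm qi]
  obtain s where s: "linear_map S (obj P (- 1)) (obj P (- 1)) s"
    "\<And>y. y \<in> carrier (obj P (- 1)) \<Longrightarrow> s y \<in> bd P 0 ` carrier (obj P 0)"
    "\<And>x. x \<in> carrier (obj P 0) \<Longrightarrow> s (bd P 0 x) = bd P 0 x"
    using semi_projective_split[OF sP] q(1) by (metis less_irrefl)
  have d0: "linear_map S (obj P 0) (obj P (- 1)) (bd P 0)" using P'(2)[of 0] by simp
  \<comment> \<open>\<open>s\<close> projects onto the boundaries and \<open>s'\<close> lifts it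
    along \<open>bd P 0\<close>; hence \<open>1 - s' d\<close> with \<open>d = bd P 0\<close> is a
    retraction of \<open>obj P 0\<close> onto the cycles.\<close>
  obtain s' where s': "linear_map S (obj P (- 1)) (obj P 0) s'"
    "\<And>y. y \<in> carrier (obj P (- 1)) \<Longrightarrow> bd P 0 (s' y) = s y"
    using projective_lift[OF pP P'(1) P'(1) d0 s(1) s(2)] by metis
  let ?Z = "obj P 0\<lparr>carrier := cycles P 0\<rparr>"
  have lZ: "lmodule S ?Z" by (rule lmodule_cycles[OF cP])
  interpret P0: lmodule S "obj P 0" by (rule P'(1))
  interpret P1: lmodule S "obj P (- 1)" by (rule P'(1))
  define r where "r x = x \<ominus>\<^bsub>obj P 0\<^esub> s' (bd P 0 x)" for x
  have sd: "linear_map S (obj P 0) (obj P 0) (\<lambda>x. s' (bd P 0 x))" by (rule linear_map_comp[OF d0 s'(1)])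
  have r0: "linear_map S (obj P 0) (obj P 0) r"
    unfolding r_def by (rule linear_map_diff[OF P'(1) linear_map_ident sd])
  have r: "linear_map S (obj P 0) ?Z r"
  proof (rule linear_map_into_submodule[OF r0])
    fix x assume x: "x \<in> carrier (obj P 0)"
    note dx = linear_map_closed[OF d0 x]
    have "bd P 0 (r x) = \<zero>\<^bsub>obj P (- 1)\<^esub>"
      unfolding r_def linear_map_minus[OF P'(1) P'(1) d0 x linear_map_closed[OF sd x]]
      using s'(2)[OF dx] s(3)[OF x] dx by (simp add: P1.minus_eq_zero_iff)
    then show "r x \<in> cycles P 0" using linear_map_closed[OF r0 x] by (simp add: cycles_eq)
  qed
  have rZ: "r z = z" if "z \<in> cycles P 0" for z
    using that linear_map_zero[OF P'(1) P'(1) s'(1)] by (simp add: r_def cycles_eq a_minus_def)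
  have ZP: "linear_map S ?Z (obj P 0) (\<lambda>x. x)"
    by (rule linear_map_restrict[OF linear_map_ident]) (auto simp: cycles_eq)
  have pZ: "projective S ?Z"
    by (rule projective_retract[OF pP lZ ZP r]) (simp add: rZ)
  define A where "A k = (if k = 0 then ?Z else obj P (int k))" for k
  define d where "d k = bd P (int k + 1)" for k
  define \<rho> where "\<rho> k = (if k = 0 then (\<lambda>x. r (\<tau> 0 x)) else \<tau> (int k))" for k :: nat
  have AS: "A (Suc k) = obj P (int k + 1)" for k by (simp add: A_def add.commute)
  have A0: "A 0 = ?Z" by (simp add: A_def)
  have bc: "bd P (i + 1) x \<in> cycles P i" if "x \<in> carrier (obj P (i + 1))" for i x
    using boundaries_subset_cycles[OF cP, of i] that by (auto simp: boundaries_def)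
  have "resolution S A d M (\<pi> 0)"
    unfolding resolution_def
  proof (intro conjI allI M)
    fix k
    show "projective S (A k)" using pP pZ by (simp add: A_def)
    show "linear_map S (A (Suc k)) (A k) (d k)"
    proof (cases k)
      case 0
      have "linear_map S (obj P (0 + 1)) ?Z (bd P (0 + 1))"
        by (rule linear_map_into_submodule[OF P'(3)]) (rule bc)
      then show ?thesis using 0 by (simp add: A_def d_def)
    next
      case (Suc m)
      then have "A k = obj P (int k)" by (simp add: A_def)
      then show ?thesis using P'(3)[of "int k"] by (simp only: AS d_def)
    qed
    show "{x \<in> carrier (A (Suc k)). d k x = \<zero>\<^bsub>A k\<^esub>} = d (Suc k) ` carrier (A (Suc (Suc k)))"
    proof -
      have "\<zero>\<^bsub>A k\<^esub> = \<zero>\<^bsub>obj P (int k)\<^esub>" by (simp add: A_def)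
      then have "{x \<in> carrier (A (Suc k)). d k x = \<zero>\<^bsub>A k\<^esub>} = cycles P (int k + 1)"
        by (simp add: AS d_def cycles_eq)
      also have "\<dots> = boundaries P (int k + 1)" using q(1) by simp
      also have "\<dots> = d (Suc k) ` carrier (A (Suc (Suc k)))"
        unfolding AS by (simp add: boundaries_def d_def add.commute)
      finally show ?thesis .
    qed
  next
    have "linear_map S (obj P 0) M (\<pi> 0)" using chain_mapD(1)[OF cm, of 0] by (simp add: stalk_def)
    then show "linear_map S (A 0) M (\<pi> 0)"
      unfolding A0 by (rule linear_map_restrict) (auto simp: cycles_eq)
    show "\<pi> 0 ` carrier (A 0) = carrier M" using q(3) by (simp add: A0)
    show "{x \<in> carrier (A 0). \<pi> 0 x = \<zero>\<^bsub>M\<^esub>} = d 0 ` carrier (A 1)"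
      using q(2) boundaries_subset_cycles[OF cP, of 0] AS[of 0] by (auto simp: A0 boundaries_def d_def)
  qed
  moreover have "linear_map S (obj T (int k)) (A k) (\<rho> k)" for k
    using linear_map_comp[OF t'(1) r] t'(1)[of "int k"] by (simp add: \<rho>_def A_def)
  moreover have "\<rho> k (bd T (int k + 1) x) = d k (\<rho> (Suc k) x)" if x: "x \<in> carrier (obj T (int k + 1))" for k x
  proof -
    have e: "\<tau> (int k) (bd T (int k + 1) x) = d k (\<tau> (int k + 1) x)"
      using t'(3)[OF x] by (simp add: d_def)
    have "\<rho> (Suc k) = \<tau> (int k + 1)" by (simp add: \<rho>_def add.commute)
    moreover have "r (d 0 y) = d 0 y" if "y \<in> carrier (obj P (0 + 1))" for y
      using rZ bc[OF that] by (simp add: d_def)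
    ultimately show ?thesis
      using e linear_map_closed[OF t'(1) x] by (cases "k = 0") (simp_all add: \<rho>_def)
  qed
  \<comment> \<open>The 1 excludes degree 0, where \<open>\<rho>\<close> differs from
    \<open>\<tau>\<close> by the retraction.\<close>
  moreover have "bij_betw (\<rho> k) (carrier (obj T (int k))) (carrier (A k))" if "k \<ge> max 1 (nat n)" for k
    using n[of "int k"] that by (auto simp: \<rho>_def A_def)
  ultimately show thesis using that by blast
qed

text \<open>Acyclicity in positive degrees makes the nonnegative half of \<open>T\<close> a
  resolution of the cokernel of \<open>bd T 1\<close>, which \<open>f\<close> identifies with
  \<open>M\<close>.\<close>

lemma totally_acyclic_resolution:
  assumes T: "totally_acyclic S T" and M: "lmodule S M"
    and f: "linear_map S M (quot_module (obj T 0) (bd T 1 ` carrier (obj T 1))) f"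
      "bij_betw f (carrier M) (carrier (quot_module (obj T 0) (bd T 1 ` carrier (obj T 1))))"
  obtains \<epsilon> where "resolution S (\<lambda>k. obj T (int k)) (\<lambda>k. bd T (int k + 1)) M \<epsilon>"
proof -
  have cT: "chain_complex S T" and pT: "projective S (obj T i)" and aT: "cycles T i = boundaries T i" for i
    using T by (simp_all add: totally_acyclic_def acyclic_complex_def)
  note T' = chain_complexD[OF cT]
  interpret T0: lmodule S "obj T 0" by (rule T'(1))
  let ?B = "bd T 1 ` carrier (obj T 1)"
  let ?Q = "quot_module (obj T 0) ?B"
  have B: "submodule ?B S (obj T 0)"
    using submodule_image[OF T'(1) T'(1) T'(3)[of 0]] by simp
  note lQ = lmodule_quot[OF T'(1) B] and pr = linear_quot[OF T'(1) B]
  define g where "g = inv_into (carrier M) f"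
  have g: "g y \<in> carrier M" "f (g y) = y" if "y \<in> carrier ?Q" for y
    using f(2) that by (auto simp: g_def bij_betw_def f_inv_into_f inv_into_into)
  have gf: "g (f x) = x" if "x \<in> carrier M" for x
    using f(2) that by (auto simp: g_def bij_betw_def)
  interpret M: lmodule S M by fact
  interpret Q: lmodule S ?Q by (rule lQ)
  have gl: "linear_map S ?Q M g" unfolding g_def by (rule linear_map_inv_into[OF M f])
  define \<epsilon> where "\<epsilon> x = g (?B +>\<^bsub>obj T 0\<^esub> x)" for x
  have e: "linear_map S (obj T 0) M \<epsilon>" unfolding \<epsilon>_def by (rule linear_map_comp[OF pr gl])
  have "resolution S (\<lambda>k. obj T (int k)) (\<lambda>k. bd T (int k + 1)) M \<epsilon>"
    unfolding resolution_def
  proof (intro conjI allI M pT)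
    fix k
    show "linear_map S (obj T (int (Suc k))) (obj T (int k)) (bd T (int k + 1))"
      using T'(3)[of "int k"] by (simp add: add.commute)
    show "{x \<in> carrier (obj T (int (Suc k))). bd T (int k + 1) x = \<zero>\<^bsub>obj T (int k)\<^esub>} =
         bd T (int (Suc k) + 1) ` carrier (obj T (int (Suc (Suc k))))"
      using aT[of "int k + 1"] by (simp add: cycles_eq boundaries_def add.commute)
  next
    show "linear_map S (obj T (int 0)) M \<epsilon>" using e by simp
    show "\<epsilon> ` carrier (obj T (int 0)) = carrier M"
    proof
      show "\<epsilon> ` carrier (obj T (int 0)) \<subseteq> carrier M" using linear_map_closed[OF e] by auto
      show "carrier M \<subseteq> \<epsilon> ` carrier (obj T (int 0))"
      proof
        fix m assume m: "m \<in> carrier M"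
        then have "f m \<in> carrier ?Q" by (rule linear_map_closed[OF f(1)])
        then obtain x where "x \<in> carrier (obj T 0)" "f m = ?B +>\<^bsub>obj T 0\<^esub> x" by (auto simp: carrier_quot)
        then show "m \<in> \<epsilon> ` carrier (obj T (int 0))" using gf[OF m]
          by (auto simp: \<epsilon>_def intro!: image_eqI[of _ _ x])
      qed
    qed
    have "\<epsilon> x = \<zero>\<^bsub>M\<^esub> \<longleftrightarrow> x \<in> ?B" if x: "x \<in> carrier (obj T 0)" for x
    proof -
      have c: "?B +>\<^bsub>obj T 0\<^esub> x \<in> carrier ?Q" using x by (simp add: carrier_quot)
      have "\<epsilon> x = \<zero>\<^bsub>M\<^esub> \<longleftrightarrow> ?B +>\<^bsub>obj T 0\<^esub> x = ?B"
        using g(2)[OF c] linear_map_zero[OF M lQ f(1)] gf[of "\<zero>\<^bsub>M\<^esub>"] by (auto simp: \<epsilon>_def zero_quot)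
      then show ?thesis using T0.coset_eq_iff[OF B x] by simp
    qed
    moreover have "?B \<subseteq> carrier (obj T 0)" using B by (simp add: T0.submodule_iff)
    ultimately show "{x \<in> carrier (obj T (int 0)). \<epsilon> x = \<zero>\<^bsub>M\<^esub>} = bd T (int 0 + 1) ` carrier (obj T (int 1))"
      by auto
  qed
  then show thesis by (rule that)
qed

text \<open>One step down: \<open>dB n\<close> after \<open>s (Suc n)\<close> kills boundaries
  because \<open>dB dB = 0\<close>, so by \<open>fac\<close> it factors as \<open>u dA\<close>, and
  \<open>u\<close> is the new component. The hypothesis \<open>fac\<close> is the vanishing of
  positive cohomology with coefficients in \<open>B k\<close>.\<close>

lemma chain_extension_down:
  fixes A :: "nat \<Rightarrow> ('r, 'a) module" and B :: "nat \<Rightarrow> ('r, 'b) module"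
  assumes dA: "\<And>k. linear_map S (A (Suc k)) (A k) (dA k)" and dB: "\<And>k. linear_map S (B (Suc k)) (B k) (dB k)"
    and dd: "\<And>k x. x \<in> carrier (B (Suc (Suc k))) \<Longrightarrow> dB k (dB (Suc k) x) = \<zero>\<^bsub>B k\<^esub>"
    and fac: "\<And>k v. \<lbrakk>linear_map S (A (Suc k)) (B k) v;
      \<And>x. x \<in> carrier (A (Suc (Suc k))) \<Longrightarrow> v (dA (Suc k) x) = \<zero>\<^bsub>B k\<^esub>\<rbrakk> \<Longrightarrow>
      \<exists>u. linear_map S (A k) (B k) u \<and> (\<forall>x\<in>carrier (A (Suc k)). v x = u (dA k x))"
    and s: "\<And>k. k \<ge> n \<Longrightarrow> linear_map S (A k) (B k) (s k)"
      "\<And>k x. \<lbrakk>k \<ge> n; x \<in> carrier (A (Suc k))\<rbrakk> \<Longrightarrow> s k (dA k x) = dB k (s (Suc k) x)"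
  shows "\<exists>\<sigma>. (\<forall>k. linear_map S (A k) (B k) (\<sigma> k)) \<and>
    (\<forall>k. \<forall>x\<in>carrier (A (Suc k)). \<sigma> k (dA k x) = dB k (\<sigma> (Suc k) x)) \<and> (\<forall>k\<ge>n. \<sigma> k = s k)"
  using s
proof (induction n arbitrary: s)
  case 0
  then show ?case by (intro exI[of _ s]) auto
next
  case (Suc n)
  have v: "linear_map S (A (Suc n)) (B n) (\<lambda>x. dB n (s (Suc n) x))"
    by (rule linear_map_comp[OF Suc.prems(1) dB]) simp
  have "dB n (s (Suc n) (dA (Suc n) x)) = \<zero>\<^bsub>B n\<^esub>" if x: "x \<in> carrier (A (Suc (Suc n)))" for x
    using Suc.prems(2)[OF order.refl x] dd linear_map_closed[OF Suc.prems(1) x] by simp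
  then obtain u where u: "linear_map S (A n) (B n) u"
    "\<And>x. x \<in> carrier (A (Suc n)) \<Longrightarrow> dB n (s (Suc n) x) = u (dA n x)"
    using fac[OF v] by blast
  define s' where "s' = s(n := u)"
  have "linear_map S (A k) (B k) (s' k)" if "k \<ge> n" for k
    using that u(1) Suc.prems(1)[of k] by (cases "k = n") (auto simp: s'_def)
  moreover have "s' k (dA k x) = dB k (s' (Suc k) x)" if "k \<ge> n" "x \<in> carrier (A (Suc k))" for k x
    using that u(2) Suc.prems(2)[of k x] by (cases "k = n") (auto simp: s'_def)
  ultimately obtain \<sigma> where \<sigma>: "\<forall>k. linear_map S (A k) (B k) (\<sigma> k)"
    "\<forall>k. \<forall>x\<in>carrier (A (Suc k)). \<sigma> k (dA k x) = dB k (\<sigma> (Suc k) x)" "\<forall>k\<ge>n. \<sigma> k = s' k"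
    using Suc.IH by blast
  moreover have "\<sigma> k = s k" if "k \<ge> Suc n" for k using \<sigma>(3) that by (simp add: s'_def)
  ultimately show ?case by blast
qed

text \<open>Mirror image of \<open>null_homotopy\<close>, starting in degree \<open>n\<close>, where
  \<open>c\<close> is zero, and descending to 0. Again only a part of the homotopy is carried along:
  \<open>c d = d h d\<close> makes \<open>c - d h\<close> vanish on boundaries, so that this
  difference factors through \<open>d\<close>.\<close>

lemma null_homotopy_down:
  fixes A :: "nat \<Rightarrow> ('r, 'a) module"
  assumes A: "\<And>k. lmodule S (A k)" and d: "\<And>k. linear_map S (A (Suc k)) (A k) (d k)"
    and dd: "\<And>k x. x \<in> carrier (A (Suc (Suc k))) \<Longrightarrow> d k (d (Suc k) x) = \<zero>\<^bsub>A k\<^esub>"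
    and fac: "\<And>k v. \<lbrakk>linear_map S (A (Suc k)) (A (Suc k)) v;
      \<And>x. x \<in> carrier (A (Suc (Suc k))) \<Longrightarrow> v (d (Suc k) x) = \<zero>\<^bsub>A (Suc k)\<^esub>\<rbrakk> \<Longrightarrow>
      \<exists>u. linear_map S (A k) (A (Suc k)) u \<and> (\<forall>x\<in>carrier (A (Suc k)). v x = u (d k x))"
    and c: "\<And>k. linear_map S (A k) (A k) (c k)"
      "\<And>k x. x \<in> carrier (A (Suc k)) \<Longrightarrow> c k (d k x) = d k (c (Suc k) x)"
      "\<And>k x. \<lbrakk>k \<ge> n; x \<in> carrier (A k)\<rbrakk> \<Longrightarrow> c k x = \<zero>\<^bsub>A k\<^esub>"
  obtains h where "linear_map S (A 0) (A (Suc 0)) h"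
    "\<And>x. x \<in> carrier (A (Suc 0)) \<Longrightarrow> c 0 (d 0 x) = d 0 (h (d 0 x))"
proof -
  have "\<exists>h. linear_map S (A 0) (A (Suc 0)) h \<and> (\<forall>x\<in>carrier (A (Suc 0)). c 0 (d 0 x) = d 0 (h (d 0 x)))"
  proof (rule inc_induct[of 0 n "\<lambda>k. \<exists>h. linear_map S (A k) (A (Suc k)) h
    \<and> (\<forall>x\<in>carrier (A (Suc k)). c k (d k x) = d k (h (d k x)))"])
    show "\<exists>h. linear_map S (A n) (A (Suc n)) h \<and> (\<forall>x\<in>carrier (A (Suc n)). c n (d n x) = d n (h (d n x)))"
      using linear_map_const_zero[OF A] c(3) linear_map_closed[OF d] linear_map_zero[OF A A d]
      by (intro exI[of _ "\<lambda>x. \<zero>\<^bsub>A (Suc n)\<^esub>"]) auto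
    fix k assume "\<exists>h. linear_map S (A (Suc k)) (A (Suc (Suc k))) h \<and>
        (\<forall>x\<in>carrier (A (Suc (Suc k))). c (Suc k) (d (Suc k) x) = d (Suc k) (h (d (Suc k) x)))"
    then obtain h where h: "linear_map S (A (Suc k)) (A (Suc (Suc k))) h"
      "\<And>x. x \<in> carrier (A (Suc (Suc k))) \<Longrightarrow> c (Suc k) (d (Suc k) x) = d (Suc k) (h (d (Suc k) x))" by blast
    interpret K: lmodule S "A (Suc k)" by (rule A)
    interpret K0: lmodule S "A k" by (rule A)
    let ?w = "\<lambda>x. c (Suc k) x \<ominus>\<^bsub>A (Suc k)\<^esub> d (Suc k) (h x)"
    note dh = linear_map_comp[OF h(1) d]
    have w: "linear_map S (A (Suc k)) (A (Suc k)) ?w" by (rule linear_map_diff[OF A c(1) dh])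
    have "?w (d (Suc k) x) = \<zero>\<^bsub>A (Suc k)\<^esub>" if x: "x \<in> carrier (A (Suc (Suc k)))" for x
      using h(2)[OF x] linear_map_closed[OF dh linear_map_closed[OF d x]] by (simp add: K.minus_eq_zero_iff)
    then obtain u where u: "linear_map S (A k) (A (Suc k)) u" "\<And>x. x \<in> carrier (A (Suc k)) \<Longrightarrow> ?w x = u (d k x)"
      using fac[OF w] by blast
    have "c k (d k x) = d k (u (d k x))" if x: "x \<in> carrier (A (Suc k))" for x
    proof -
      have "d k (u (d k x)) = d k (c (Suc k) x) \<ominus>\<^bsub>A k\<^esub> d k (d (Suc k) (h x))"
        unfolding u(2)[OF x, symmetric]
        by (rule linear_map_minus[OF A A d linear_map_closed[OF c(1) x] linear_map_closed[OF dh x]])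
      also have "\<dots> = d k (c (Suc k) x)"
        using dd[OF linear_map_closed[OF h(1) x]] linear_map_closed[OF d linear_map_closed[OF c(1) x]]
        by (simp add: a_minus_def)
      finally show ?thesis using c(2)[OF x] by simp
    qed
    then show "\<exists>h. linear_map S (A k) (A (Suc k)) h \<and> (\<forall>x\<in>carrier (A (Suc k)). c k (d k x) = d k (h (d k x)))"
      using u(1) by blast
  qed simp
  then show thesis using that by blast
qed

text \<open>Chosen preimages play the role of cosets, because the augmentation of a resolution is a
  map onto \<open>M\<close> and not literally a quotient.\<close>

lemma surj_factor:
  assumes "lmodule S A" "lmodule S M" "lmodule S X" "linear_map S A M e" "e ` carrier A = carrier M"
    "linear_map S A X w" "\<And>x. \<lbrakk>x \<in> carrier A; e x = \<zero>\<^bsub>M\<^esub>\<rbrakk> \<Longrightarrow> w x = \<zero>\<^bsub>X\<^esub>"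
  obtains u where "linear_map S M X u" "\<And>x. x \<in> carrier A \<Longrightarrow> u (e x) = w x"
proof -
  interpret A: lmodule S A by fact
  interpret M: lmodule S M by fact
  interpret X: lmodule S X by fact
  note ec = linear_map_closed[OF assms(4)] and wc = linear_map_closed[OF assms(6)]
  define u where "u m = w (inv_into (carrier A) e m)" for m
  have u: "u (e x) = w x" if x: "x \<in> carrier A" for x
  proof -
    have "e x \<in> e ` carrier A" using x by simp
    then have y: "inv_into (carrier A) e (e x) \<in> carrier A" "e (inv_into (carrier A) e (e x)) = e x"
      by (simp_all add: inv_into_into f_inv_into_f)
    have "w (inv_into (carrier A) e (e x) \<ominus>\<^bsub>A\<^esub> x) = \<zero>\<^bsub>X\<^esub>"
      using y x ec by (intro assms(7)) (simp_all add: linear_map_minus[OF assms(1,2,4)] M.minus_eq_zero_iff)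
    then show ?thesis
      using y(1) x wc by (simp add: u_def linear_map_minus[OF assms(1,3,6)] X.minus_eq_zero_iff)
  qed
  have "linear_map S M X u"
    unfolding linear_map_def assms(5)[symmetric]
    using u wc ec by (auto simp: linear_map_add[OF assms(4), symmetric] linear_map_smult[OF assms(4), symmetric]
        linear_map_add[OF assms(6)] linear_map_smult[OF assms(6)])
  then show thesis using that u by blast
qed

text \<open>
  \<open>\<alpha>\<close> and \<open>\<beta>\<close> identify \<open>M\<close> with \<open>bd T 0 ` T\<^sub>0\<close> up to maps which factor through projective modules,
  namely through \<open>T\<^sub>0\<close> and \<open>Q\<close>.
\<close>

lemma stable_comparison:
  fixes S :: "('k, 'r) module" and M :: "('r, 'm) module"
    and T :: "('r, 't) mcomplex" and P :: "('r, 'p) mcomplex"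
  assumes cpr: "complete_projective_resolution S M T \<tau> P \<pi>" and gor: "gorenstein_projective TYPE('g) S M"
  obtains \<alpha> \<beta> h u p and Q :: "('r, 'p) module" where
    "projective S Q" "linear_map S (obj T 0) M \<alpha>" "\<And>x. x \<in> carrier (obj T 1) \<Longrightarrow> \<alpha> (bd T 1 x) = \<zero>\<^bsub>M\<^esub>"
    "linear_map S M (obj T (- 1)) \<beta>" "\<And>m. m \<in> carrier M \<Longrightarrow> \<beta> m \<in> bd T 0 ` carrier (obj T 0)"
    "linear_map S (obj T (- 1)) (obj T 0) h" "linear_map S M Q u" "linear_map S Q M p"
    "\<And>t. t \<in> carrier (obj T 0) \<Longrightarrow> \<beta> (\<alpha> t) = bd T 0 (t \<oplus>\<^bsub>obj T 0\<^esub> h (bd T 0 t))"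
    "\<And>m t. \<lbrakk>m \<in> carrier M; t \<in> carrier (obj T 0); bd T 0 t = \<beta> m\<rbrakk> \<Longrightarrow> \<alpha> t = m \<oplus>\<^bsub>M\<^esub> p (u m)"
proof -
  have M: "lmodule S M" using gor by (simp add: gorenstein_projective_def)
  interpret M: lmodule S M by fact
  obtain G :: "('r, 'g) mcomplex" and f where G: "totally_acyclic S G"
    "linear_map S M (quot_module (obj G 0) (bd G 1 ` carrier (obj G 1))) f"
    "bij_betw f (carrier M) (carrier (quot_module (obj G 0) (bd G 1 ` carrier (obj G 1))))"
    using gor by (auto simp: gorenstein_projective_def module_iso_def)
  obtain \<epsilon>G where rG: "resolution S (\<lambda>k. obj G (int k)) (\<lambda>k. bd G (int k + 1)) M \<epsilon>G"
    using totally_acyclic_resolution[OF G(1) M G(2,3)] by blast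
  obtain A :: "nat \<Rightarrow> ('r, 'p) module" and d \<epsilon> \<rho> n where rA: "resolution S A d M \<epsilon>"
    and \<rho>: "\<And>k. linear_map S (obj T (int k)) (A k) (\<rho> k)"
    "\<And>k x. x \<in> carrier (obj T (int k + 1)) \<Longrightarrow> \<rho> k (bd T (int k + 1) x) = d k (\<rho> (Suc k) x)"
    "\<And>k. k \<ge> n \<Longrightarrow> bij_betw (\<rho> k) (carrier (obj T (int k))) (carrier (A k))"
    using ordinary_resolution[OF cpr M] by blast
  note A' = resolutionD[OF rA]
  have tT: "totally_acyclic S T" using cpr by (simp add: complete_projective_resolution_def)
  then have cT: "chain_complex S T" and pT: "projective S (obj T i)" and aT: "cycles T i = boundaries T i" for i
    by (simp_all add: totally_acyclic_def acyclic_complex_def)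
  note T' = chain_complexD[OF cT]
  define B where "B k = obj T (int k)" for k
  define b where "b k = bd T (int k + 1)" for k
  have BS: "B (Suc k) = obj T (int k + 1)" for k by (simp add: B_def add.commute)
  have lB: "lmodule S (B k)" and pB: "projective S (B k)" for k using T'(1) pT by (simp_all add: B_def)
  have bl: "linear_map S (B (Suc k)) (B k) (b k)" for k using T'(3)[of "int k"] unfolding BS
    by (simp add: B_def b_def)
  have bb: "b k (b (Suc k) x) = \<zero>\<^bsub>B k\<^esub>" if "x \<in> carrier (B (Suc (Suc k)))" for k x
  proof -
    have "x \<in> carrier (obj T (int k + 1 + 1))" using that by (simp add: B_def add.commute)
    moreover have "bd T (int k + 1) (bd T (int k + 1 + 1) x) = \<zero>\<^bsub>obj T (int k + 1 - 1)\<^esub>"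
      using T'(4)[of x "int k + 1"] calculation by blast
    moreover have "int k + 1 - 1 = int k" "int (Suc k) + 1 = int k + 1 + 1" by simp_all
    ultimately show ?thesis unfolding b_def B_def by metis
  qed
  have \<rho>B: "linear_map S (B k) (A k) (\<rho> k)" for k using \<rho>(1) by (simp add: B_def)
  have \<rho>b: "\<rho> k (b k x) = d k (\<rho> (Suc k) x)" if "x \<in> carrier (B (Suc k))" for k x
    using \<rho>(2) that by (simp add: BS b_def)
  have facT: "\<exists>u. linear_map S (B k) X u \<and> (\<forall>x\<in>carrier (B (Suc k)). v x = u (b k x))"
    if X: "projective S X" and v: "linear_map S (B (Suc k)) X v"
      "\<And>x. x \<in> carrier (B (Suc (Suc k))) \<Longrightarrow> v (b (Suc k) x) = \<zero>\<^bsub>X\<^esub>" for k v and X :: "('r, 'x) module"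
  proof -
    have e: "int (Suc (Suc k)) = int k + 2" "int (Suc k) + 1 = int k + 2" by simp_all
    have "v (bd T (int k + 2) x) = \<zero>\<^bsub>X\<^esub>" if "x \<in> carrier (obj T (int k + 2))" for x
      using v(2)[of x] that unfolding B_def b_def e .
    then obtain u where "linear_map S (obj T (int k)) X u"
      "\<And>x. x \<in> carrier (obj T (int k + 1)) \<Longrightarrow> v x = u (bd T (int k + 1) x)"
      using totally_acyclic_factor[OF tT X v(1)[unfolded BS]] by blast
    then show ?thesis unfolding BS b_def by (auto simp: B_def)
  qed
  have facG: "\<exists>u. linear_map S (obj G (int k)) X u \<and> (\<forall>x\<in>carrier (obj G (int (Suc k))). v x
    = u (bd G (int k + 1) x))"
    if X: "projective S X" and v: "linear_map S (obj G (int (Suc k))) X v"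
      "\<And>x. x \<in> carrier (obj G (int (Suc (Suc k)))) \<Longrightarrow> v (bd G (int (Suc k) + 1) x) = \<zero>\<^bsub>X\<^esub>" for k v
        and X :: "('r, 'x) module"
  proof -
    have e: "int (Suc (Suc k)) = int k + 2" "int (Suc k) + 1 = int k + 2" "int (Suc k) = int k + 1" by simp_all
    have "v (bd G (int k + 2) x) = \<zero>\<^bsub>X\<^esub>" if "x \<in> carrier (obj G (int k + 2))" for x
      using v(2)[of x] that unfolding e(1,2) .
    then obtain u where "linear_map S (obj G (int k)) X u"
      "\<And>x. x \<in> carrier (obj G (int k + 1)) \<Longrightarrow> v x = u (bd G (int k + 1) x)"
      using totally_acyclic_factor[OF G(1) X v(1)[unfolded e(3)]] by blast
    then show ?thesis unfolding e(3) by auto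
  qed
  \<comment> \<open>In nonnegative degrees \<open>G\<close> resolves \<open>M\<close>, so its total
    acyclicity carries over to \<open>A\<close>. The complex \<open>T\<close> is so far tied to
    \<open>A\<close> only in high degrees and cannot supply this.\<close>
  have facA: "\<exists>u. linear_map S (A k) X u \<and> (\<forall>x\<in>carrier (A (Suc k)). v x = u (d k x))"
    if X: "projective S X" and v: "linear_map S (A (Suc k)) X v"
      "\<And>x. x \<in> carrier (A (Suc (Suc k))) \<Longrightarrow> v (d (Suc k) x) = \<zero>\<^bsub>X\<^esub>" for k v and X :: "('r, 'x) module"
    using resolution_factor[OF rA rG projective_lmodule[OF X] facG[OF X] v] by blast
  define s where "s k = inv_into (carrier (B k)) (\<rho> k)" for k
  have bij: "bij_betw (\<rho> k) (carrier (B k)) (carrier (A k))" if "k \<ge> n" for k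
    using \<rho>(3)[OF that] by (simp add: B_def)
  have s\<rho>: "s k (\<rho> k x) = x" if "k \<ge> n" "x \<in> carrier (B k)" for k x
    using bij[OF that(1)] that(2) by (auto simp: s_def bij_betw_def)
  have sc: "s k y \<in> carrier (B k)" "\<rho> k (s k y) = y" if "k \<ge> n" "y \<in> carrier (A k)" for k y
    using bij[OF that(1)] that(2) by (auto simp: s_def bij_betw_def f_inv_into_f inv_into_into)
  have s1: "linear_map S (A k) (B k) (s k)" if k: "k \<ge> n" for k
    unfolding s_def by (rule linear_map_inv_into[OF lB \<rho>B bij[OF k]])
  have s2: "s k (d k x) = b k (s (Suc k) x)" if k: "k \<ge> n" and x: "x \<in> carrier (A (Suc k))" for k x
  proof -
    have c: "s (Suc k) x \<in> carrier (B (Suc k))" "\<rho> (Suc k) (s (Suc k) x) = x" using sc k x by simp_all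
    have "s k (d k x) = s k (\<rho> k (b k (s (Suc k) x)))" using \<rho>b[OF c(1)] c(2) by simp
    then show ?thesis using s\<rho>[OF k] linear_map_closed[OF bl c(1)] by simp
  qed
  have "\<exists>\<sigma>. (\<forall>k. linear_map S (A k) (B k) (\<sigma> k)) \<and>
    (\<forall>k. \<forall>x\<in>carrier (A (Suc k)). \<sigma> k (d k x) = b k (\<sigma> (Suc k) x)) \<and> (\<forall>k\<ge>n. \<sigma> k = s k)"
    using facA[OF pB] by (intro chain_extension_down A'(4) bl bb s1 s2) blast+
  then obtain \<sigma> where \<sigma>: "\<And>k. linear_map S (A k) (B k) (\<sigma> k)"
    "\<And>k x. x \<in> carrier (A (Suc k)) \<Longrightarrow> \<sigma> k (d k x) = b k (\<sigma> (Suc k) x)" "\<And>k. k \<ge> n \<Longrightarrow> \<sigma> k = s k"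
    by blast
  note \<rho>c = linear_map_closed[OF \<rho>B] and \<sigma>c = linear_map_closed[OF \<sigma>(1)] and bc = linear_map_closed[OF bl]
    and dc = linear_map_closed[OF A'(4)]
  note \<sigma>\<rho> = linear_map_comp[OF \<rho>B \<sigma>(1)] and \<rho>\<sigma> = linear_map_comp[OF \<sigma>(1) \<rho>B]
  interpret B0: lmodule S "B 0" by (rule lB)
  interpret A0: lmodule S "A 0" by (rule A'(3))
  \<comment> \<open>\<open>\<sigma> \<rho> - 1\<close> on \<open>T\<close> and, below,
    \<open>\<rho> \<sigma> - 1\<close> on \<open>A\<close> vanish in all degrees from
    \<open>n\<close> on, so \<open>null_homotopy_down\<close> applies to both.\<close>
  define cB where "cB k = (\<lambda>x. \<sigma> k (\<rho> k x) \<ominus>\<^bsub>B k\<^esub> x)" for k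
  have cB: "linear_map S (B k) (B k) (cB k)" for k
    unfolding cB_def by (rule linear_map_diff[OF lB \<sigma>\<rho> linear_map_ident])
  have cBb: "cB k (b k x) = b k (cB (Suc k) x)" if x: "x \<in> carrier (B (Suc k))" for k x
    using x by (simp add: cB_def \<rho>b \<sigma>(2)[OF \<rho>c[OF x]] linear_map_minus[OF lB lB bl linear_map_closed[OF \<sigma>\<rho> x] x])
  have cB0: "cB k x = \<zero>\<^bsub>B k\<^esub>" if "k \<ge> n" "x \<in> carrier (B k)" for k x
    using that \<sigma>(3) s\<rho> lmodule.minus_eq_zero_iff[OF lB] by (simp add: cB_def)
  obtain h0 where h0: "linear_map S (B 0) (B (Suc 0)) h0"
    "\<And>x. x \<in> carrier (B (Suc 0)) \<Longrightarrow> cB 0 (b 0 x) = b 0 (h0 (b 0 x))"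
    using null_homotopy_down[of S B b, OF lB bl bb facT[OF pB] cB cBb cB0, of n] by blast
  define cA where "cA k = (\<lambda>x. \<rho> k (\<sigma> k x) \<ominus>\<^bsub>A k\<^esub> x)" for k
  have cA: "linear_map S (A k) (A k) (cA k)" for k
    unfolding cA_def by (rule linear_map_diff[OF A'(3) \<rho>\<sigma> linear_map_ident])
  have cAd: "cA k (d k x) = d k (cA (Suc k) x)" if x: "x \<in> carrier (A (Suc k))" for k x
    using x by (simp add: cA_def \<sigma>(2) \<rho>b[OF \<sigma>c[OF x]] linear_map_minus[OF A'(3) A'(3) A'(4)
      linear_map_closed[OF \<rho>\<sigma> x] x])
  have cA0: "cA k x = \<zero>\<^bsub>A k\<^esub>" if "k \<ge> n" "x \<in> carrier (A k)" for k x
    using that \<sigma>(3) sc lmodule.minus_eq_zero_iff[OF A'(3)] by (simp add: cA_def)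
  obtain k0 where k0: "linear_map S (A 0) (A (Suc 0)) k0"
    "\<And>x. x \<in> carrier (A (Suc 0)) \<Longrightarrow> cA 0 (d 0 x) = d 0 (k0 (d 0 x))"
    using null_homotopy_down[of S A d, OF A'(3) A'(4) A'(9) facA[OF A'(2)] cA cAd cA0, of n] by blast
  have B0: "B 0 = obj T 0" and B1: "B (Suc 0) = obj T 1" and b0: "b 0 = bd T 1" by (simp_all add: B_def b_def)
  have d0: "linear_map S (obj T 0) (obj T (- 1)) (bd T 0)" using T'(2)[of 0] by simp
  have dd0: "bd T 0 (bd T 1 x) = \<zero>\<^bsub>obj T (- 1)\<^esub>" if "x \<in> carrier (obj T 1)" for x
    using T'(4)[of x 0] that by simp
  note bh0 = linear_map_comp[OF h0(1) bl] and dk0 = linear_map_comp[OF k0(1) A'(4)]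
  \<comment> \<open>\<open>w\<close> kills the image of \<open>bd T 1\<close>. Total acyclicity with
    \<open>i = - 1\<close>, below the range of the resolution, gives \<open>h\<close>. So
    \<open>\<sigma> \<rho> = 1 + b h0 + h d\<close> in degree 0, with
    \<open>d = bd T 0\<close>.\<close>
  define w where "w x = cB 0 x \<ominus>\<^bsub>B 0\<^esub> b 0 (h0 x)" for x
  have w: "linear_map S (obj T (- 1 + 1)) (B 0) w"
    using linear_map_diff[OF lB cB bh0] by (simp add: w_def[abs_def] B0)
  have wd: "w (bd T (- 1 + 2) x) = \<zero>\<^bsub>B 0\<^esub>" if "x \<in> carrier (obj T (- 1 + 2))" for x
  proof -
    have x: "x \<in> carrier (B (Suc 0))" using that by (simp add: B1)
    show ?thesis using h0(2)[OF x] linear_map_closed[OF bh0 bc[OF x]] b0 by (simp add: w_def B0.minus_eq_zero_iff)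
  qed
  obtain h where h: "linear_map S (obj T (- 1)) (B 0) h" "\<And>x. x \<in> carrier (obj T 0) \<Longrightarrow> w x = h (bd T 0 x)"
    using totally_acyclic_factor[OF tT pB w wd] by auto
  \<comment> \<open>\<open>A\<close> stops at \<open>M\<close>, so here the remaining error factors
    through \<open>\<epsilon>\<close>: \<open>\<rho> \<sigma> = 1 + d k0 + u \<epsilon>\<close> in
    degree 0. The \<open>Q\<close> and \<open>p\<close> of the statement are \<open>A 0\<close> and
    \<open>\<epsilon>\<close>.\<close>
  define w' where "w' x = cA 0 x \<ominus>\<^bsub>A 0\<^esub> d 0 (k0 x)" for x
  have w': "linear_map S (A 0) (A 0) w'"
    unfolding w'_def by (rule linear_map_diff[OF A'(3) cA dk0])
  have w'0: "w' x = \<zero>\<^bsub>A 0\<^esub>" if x: "x \<in> carrier (A 0)" "\<epsilon> x = \<zero>\<^bsub>M\<^esub>" for x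
  proof -
    obtain y where y: "y \<in> carrier (A (Suc 0))" "x = d 0 y" using A'(8)[OF x] by blast
    show ?thesis using k0(2)[OF y(1)] linear_map_closed[OF dk0 x(1)] y(2)
      by (simp add: w'_def A0.minus_eq_zero_iff)
  qed
  obtain u where u: "linear_map S M (A 0) u" "\<And>x. x \<in> carrier (A 0) \<Longrightarrow> u (\<epsilon> x) = w' x"
    using surj_factor[OF A'(3) M A'(3) A'(5) A'(6) w' w'0] by blast
  have d\<sigma>: "linear_map S (A 0) (obj T (- 1)) (\<lambda>x. bd T 0 (\<sigma> 0 x))"
    by (rule linear_map_comp[OF \<sigma>(1) d0[folded B0]])
  have d\<sigma>0: "bd T 0 (\<sigma> 0 x) = \<zero>\<^bsub>obj T (- 1)\<^esub>" if x: "x \<in> carrier (A 0)" "\<epsilon> x = \<zero>\<^bsub>M\<^esub>" for x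
  proof -
    obtain y where y: "y \<in> carrier (A (Suc 0))" "x = d 0 y" using A'(8)[OF x] by blast
    show ?thesis using \<sigma>(2)[OF y(1)] y(2) dd0 \<sigma>c[OF y(1)] by (simp add: b0 B1)
  qed
  \<comment> \<open>\<open>\<beta>\<close> is induced by \<open>\<sigma> 0\<close> on
    \<open>M\<close>, the cokernel of \<open>A 1 -> A 0\<close>, with values in the image of
    \<open>bd T 0\<close>. In the other direction \<open>\<alpha>\<close> is \<open>\<rho> 0\<close>
    followed by \<open>\<epsilon>\<close>.\<close>
  obtain \<beta> where \<beta>: "linear_map S M (obj T (- 1)) \<beta>" "\<And>x. x \<in> carrier (A 0) \<Longrightarrow> \<beta> (\<epsilon> x) = bd T 0 (\<sigma> 0 x)"
    using surj_factor[OF A'(3) M T'(1) A'(5) A'(6) d\<sigma> d\<sigma>0] by blast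
  define \<alpha> where "\<alpha> x = \<epsilon> (\<rho> 0 x)" for x
  have \<alpha>: "linear_map S (obj T 0) M \<alpha>"
    unfolding \<alpha>_def B0[symmetric] by (rule linear_map_comp[OF \<rho>B A'(5)])
  have \<alpha>d: "\<alpha> (bd T 1 x) = \<zero>\<^bsub>M\<^esub>" if "x \<in> carrier (obj T 1)" for x
    using \<rho>b[of x 0] A'(7) \<rho>c[of x "Suc 0"] that by (simp add: \<alpha>_def b0 B1)
  have im: "\<beta> m \<in> bd T 0 ` carrier (obj T 0)" if m: "m \<in> carrier M" for m
  proof -
    obtain a where "a \<in> carrier (A 0)" "m = \<epsilon> a" using m A'(6) by blast
    then show ?thesis using \<beta>(2) \<sigma>c[of a 0] by (simp add: B0)
  qed
  interpret Y: lmodule S "obj T (- 1)" by (rule T'(1))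
  have \<beta>\<alpha>: "\<beta> (\<alpha> t) = bd T 0 (t \<oplus>\<^bsub>obj T 0\<^esub> h (bd T 0 t))" if "t \<in> carrier (obj T 0)" for t
  proof -
    have t: "t \<in> carrier (B 0)" using that by (simp add: B0)
    note c1 = linear_map_closed[OF \<sigma>\<rho> t] and c2 = linear_map_closed[OF bh0 t]
      and c3 = linear_map_closed[OF h(1) linear_map_closed[OF d0 that]]
    have "h (bd T 0 t) = \<sigma> 0 (\<rho> 0 t) \<ominus>\<^bsub>B 0\<^esub> t \<ominus>\<^bsub>B 0\<^esub> b 0 (h0 t)"
      using h(2)[OF that] by (simp add: w_def cB_def)
    then have "t \<oplus>\<^bsub>B 0\<^esub> h (bd T 0 t) = \<sigma> 0 (\<rho> 0 t) \<ominus>\<^bsub>B 0\<^esub> b 0 (h0 t)"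
      using c1 c2 t by (simp add: a_minus_def B0.M.a_lcomm[of t] B0.M.a_assoc B0.M.r_neg1)
    then have "bd T 0 (t \<oplus>\<^bsub>obj T 0\<^esub> h (bd T 0 t)) = bd T 0 (\<sigma> 0 (\<rho> 0 t)) \<ominus>\<^bsub>obj T (- 1)\<^esub> bd T 0 (b 0 (h0 t))"
      using linear_map_minus[OF T'(1) T'(1) d0] c1 c2 by (simp add: B0)
    also have "bd T 0 (b 0 (h0 t)) = \<zero>\<^bsub>obj T (- 1)\<^esub>"
      using dd0 linear_map_closed[OF h0(1) t] by (simp add: b0 B1)
    finally show ?thesis
      using \<beta>(2)[OF \<rho>c[OF t]] linear_map_closed[OF d0, folded B0, OF c1] by (simp add: \<alpha>_def a_minus_def)
  qed
  \<comment> \<open>\<open>t\<close> differs from \<open>\<sigma> 0 a\<close> by a cycle of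
    \<open>T\<close>, hence by a boundary, which \<open>\<alpha>\<close> kills. The rest is the
    formula for \<open>\<rho> \<sigma>\<close> under \<open>\<epsilon>\<close>, where the term
    \<open>d k0\<close> disappears.\<close>
  have \<alpha>\<beta>: "\<alpha> t = m \<oplus>\<^bsub>M\<^esub> \<epsilon> (u m)" if m: "m \<in> carrier M" and t: "t \<in> carrier (obj T 0)"
    and e: "bd T 0 t = \<beta> m" for m t
  proof -
    interpret T0: lmodule S "obj T 0" by (rule T'(1))
    obtain a where a: "a \<in> carrier (A 0)" "m = \<epsilon> a" using m A'(6) by blast
    have sa: "\<sigma> 0 a \<in> carrier (obj T 0)" using \<sigma>c[OF a(1)] by (simp add: B0)
    have "bd T 0 (t \<ominus>\<^bsub>obj T 0\<^esub> \<sigma> 0 a) = \<zero>\<^bsub>obj T (- 1)\<^esub>"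
      using linear_map_minus[OF T'(1) T'(1) d0 t sa] e \<beta>(2)[OF a(1)] a(2) linear_map_closed[OF d0 sa]
      by (simp add: Y.minus_eq_zero_iff)
    then have "t \<ominus>\<^bsub>obj T 0\<^esub> \<sigma> 0 a \<in> cycles T 0" using t sa by (simp add: cycles_eq)
    then obtain y where y: "y \<in> carrier (obj T 1)" "t \<ominus>\<^bsub>obj T 0\<^esub> \<sigma> 0 a = bd T 1 y"
      using aT[of 0] by (auto simp: boundaries_def)
    have "\<alpha> t \<ominus>\<^bsub>M\<^esub> \<alpha> (\<sigma> 0 a) = \<zero>\<^bsub>M\<^esub>"
      using linear_map_minus[OF T'(1) M \<alpha> t sa] y \<alpha>d by simp
    then have "\<alpha> t = \<epsilon> (\<rho> 0 (\<sigma> 0 a))"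
      using linear_map_closed[OF \<alpha>] t sa by (simp add: M.minus_eq_zero_iff \<alpha>_def[symmetric])
    moreover have "\<epsilon> (u m) = \<epsilon> (\<rho> 0 (\<sigma> 0 a)) \<ominus>\<^bsub>M\<^esub> m"
    proof -
      note c1 = linear_map_closed[OF \<rho>\<sigma> a(1)] and c2 = linear_map_closed[OF dk0 a(1)]
        and ec = linear_map_closed[OF A'(5)]
      have "\<epsilon> (u m) = \<epsilon> ((\<rho> 0 (\<sigma> 0 a) \<ominus>\<^bsub>A 0\<^esub> a) \<ominus>\<^bsub>A 0\<^esub> d 0 (k0 a))"
        using u(2)[OF a(1)] a(2) by (simp add: w'_def cA_def)
      also have "\<dots> = (\<epsilon> (\<rho> 0 (\<sigma> 0 a)) \<ominus>\<^bsub>M\<^esub> m) \<ominus>\<^bsub>M\<^esub> \<epsilon> (d 0 (k0 a))"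
        using c1 c2 a by (simp add: linear_map_minus[OF A'(3) M A'(5)])
      also have "\<epsilon> (d 0 (k0 a)) = \<zero>\<^bsub>M\<^esub>" by (rule A'(7)[OF linear_map_closed[OF k0(1) a(1)]])
      finally show ?thesis using ec c1 m by (simp add: a_minus_def)
    qed
    ultimately show ?thesis
      using m linear_map_closed[OF A'(5) linear_map_closed[OF \<rho>\<sigma> a(1)]]
      by (simp add: a_minus_def M.M.a_lcomm[of m] M.M.r_neg)
  qed
  show thesis
    by (rule that[OF A'(2)[of 0] \<alpha> \<alpha>d \<beta>(1) im h(1)[unfolded B0] u(1) A'(5) \<beta>\<alpha> \<alpha>\<beta>])
qed

section \<open>Tensor products\<close>

lemma finsum_regular: "finsum (regular_module K) = finsum K"
  by (simp add: finsum_def finprod_def regular_module_def fun_eq_iff)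

text \<open>Evaluation at \<open>y\<close> is linear and turns the right-hand side into a sum in
  \<open>K\<close> to which only the fibre of \<open>h\<close> over \<open>y\<close>
  contributes.\<close>

lemma free_map_eq_lin_comb:
  assumes "ring K" "h ` A \<subseteq> B" "a \<in> carrier (free_module K A)"
  shows "free_map K h a = lin_comb K (free_module K B) (\<lambda>x. free_gen K (h x)) a"
proof (rule ext)
  fix y
  interpret K: ring K by fact
  let ?F = "free_module K B"
  define Q where "Q = {x. a x \<noteq> \<zero>\<^bsub>K\<^esub>}"
  have Q: "finite Q" "Q \<subseteq> A" using assms(3) by (auto simp: Q_def free_module_def)
  note am = free_mem[OF assms(1,3)]
  interpret F: lmodule K ?F by (rule lmodule_free) fact
  have g: "free_gen K (h x) \<in> carrier ?F" if "x \<in> Q" for x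
    by (rule free_gen_closed[OF assms(1)]) (use Q(2) assms(2) that in blast)
  have ev: "linear_map K ?F (regular_module K) (\<lambda>b. b y)"
    using free_mem[OF assms(1)] by (intro linear_mapI) (auto simp: regular_module_def free_module_def)
  have "lin_comb K ?F (\<lambda>x. free_gen K (h x)) a y = finsum K (\<lambda>x. (a x \<odot>\<^bsub>?F\<^esub> free_gen K (h x)) y) Q"
    unfolding lin_comb_def Q_def[symmetric] finsum_regular[of K, symmetric]
    using am g by (intro linear_map_finsum[OF F.lmodule_axioms lmodule_regular[OF assms(1)] ev]) auto
  also have "\<dots> = finsum K a {x. a x \<noteq> \<zero>\<^bsub>K\<^esub> \<and> h x = y}"
    using Q am by (intro K.add.finprod_mono_neutral_cong_right) (auto simp: free_module_def free_gen_def Q_def)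
  finally show "free_map K h a y = lin_comb K ?F (\<lambda>x. free_gen K (h x)) a y"
    by (simp add: free_map_def)
qed

text \<open>Evaluation maps out of a tensor product are linear over \<open>K\<close>, so their
  target is \<open>N\<close> as a \<open>K\<close>-module along the structure map, the action also
  used in \<open>hom_module\<close>.\<close>

definition restrict_scalars :: "('k, 'r) module \<Rightarrow> ('r, 'n) module \<Rightarrow> ('k, 'n) module" where
  "restrict_scalars R N = \<lparr>carrier = carrier N, mult = undefined, one = undefined, zero = \<zero>\<^bsub>N\<^esub>,
     add = add N, smult = (\<lambda>c n. (c \<odot>\<^bsub>R\<^esub> \<one>\<^bsub>R\<^esub>) \<odot>\<^bsub>N\<^esub> n)\<rparr>"

lemma restrict_scalars_simps [simp]:
  "carrier (restrict_scalars R N) = carrier N" "\<zero>\<^bsub>restrict_scalars R N\<^esub> = \<zero>\<^bsub>N\<^esub>"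
  "add (restrict_scalars R N) = add N" "c \<odot>\<^bsub>restrict_scalars R N\<^esub> n = (c \<odot>\<^bsub>R\<^esub> \<one>\<^bsub>R\<^esub>) \<odot>\<^bsub>N\<^esub> n"
  by (simp_all add: restrict_scalars_def)

lemma opp_ring_simps [simp]:
  "carrier (opp_ring R) = carrier R" "add (opp_ring R) = add R" "\<zero>\<^bsub>opp_ring R\<^esub> = \<zero>\<^bsub>R\<^esub>"
  "\<one>\<^bsub>opp_ring R\<^esub> = \<one>\<^bsub>R\<^esub>" "x \<otimes>\<^bsub>opp_ring R\<^esub> y = y \<otimes>\<^bsub>R\<^esub> x"
  by (simp_all add: opp_ring_def)

lemma regular_module_simps [simp]:
  "carrier (regular_module R) = carrier R" "add (regular_module R) = add R" "\<zero>\<^bsub>regular_module R\<^esub> = \<zero>\<^bsub>R\<^esub>"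
  "r \<odot>\<^bsub>regular_module R\<^esub> x = r \<otimes>\<^bsub>R\<^esub> x"
  by (simp_all add: regular_module_def)

lemma ring_opp: assumes "ring R" shows "ring (opp_ring R)"
proof -
  interpret ring R by fact
  have "\<exists>y\<in>carrier R. y \<oplus>\<^bsub>R\<^esub> x = \<zero>\<^bsub>R\<^esub>" if "x \<in> carrier R" for x
    using that l_neg by blast
  then show ?thesis
    by (intro ringI abelian_groupI monoidI) (simp_all add: a_ac m_assoc l_distr r_distr)
qed

text \<open>The right module is left variable because the tensor product is taken with
  \<open>M\<close>, with \<open>Q\<close> and with several modules of \<open>T\<close>, whose
  elements lie in different types.\<close>

locale tensor_right =
  fixes K :: "'k ring" and R :: "('k, 'r) module" and N :: "('r, 'n) module"
  assumes alg: "assoc_algebra K R" and N: "lmodule R N"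
begin

sublocale K: cring K using alg by (simp add: assoc_algebra_def module_def)
sublocale R: ring R using alg by (simp add: assoc_algebra_def)
sublocale N: lmodule R N by (rule N)

abbreviation "S \<equiv> opp_ring R"
abbreviation "\<kappa> c \<equiv> c \<odot>\<^bsub>R\<^esub> \<one>\<^bsub>R\<^esub>"

lemma ring_S: "ring S" by (rule ring_opp) (rule R.ring_axioms)

text \<open>The structure map from \<open>K\<close> to the centre of \<open>R\<close>. Centrality is
  what makes evaluation at a functional, and multiplication by \<open>r\<close> on \<open>N\<close>,
  linear over \<open>K\<close>.\<close>

lemma kappa:
  assumes "c \<in> carrier K"
  shows kappa_closed: "\<kappa> c \<in> carrier R"
    and kappa_add: "c' \<in> carrier K \<Longrightarrow> \<kappa> (c \<oplus>\<^bsub>K\<^esub> c') = \<kappa> c \<oplus>\<^bsub>R\<^esub> \<kappa> c'"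
    and kappa_mult: "c' \<in> carrier K \<Longrightarrow> \<kappa> (c \<otimes>\<^bsub>K\<^esub> c') = \<kappa> c \<otimes>\<^bsub>R\<^esub> \<kappa> c'"
    and kappa_central: "r \<in> carrier R \<Longrightarrow> \<kappa> c \<otimes>\<^bsub>R\<^esub> r = r \<otimes>\<^bsub>R\<^esub> \<kappa> c"
proof -
  interpret A: assoc_algebra K R by (rule alg)
  show "\<kappa> c \<in> carrier R" using assms by simp
  show "c' \<in> carrier K \<Longrightarrow> \<kappa> (c \<oplus>\<^bsub>K\<^esub> c') = \<kappa> c \<oplus>\<^bsub>R\<^esub> \<kappa> c'"
    using assms by (simp add: A.smult_l_distr)
  show "c' \<in> carrier K \<Longrightarrow> \<kappa> (c \<otimes>\<^bsub>K\<^esub> c') = \<kappa> c \<otimes>\<^bsub>R\<^esub> \<kappa> c'"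
    using assms by (simp add: A.smult_assoc1 A.smult_mult_left)
  show "r \<in> carrier R \<Longrightarrow> \<kappa> c \<otimes>\<^bsub>R\<^esub> r = r \<otimes>\<^bsub>R\<^esub> \<kappa> c"
    using assms by (simp add: A.smult_mult_left A.smult_mult_right)
qed

lemma kappa_one: "\<kappa> \<one>\<^bsub>K\<^esub> = \<one>\<^bsub>R\<^esub>"
proof -
  interpret A: assoc_algebra K R by (rule alg)
  show ?thesis by simp
qed

lemma lmodule_restrict_scalars: "lmodule R A \<Longrightarrow> lmodule K (restrict_scalars R A)"
proof -
  assume "lmodule R A"
  then interpret A: lmodule R A .
  have "\<exists>y\<in>carrier A. y \<oplus>\<^bsub>A\<^esub> x = \<zero>\<^bsub>A\<^esub>" if "x \<in> carrier A" for x
    using that A.M.l_neg by blast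
  then show ?thesis
    by (intro lmodule.intro lmodule_axioms.intro abelian_groupI K.ring_axioms)
      (simp_all add: kappa_closed kappa_add kappa_mult kappa_one A.M.a_assoc A.smult_l_distr A.smult_r_distr
        A.smult_assoc1,
       simp add: A.M.a_comm)
qed

abbreviation NK where "NK \<equiv> restrict_scalars R N"
lemmas NK = lmodule_restrict_scalars[OF N]

abbreviation free where "free X \<equiv> free_module K (carrier X \<times> carrier N)"
abbreviation rel where "rel X \<equiv> tensor_submodule K R X N"
abbreviation tens where "tens X \<equiv> tensor K R X N"
definition pure where "pure X x n = rel X +>\<^bsub>free X\<^esub> free_gen K (x, n)"

lemma lmodule_freeN: "lmodule K (free X)" by (rule lmodule_free) (rule K.ring_axioms)

lemma gen_closed: "\<lbrakk>x \<in> carrier X; n \<in> carrier N\<rbrakk> \<Longrightarrow> free_gen K (x, n) \<in> carrier (free X)"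
  by (rule free_gen_closed[OF K.ring_axioms]) simp

context
  fixes X :: "('r, 'x) module"
  assumes X: "lmodule S X"
begin

interpretation X: lmodule S X by (rule X)
interpretation F: lmodule K "free X" by (rule lmodule_freeN)

lemma relations_closed: "tensor_relations K R X N \<subseteq> carrier (free X)"
proof -
  have s: "\<And>r x. \<lbrakk>r \<in> carrier R; x \<in> carrier X\<rbrakk> \<Longrightarrow> r \<odot>\<^bsub>X\<^esub> x \<in> carrier X"
    using X.smult_closed by simp
  show ?thesis
    unfolding tensor_relations_def Let_def
    by (auto intro!: F.M.minus_closed F.M.a_closed F.smult_closed gen_closed s kappa_closed N.smult_closed
      X.M.a_closed N.M.a_closed)
qed

lemma submodule_rel: "submodule (rel X) K (free X)"
  unfolding tensor_submodule_def by (rule submodule_span[OF lmodule_freeN relations_closed])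

lemma lmodule_tensor: "lmodule K (tens X)"
  unfolding tensor_def by (rule lmodule_quot[OF lmodule_freeN submodule_rel])

lemma proj_linear: "linear_map K (free X) (tens X) (\<lambda>a. rel X +>\<^bsub>free X\<^esub> a)"
  unfolding tensor_def by (rule linear_quot[OF lmodule_freeN submodule_rel])

lemma carrier_tensor: "carrier (tens X) = (\<lambda>a. rel X +>\<^bsub>free X\<^esub> a) ` carrier (free X)"
  by (simp add: tensor_def carrier_quot)

lemma pure_closed: "\<lbrakk>x \<in> carrier X; n \<in> carrier N\<rbrakk> \<Longrightarrow> pure X x n \<in> carrier (tens X)"
  unfolding pure_def by (rule linear_map_closed[OF proj_linear gen_closed])

lemma proj_eq:
  assumes "a \<ominus>\<^bsub>free X\<^esub> b \<in> tensor_relations K R X N" "a \<in> carrier (free X)" "b \<in> carrier (free X)"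
  shows "rel X +>\<^bsub>free X\<^esub> a = rel X +>\<^bsub>free X\<^esub> b"
  using F.quot_eq_iff[OF submodule_rel assms(2,3)] assms(1) module_span_superset[of "tensor_relations K R X N"]
  unfolding tensor_submodule_def by blast

lemma pure_add_left:
  assumes "x \<in> carrier X" "x' \<in> carrier X" "n \<in> carrier N"
  shows "pure X (x \<oplus>\<^bsub>X\<^esub> x') n = pure X x n \<oplus>\<^bsub>tens X\<^esub> pure X x' n"
  unfolding pure_def using assms
  by (subst linear_map_add[OF proj_linear, symmetric], simp_all add: gen_closed, intro proj_eq)
    (auto simp: tensor_relations_def Let_def gen_closed)

lemma pure_add_right:
  assumes "x \<in> carrier X" "n \<in> carrier N" "n' \<in> carrier N"
  shows "pure X x (n \<oplus>\<^bsub>N\<^esub> n') = pure X x n \<oplus>\<^bsub>tens X\<^esub> pure X x n'"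
  unfolding pure_def using assms
  by (subst linear_map_add[OF proj_linear, symmetric], simp_all add: gen_closed, intro proj_eq)
    (auto simp: tensor_relations_def Let_def gen_closed)

lemma pure_balanced:
  assumes "r \<in> carrier R" "x \<in> carrier X" "n \<in> carrier N"
  shows "pure X (r \<odot>\<^bsub>X\<^esub> x) n = pure X x (r \<odot>\<^bsub>N\<^esub> n)"
  unfolding pure_def using assms X.smult_closed[of r x]
  by (intro proj_eq) (auto simp: tensor_relations_def Let_def gen_closed)

lemma pure_smult:
  assumes "c \<in> carrier K" "x \<in> carrier X" "n \<in> carrier N"
  shows "c \<odot>\<^bsub>tens X\<^esub> pure X x n = pure X x (\<kappa> c \<odot>\<^bsub>N\<^esub> n)"
  unfolding pure_def using assms
  by (subst linear_map_smult[OF proj_linear, symmetric], simp_all add: gen_closed, intro proj_eq)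
    (auto simp: tensor_relations_def Let_def gen_closed kappa_closed)

lemma pure_zero_right:
  assumes "x \<in> carrier X" shows "pure X x \<zero>\<^bsub>N\<^esub> = \<zero>\<^bsub>tens X\<^esub>"
proof -
  interpret T: lmodule K "tens X" by (rule lmodule_tensor)
  show ?thesis
    using pure_add_right[OF assms, of "\<zero>\<^bsub>N\<^esub>" "\<zero>\<^bsub>N\<^esub>"] pure_closed[OF assms, of "\<zero>\<^bsub>N\<^esub>"] T.M.add.r_cancel_one' by simp
qed

lemma pure_zero_left:
  assumes "n \<in> carrier N" shows "pure X \<zero>\<^bsub>X\<^esub> n = \<zero>\<^bsub>tens X\<^esub>"
proof -
  interpret T: lmodule K "tens X" by (rule lmodule_tensor)
  show ?thesis
    using pure_add_left[of "\<zero>\<^bsub>X\<^esub>" "\<zero>\<^bsub>X\<^esub>", OF _ _ assms] pure_closed[of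
      "\<zero>\<^bsub>X\<^esub>", OF _ assms] T.M.add.r_cancel_one' by simp
qed

text \<open>A scalar in front of a pure tensor can be moved into the second factor, and zero is
  itself a pure tensor; so every tensor is a nonempty sum of pure ones.\<close>

lemma tensor_induct [consumes 1, case_names pure add]:
  assumes z: "z \<in> carrier (tens X)"
    and p: "\<And>x n. \<lbrakk>x \<in> carrier X; n \<in> carrier N\<rbrakk> \<Longrightarrow> P (pure X x n)"
    and add: "\<And>y z. \<lbrakk>y \<in> carrier (tens X); z \<in> carrier (tens X); P y; P z\<rbrakk> \<Longrightarrow> P (y \<oplus>\<^bsub>tens X\<^esub> z)"
  shows "P z"
proof -
  obtain a where a: "a \<in> carrier (free X)" "z = rel X +>\<^bsub>free X\<^esub> a" using z by (auto simp: carrier_tensor)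
  define Q where "Q = {x. a x \<noteq> \<zero>\<^bsub>K\<^esub>}"
  have Q: "finite Q" "Q \<subseteq> carrier X \<times> carrier N" using a(1) by (auto simp: Q_def free_module_def)
  note am = free_mem[OF K.ring_axioms a(1)]
  have P0: "P \<zero>\<^bsub>tens X\<^esub>" using p[of "\<zero>\<^bsub>X\<^esub>" "\<zero>\<^bsub>N\<^esub>"] by (simp add: pure_zero_right)
  have "P (rel X +>\<^bsub>free X\<^esub> finsum (free X) (\<lambda>x. a x \<odot>\<^bsub>free X\<^esub> free_gen K x) Q')" if "finite Q'" "Q' \<subseteq> Q" for Q'
    using that
  proof (induction rule: finite_induct)
    case empty
    then show ?case using P0 linear_map_zero[OF lmodule_freeN lmodule_tensor proj_linear] by simp
  next
    case (insert y Q')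
    obtain x n where y: "y = (x, n)" "x \<in> carrier X" "n \<in> carrier N" using insert Q by auto
    have g: "w \<in> Q \<Longrightarrow> a w \<odot>\<^bsub>free X\<^esub> free_gen K w \<in> carrier (free X)" for w
      using Q am free_gen_closed[OF K.ring_axioms, of w] by auto
    have gs: "finsum (free X) (\<lambda>x. a x \<odot>\<^bsub>free X\<^esub> free_gen K x) Q' \<in> carrier (free X)"
      using g insert by (intro F.M.finsum_closed) auto
    have gy: "a y \<odot>\<^bsub>free X\<^esub> free_gen K y \<in> carrier (free X)" using g insert by auto
    have "finsum (free X) (\<lambda>x. a x \<odot>\<^bsub>free X\<^esub> free_gen K x) (insert y Q')
      = a y \<odot>\<^bsub>free X\<^esub> free_gen K y \<oplus>\<^bsub>free X\<^esub> finsum (free X) (\<lambda>x. a x \<odot>\<^bsub>free X\<^esub> free_gen K x) Q'"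
      using insert g by (intro F.M.finsum_insert) auto
    moreover have "rel X +>\<^bsub>free X\<^esub> (a y \<odot>\<^bsub>free X\<^esub> free_gen K y) = pure X x (\<kappa> (a y) \<odot>\<^bsub>N\<^esub> n)"
      using linear_map_smult[OF proj_linear am gen_closed] pure_smult[OF am y(2,3)] y unfolding pure_def by simp
    ultimately show ?case
      using linear_map_add[OF proj_linear gy gs] add[OF _ _ p insert.IH] linear_map_closed[OF proj_linear gs]
        linear_map_closed[OF proj_linear gy] insert.prems y am
      by (simp add: kappa_closed)
  qed
  from this[OF Q(1) order.refl] show ?thesis
    using free_expand[OF K.ring_axioms a(1)] a(2) by (simp add: lin_comb_def Q_def)
qed

lemma tensor_eqI:
  assumes "linear_map K (tens X) W f" "linear_map K (tens X) W g"
    "\<And>x n. \<lbrakk>x \<in> carrier X; n \<in> carrier N\<rbrakk> \<Longrightarrow> f (pure X x n) = g (pure X x n)" "z \<in> carrier (tens X)"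
  shows "f z = g z"
  using assms(4)
  by (induction rule: tensor_induct) (simp_all add: assms(3) linear_map_add[OF assms(1)]
    linear_map_add[OF assms(2)])

text \<open>The last four hypotheses on \<open>b\<close> match the four families in
  \<open>tensor_relations\<close>, so the linear extension of \<open>b\<close> kills their
  span.\<close>

lemma tensor_lift:
  assumes W: "lmodule K W"
    and b: "\<And>x n. \<lbrakk>x \<in> carrier X; n \<in> carrier N\<rbrakk> \<Longrightarrow> b x n \<in> carrier W"
    "\<And>x x' n. \<lbrakk>x \<in> carrier X; x' \<in> carrier X; n \<in> carrier N\<rbrakk> \<Longrightarrow> b (x \<oplus>\<^bsub>X\<^esub> x') n = b x n \<oplus>\<^bsub>W\<^esub> b x' n"
    "\<And>x n n'. \<lbrakk>x \<in> carrier X; n \<in> carrier N; n' \<in> carrier N\<rbrakk> \<Longrightarrow> b x (n \<oplus>\<^bsub>N\<^esub> n') = b x n \<oplus>\<^bsub>W\<^esub> b x n'"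
    "\<And>r x n. \<lbrakk>r \<in> carrier R; x \<in> carrier X; n \<in> carrier N\<rbrakk> \<Longrightarrow> b (r \<odot>\<^bsub>X\<^esub> x) n = b x (r \<odot>\<^bsub>N\<^esub> n)"
    "\<And>c x n. \<lbrakk>c \<in> carrier K; x \<in> carrier X; n \<in> carrier N\<rbrakk> \<Longrightarrow> c \<odot>\<^bsub>W\<^esub> b x n = b x (\<kappa> c \<odot>\<^bsub>N\<^esub> n)"
  shows "\<exists>g. linear_map K (tens X) W g \<and> (\<forall>x\<in>carrier X. \<forall>n\<in>carrier N. g (pure X x n) = b x n)"
proof -
  interpret W: lmodule K W by fact
  define \<phi> where "\<phi> = lin_comb K W (\<lambda>(x, n). b x n)"
  have \<phi>: "linear_map K (free X) W \<phi>"
    unfolding \<phi>_def by (rule lin_comb_linear[OF W]) (use b(1) in auto)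
  have \<phi>g: "\<phi> (free_gen K (x, n)) = b x n" if "x \<in> carrier X" "n \<in> carrier N" for x n
    unfolding \<phi>_def using lin_comb_gen[OF W, of "\<lambda>(x, n). b x n" "(x, n)"] b(1) that by simp
  have s: "\<And>r x. \<lbrakk>r \<in> carrier R; x \<in> carrier X\<rbrakk> \<Longrightarrow> r \<odot>\<^bsub>X\<^esub> x \<in> carrier X"
    using X.smult_closed by simp
  note lin = linear_map_minus[OF lmodule_freeN W \<phi>] linear_map_add[OF \<phi>] linear_map_smult[OF \<phi>]
  have r: "\<phi> (u \<ominus>\<^bsub>free X\<^esub> v) = \<zero>\<^bsub>W\<^esub>" if "u \<in> carrier (free X)" "v \<in> carrier (free X)" "\<phi> u = \<phi> v" for u v
    using that linear_map_closed[OF \<phi>] by (simp add: lin W.minus_eq_zero_iff)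
  have k: "submodule {a \<in> carrier (free X). \<phi> a = \<zero>\<^bsub>W\<^esub>} K (free X)"
    by (rule submodule_kernel[OF lmodule_freeN W \<phi>])
  have "\<phi> a = \<zero>\<^bsub>W\<^esub>" if "a \<in> tensor_relations K R X N" for a
    using that unfolding tensor_relations_def Let_def
    by (elim UnE; clarify; intro r F.M.a_closed F.smult_closed gen_closed s kappa_closed N.smult_closed
      X.M.a_closed N.M.a_closed)
      (simp_all add: lin gen_closed \<phi>g b s kappa_closed)
  then have "rel X \<subseteq> {a \<in> carrier (free X). \<phi> a = \<zero>\<^bsub>W\<^esub>}"
    unfolding tensor_submodule_def using relations_closed by (intro module_span_least k) auto
  then obtain g where g: "linear_map K (quot_module (free X) (rel X)) W g"
    "\<And>a. a \<in> carrier (free X) \<Longrightarrow> g (rel X +>\<^bsub>free X\<^esub> a) = \<phi> a"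
    using quot_lift[OF lmodule_freeN W submodule_rel \<phi>] by blast
  show ?thesis
    using g(1) by (intro exI[of _ g] conjI ballI) (simp_all add: tensor_def pure_def g(2) gen_closed \<phi>g)
qed

end

text \<open>\<open>tensor_map\<close> is given on representatives. The map \<open>G\<close> from the
  universal property is built independently of it, and then serves to show that
  \<open>free_map\<close> preserves the relations and induces \<open>G\<close>.\<close>

lemma tensor_map:
  assumes X: "lmodule S X" and Y: "lmodule S Y" and f: "linear_map S X Y f"
  shows tensor_map_linear: "linear_map K (tens X) (tens Y) (tensor_map K R Y N f)"
    and tensor_map_pure: "\<lbrakk>x \<in> carrier X; n \<in> carrier N\<rbrakk> \<Longrightarrow> tensor_map K R Y N f (pure X x n) = pure Y (f x) n"
proof -
  note fc = linear_map_closed[OF f]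
  have "\<exists>G. linear_map K (tens X) (tens Y) G \<and> (\<forall>x\<in>carrier X. \<forall>n\<in>carrier N. G (pure X x n) = pure Y (f x) n)"
    by (rule tensor_lift[OF X lmodule_tensor[OF Y]])
      (simp_all add: fc pure_closed[OF Y] pure_add_left[OF Y] pure_add_right[OF Y] pure_balanced[OF Y]
        pure_smult[OF Y] linear_map_add[OF f] linear_map_smult[OF f])
  then obtain G where G: "linear_map K (tens X) (tens Y) G"
    "\<And>x n. \<lbrakk>x \<in> carrier X; n \<in> carrier N\<rbrakk> \<Longrightarrow> G (pure X x n) = pure Y (f x) n"
    by blast
  let ?h = "map_prod f id :: _ \<times> 'n \<Rightarrow> _"
  have hc: "?h ` (carrier X \<times> carrier N) \<subseteq> carrier Y \<times> carrier N" using fc by auto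
  have L: "linear_map K (free X) (free Y) (lin_comb K (free Y) (\<lambda>x. free_gen K (?h x)))"
    by (rule lin_comb_linear[OF lmodule_freeN]) (use hc in \<open>blast intro: free_gen_closed[OF K.ring_axioms]\<close>)
  have fm: "free_map K ?h a = lin_comb K (free Y) (\<lambda>x. free_gen K (?h x)) a" if "a \<in> carrier (free X)" for a
    by (rule free_map_eq_lin_comb[OF K.ring_axioms hc that])
  have lin: "linear_map K (free X) (free Y) (free_map K ?h)"
    by (rule linear_map_cong[OF lmodule_freeN fm, THEN iffD2, OF _ L])
  have gen: "free_map K ?h (free_gen K (x, n)) = free_gen K (f x, n)" if "x \<in> carrier X" "n \<in> carrier N" for x n
    using fm[OF gen_closed[OF that]] lin_comb_gen[OF lmodule_freeN, of "\<lambda>x. free_gen K (?h x)"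
      "(x, n)" Y] gen_closed[OF fc[OF that(1)] that(2)] by simp
  have e: "rel Y +>\<^bsub>free Y\<^esub> free_map K ?h a = G (rel X +>\<^bsub>free X\<^esub> a)" if a: "a \<in> carrier (free X)" for a
  proof (rule linear_eq_on_free[OF lmodule_tensor[OF Y] linear_map_comp[OF lin proj_linear[OF Y]]
        linear_map_comp[OF proj_linear[OF X] G(1)] _ a])
    fix p assume "p \<in> carrier X \<times> carrier N"
    then obtain x n where p: "p = (x, n)" "x \<in> carrier X" "n \<in> carrier N" by auto
    show "rel Y +>\<^bsub>free Y\<^esub> free_map K ?h (free_gen K p) = G (rel X +>\<^bsub>free X\<^esub> free_gen K p)"
      using G(2)[OF p(2,3)] gen[OF p(2,3)] p(1) by (simp add: pure_def)
  qed
  \<comment> \<open>An element of \<open>rel X\<close> represents zero and \<open>G\<close> sends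
    zero to zero, so the image lies in \<open>rel Y\<close>; this way no single relation has to be
    inspected.\<close>
  have sub: "free_map K ?h ` rel X \<subseteq> rel Y"
  proof
    fix b assume "b \<in> free_map K ?h ` rel X"
    then obtain a where a: "a \<in> rel X" "b = free_map K ?h a" by blast
    have ac: "a \<in> carrier (free X)"
      using submodule_rel[OF X] a(1) by (auto simp: lmodule.submodule_iff[OF lmodule_freeN])
    have "rel X +>\<^bsub>free X\<^esub> a = \<zero>\<^bsub>tens X\<^esub>"
      using lmodule.coset_eq_iff[OF lmodule_freeN submodule_rel[OF X] ac] a(1) by (simp add: tensor_def zero_quot)
    then have "rel Y +>\<^bsub>free Y\<^esub> b = rel Y"
      using e[OF ac] a(2) linear_map_zero[OF lmodule_tensor[OF X] lmodule_tensor[OF Y] G(1)]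
      by (simp add: tensor_def zero_quot)
    then show "b \<in> rel Y"
      using lmodule.coset_eq_iff[OF lmodule_freeN submodule_rel[OF Y] linear_map_closed[OF lin ac]] a(2) by simp
  qed
  have "tensor_map K R Y N f z = G z" if z: "z \<in> carrier (tens X)" for z
  proof -
    obtain a where a: "a \<in> carrier (free X)" "z = rel X +>\<^bsub>free X\<^esub> a" using z by (auto simp: carrier_tensor[OF X])
    show ?thesis
      unfolding tensor_map_def a(2)
      using coset_map_coset[OF lmodule_freeN lmodule_freeN submodule_rel[OF X] submodule_rel[OF Y] lin sub
        a(1)] e[OF a(1)] by simp
  qed
  note eq = this
  show "linear_map K (tens X) (tens Y) (tensor_map K R Y N f)"
    by (rule linear_map_cong[OF lmodule_tensor[OF X] eq, THEN iffD2, OF _ G(1)])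
  show "tensor_map K R Y N f (pure X x n) = pure Y (f x) n" if "x \<in> carrier X" "n \<in> carrier N"
    using eq[OF pure_closed[OF X that]] G(2)[OF that] by simp
qed

section \<open>Evaluation of functionals\<close>

abbreviation functional where "functional X \<psi> \<equiv> linear_map S X (regular_module S) \<psi>"

text \<open>\<open>\<psi>\<close> tensored with \<open>N\<close>, followed by the isomorphism of
  \<open>R \<otimes> N\<close> with \<open>N\<close>. The choice determines it on the tensor product
  when \<open>\<psi>\<close> is a functional.\<close>

definition ev where
  "ev X \<psi> = (SOME g. linear_map K (tens X) NK g \<and>
     (\<forall>x\<in>carrier X. \<forall>n\<in>carrier N. g (pure X x n) = \<psi> x \<odot>\<^bsub>N\<^esub> n))"

lemma ev:
  assumes X: "lmodule S X" and p: "functional X \<psi>"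
  shows ev_linear: "linear_map K (tens X) NK (ev X \<psi>)"
    and ev_pure: "\<lbrakk>x \<in> carrier X; n \<in> carrier N\<rbrakk> \<Longrightarrow> ev X \<psi> (pure X x n) = \<psi> x \<odot>\<^bsub>N\<^esub> n"
proof -
  have pc: "\<psi> x \<in> carrier R" if "x \<in> carrier X" for x using linear_map_closed[OF p that] by simp
  have "\<exists>g. linear_map K (tens X) NK g \<and> (\<forall>x\<in>carrier X. \<forall>n\<in>carrier N. g (pure X x n) = \<psi> x \<odot>\<^bsub>N\<^esub> n)"
    by (rule tensor_lift[OF X NK])
      (simp_all add: pc linear_map_add[OF p] linear_map_smult[OF p] N.smult_l_distr N.smult_r_distr
        N.smult_assoc1[symmetric] kappa_closed kappa_central)
  from someI_ex[OF this, folded ev_def]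
  show "linear_map K (tens X) NK (ev X \<psi>)"
    "\<lbrakk>x \<in> carrier X; n \<in> carrier N\<rbrakk> \<Longrightarrow> ev X \<psi> (pure X x n) = \<psi> x \<odot>\<^bsub>N\<^esub> n" by auto
qed

lemma ev_tensor_map:
  assumes X: "lmodule S X" and Y: "lmodule S Y" and f: "linear_map S X Y f" and p: "functional Y \<psi>"
    and z: "z \<in> carrier (tens X)"
  shows "ev Y \<psi> (tensor_map K R Y N f z) = ev X (\<lambda>x. \<psi> (f x)) z"
  by (rule tensor_eqI[OF X linear_map_comp[OF tensor_map_linear[OF X Y f] ev_linear[OF Y p]]
        ev_linear[OF X linear_map_comp[OF f p]] _ z])
    (simp add: tensor_map_pure[OF X Y f] ev_pure[OF Y p] ev_pure[OF X linear_map_comp[OF f p]]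
      linear_map_closed[OF f])

text \<open>By choice \<open>ev\<close> depends on \<open>\<psi>\<close> as a function on the whole
  type, while on tensors only the values on the carrier count. Elements of the dual are cut off
  outside the carrier, so both views meet.\<close>

lemma ev_cong:
  assumes X: "lmodule S X" and p: "functional X \<psi>" and e: "\<And>x. x \<in> carrier X \<Longrightarrow> \<psi> x = \<phi> x"
    and z: "z \<in> carrier (tens X)"
  shows "ev X \<psi> z = ev X \<phi> z"
proof -
  have "functional X \<phi>"
    by (rule linear_map_cong[OF X, where f = \<psi> and g = \<phi>, OF e, THEN iffD1, OF _ p])
  then show ?thesis
    by (intro tensor_eqI[OF X ev_linear[OF X p] ev_linear[OF X] _ z]) (simp_all add: ev_pure[OF X] p e)
qed

lemma pure_finsum_left:
  assumes X: "lmodule S X" and "\<And>i. i \<in> J \<Longrightarrow> y i \<in> carrier X" "n \<in> carrier N"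
  shows "pure X (finsum X y J) n = finsum (tens X) (\<lambda>i. pure X (y i) n) J"
proof -
  interpret X: lmodule S X by fact
  interpret T: lmodule K "tens X" by (rule lmodule_tensor[OF X])
  show ?thesis using assms(2)
  proof (induction J rule: infinite_finite_induct)
    case (insert i J)
    then have "finsum X y J \<in> carrier X" by (intro X.M.finsum_closed) auto
    with insert show ?case
      using assms(3) pure_closed[OF X] by (simp add: Pi_def pure_add_left[OF X])
  qed (simp_all add: pure_zero_left[OF X] assms(3))
qed

text \<open>Tensoring the dual basis expansion writes \<open>z\<close> as a sum of terms
  \<open>p \<otimes> n\<close>, with \<open>n\<close> the value at \<open>z\<close> of the
  coordinate belonging to \<open>p\<close>. Which \<open>p\<close> occur depends on
  \<open>z\<close>; asserting the formula for all finite \<open>J\<close> above some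
  \<open>J0\<close> lets the induction merge the sets of two summands.\<close>

lemma tensor_projective_expand:
  assumes X: "projective S X"
  shows "\<exists>q. (\<forall>p. functional X (\<lambda>x. q x p)) \<and> (\<forall>z\<in>carrier (tens X). \<exists>J0. finite J0 \<and> J0 \<subseteq> carrier X \<and>
    (\<forall>J. finite J \<and> J0 \<subseteq> J \<and> J \<subseteq> carrier X \<longrightarrow> z = finsum (tens X) (\<lambda>p. pure X p (ev X (\<lambda>x. q x p) z)) J))"
proof -
  have lX: "lmodule S X" by (rule projective_lmodule[OF X])
  interpret X: lmodule S X by (rule lX)
  interpret T: lmodule K "tens X" by (rule lmodule_tensor[OF lX])
  obtain q where q: "linear_map S X (free_module S (carrier X)) q"
    "\<And>x. x \<in> carrier X \<Longrightarrow> lin_comb S X (\<lambda>p. p) (q x) = x"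
    using dual_basis[OF X] by blast
  note qc = linear_map_closed[OF q(1)]
  have qm: "q x p \<in> carrier R" if "x \<in> carrier X" for x p
    using free_mem[OF ring_S qc[OF that]] by simp
  have qf: "functional X (\<lambda>x. q x p)" for p
    by (intro linear_mapI) (simp_all add: qm linear_map_add[OF q(1)] linear_map_smult[OF q(1)], simp_all
      add: free_module_def)
  let ?P = "\<lambda>z. \<exists>J0. finite J0 \<and> J0 \<subseteq> carrier X \<and> (\<forall>J. finite J \<and> J0 \<subseteq> J \<and> J \<subseteq> carrier X \<longrightarrow>
      z = finsum (tens X) (\<lambda>p. pure X p (ev X (\<lambda>x. q x p) z)) J)"
  have P: "?P z" if z: "z \<in> carrier (tens X)" for z
    using z
  proof (induction rule: tensor_induct[OF lX, consumes 1, case_names pure add])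
    case (pure x n)
    show ?case
    proof (intro exI conjI allI impI)
      show "finite {p. q x p \<noteq> \<zero>\<^bsub>S\<^esub>}" "{p. q x p \<noteq> \<zero>\<^bsub>S\<^esub>} \<subseteq> carrier X"
        using qc[OF pure(1)] by (auto simp: free_module_def)
      fix J assume J: "finite J \<and> {p. q x p \<noteq> \<zero>\<^bsub>S\<^esub>} \<subseteq> J \<and> J \<subseteq> carrier X"
      have sm: "q x p \<odot>\<^bsub>X\<^esub> p \<in> carrier X" if "p \<in> J" for p
        using X.smult_closed[of "q x p" p] qm[OF pure(1)] J that by auto
      have "x = finsum X (\<lambda>p. q x p \<odot>\<^bsub>X\<^esub> p) J"
        using q(2)[OF pure(1)] lin_comb_superset[OF lX, of J "q x" "\<lambda>p. p"] J qm[OF pure(1)] by auto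
      then have "pure X x n = pure X (finsum X (\<lambda>p. q x p \<odot>\<^bsub>X\<^esub> p) J) n" by simp
      also have "\<dots> = finsum (tens X) (\<lambda>p. pure X (q x p \<odot>\<^bsub>X\<^esub> p) n) J"
        by (rule pure_finsum_left[OF lX sm pure(2)])
      also have "\<dots> = finsum (tens X) (\<lambda>p. pure X p (ev X (\<lambda>x. q x p) (pure X x n))) J"
        using J pure qm[OF pure(1)] pure_closed[OF lX]
        by (intro T.M.finsum_cong') (auto simp: ev_pure[OF lX qf] pure_balanced[OF lX])
      finally show "pure X x n = finsum (tens X) (\<lambda>p. pure X p (ev X (\<lambda>x. q x p) (pure X x n))) J" .
    qed
  next
    case (add y z)
    from add.IH(1) obtain J1 where J1: "finite J1" "J1 \<subseteq> carrier X"
      "\<forall>J. finite J \<and> J1 \<subseteq> J \<and> J \<subseteq> carrier X \<longrightarrow> y = finsum (tens X) (\<lambda>p. pure X p (ev X (\<lambda>x. q x p) y)) J"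
      by (elim exE conjE)
    from add.IH(2) obtain J2 where J2: "finite J2" "J2 \<subseteq> carrier X"
      "\<forall>J. finite J \<and> J2 \<subseteq> J \<and> J \<subseteq> carrier X \<longrightarrow> z = finsum (tens X) (\<lambda>p. pure X p (ev X (\<lambda>x. q x p) z)) J"
      by (elim exE conjE)
    show ?case
    proof (intro exI[of _ "J1 \<union> J2"] conjI allI impI)
      show "finite (J1 \<union> J2)" "J1 \<union> J2 \<subseteq> carrier X" using J1 J2 by auto
      fix J assume "finite J \<and> J1 \<union> J2 \<subseteq> J \<and> J \<subseteq> carrier X"
      then have J': "finite J" "J1 \<subseteq> J" "J2 \<subseteq> J" "J \<subseteq> carrier X" by auto
      have evc: "ev X (\<lambda>x. q x p) w \<in> carrier N" if "w \<in> carrier (tens X)" for p w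
        using linear_map_closed[OF ev_linear[OF lX qf] that] by simp
      have ye: "y = finsum (tens X) (\<lambda>p. pure X p (ev X (\<lambda>x. q x p) y)) J"
        by (rule J1(3)[rule_format]) (use J' in blast)
      have ze: "z = finsum (tens X) (\<lambda>p. pure X p (ev X (\<lambda>x. q x p) z)) J"
        by (rule J2(3)[rule_format]) (use J' in blast)
      have "y \<oplus>\<^bsub>tens X\<^esub> z = finsum (tens X) (\<lambda>p. pure X p (ev X (\<lambda>x. q x p) y)) J \<oplus>\<^bsub>tens X\<^esub>
          finsum (tens X) (\<lambda>p. pure X p (ev X (\<lambda>x. q x p) z)) J"
        by (rule arg_cong2[OF ye ze])
      also have "\<dots> = finsum (tens X) (\<lambda>p. pure X p (ev X (\<lambda>x. q x p) y) \<oplus>\<^bsub>tens X\<^esub> pure X p (ev X (\<lambda>x. q x p) z)) J"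
        using J' pure_closed[OF lX] evc[OF add(1)] evc[OF add(2)] by (intro T.M.finsum_addf[symmetric]) auto
      also have "\<dots> = finsum (tens X) (\<lambda>p. pure X p (ev X (\<lambda>x. q x p) (y \<oplus>\<^bsub>tens X\<^esub> z))) J"
        using J' pure_closed[OF lX] evc[OF add(1)] evc[OF add(2)] add(1,2)
        by (intro T.M.finsum_cong') (auto simp: linear_map_add[OF ev_linear[OF lX qf]] pure_add_right[OF lX])
      finally show "y \<oplus>\<^bsub>tens X\<^esub> z = finsum (tens X) (\<lambda>p. pure X p (ev X (\<lambda>x. q x p) (y \<oplus>\<^bsub>tens X\<^esub> z))) J" .
    qed
  qed
  show ?thesis by (intro exI[of _ q] conjI allI ballI qf P)
qed

text \<open>Every coefficient in the expansion of \<open>z\<close> is the value at \<open>z\<close>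
  of some \<open>ev X \<psi>\<close>. This is how identities are checked in the tensor products with
  \<open>obj T (- 1)\<close>, \<open>obj T (- 2)\<close> and \<open>Q\<close>.\<close>

lemma tensor_projective_vanish:
  assumes X: "projective S X" and z: "z \<in> carrier (tens X)"
    and v: "\<And>\<psi>. functional X \<psi> \<Longrightarrow> ev X \<psi> z = \<zero>\<^bsub>N\<^esub>"
  shows "z = \<zero>\<^bsub>tens X\<^esub>"
proof -
  have lX: "lmodule S X" by (rule projective_lmodule[OF X])
  interpret T: lmodule K "tens X" by (rule lmodule_tensor[OF lX])
  from tensor_projective_expand[OF X] obtain q where q: "\<forall>p. functional X (\<lambda>x. q x p)" and
    e: "\<forall>z\<in>carrier (tens X). \<exists>J0. finite J0 \<and> J0 \<subseteq> carrier X \<and> (\<forall>J. finite J \<and> J0 \<subseteq> J \<and> J \<subseteq> carrier X \<longrightarrow>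
      z = finsum (tens X) (\<lambda>p. pure X p (ev X (\<lambda>x. q x p) z)) J)"
    by (elim exE conjE)
  from e[rule_format, OF z] obtain J where J': "finite J" "J \<subseteq> carrier X"
    "\<forall>I. finite I \<and> J \<subseteq> I \<and> I \<subseteq> carrier X \<longrightarrow> z = finsum (tens X) (\<lambda>p. pure X p (ev X (\<lambda>x. q x p) z)) I"
    by (elim exE conjE)
  have J: "J \<subseteq> carrier X" "z = finsum (tens X) (\<lambda>p. pure X p (ev X (\<lambda>x. q x p) z)) J"
    by (rule J'(2)) (rule J'(3)[rule_format], use J' in blast)
  have "finsum (tens X) (\<lambda>p. pure X p (ev X (\<lambda>x. q x p) z)) J = finsum (tens X) (\<lambda>p. \<zero>\<^bsub>tens X\<^esub>) J"
    using J(1) by (intro T.M.finsum_cong') (auto simp: v[OF q[rule_format]] pure_zero_right[OF lX])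
  with J(2) have "z = finsum (tens X) (\<lambda>p. \<zero>\<^bsub>tens X\<^esub>) J" by (rule trans)
  then show ?thesis by simp
qed

end

lemma finsum_opp: "finsum (opp_ring R) = finsum R"
  by (simp add: finsum_def finprod_def fun_eq_iff)

text \<open>The elements of \<open>M\<close> whose images have coordinates supported in
  \<open>J\<close> form a submodule. If \<open>J\<close> collects the supports belonging to a finite
  set of generators, this submodule is all of \<open>M\<close>.\<close>

lemma finitely_generated_coordinates:
  assumes M: "lmodule S M" and fg: "finitely_generated S M" and X: "projective S X" and f: "linear_map S M X f"
  obtains J \<phi> where "finite J" "J \<subseteq> carrier X" "\<And>p. linear_map S M (regular_module S) (\<phi> p)"
    "\<And>m. m \<in> carrier M \<Longrightarrow> f m = finsum X (\<lambda>p. \<phi> p m \<odot>\<^bsub>X\<^esub> p) J"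
proof -
  have lX: "lmodule S X" by (rule projective_lmodule[OF X])
  interpret M: lmodule S M by fact
  interpret X: lmodule S X by fact
  obtain q where q: "linear_map S X (free_module S (carrier X)) q"
    "\<And>x. x \<in> carrier X \<Longrightarrow> lin_comb S X (\<lambda>p. p) (q x) = x"
    using dual_basis[OF X] by blast
  obtain A where A: "finite A" "A \<subseteq> carrier M" "module_span S M A = carrier M"
    using fg by (auto simp: finitely_generated_def)
  note qf = linear_map_comp[OF f q(1)]
  note qfc = linear_map_closed[OF qf]
  have fin: "finite {p. q (f m) p \<noteq> \<zero>\<^bsub>S\<^esub>}" "{p. q (f m) p \<noteq> \<zero>\<^bsub>S\<^esub>} \<subseteq> carrier X" if "m \<in> carrier M" for m
    using qfc[OF that] by (auto simp: free_module_def)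
  have qm: "q (f m) p \<in> carrier S" if "m \<in> carrier M" for m p
    using free_mem[OF M.R.ring_axioms qfc[OF that]] .
  have lin: "linear_map S M (regular_module S) (\<lambda>m. q (f m) p)" for p
    by (intro linear_mapI) (simp_all add: qm linear_map_add[OF qf] linear_map_smult[OF qf], simp_all add:
      free_module_def)
  define J where "J = (\<Union>a\<in>A. {p. q (f a) p \<noteq> \<zero>\<^bsub>S\<^esub>})"
  define H where "H = {m \<in> carrier M. \<forall>p. p \<notin> J \<longrightarrow> q (f m) p = \<zero>\<^bsub>S\<^esub>}"
  have "submodule H S M"
    unfolding M.submodule_iff
  proof (intro conjI ballI)
    show "\<zero>\<^bsub>M\<^esub> \<in> H"
      using linear_map_zero[OF M lmodule_regular[OF M.R.ring_axioms] lin] by (simp add: H_def)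
    show "x \<oplus>\<^bsub>M\<^esub> y \<in> H" if "x \<in> H" "y \<in> H" for x y
      using that linear_map_add[OF lin] by (simp add: H_def)
    show "r \<odot>\<^bsub>M\<^esub> x \<in> H" if "r \<in> carrier S" "x \<in> H" for r x
      using that linear_map_smult[OF lin] by (simp add: H_def)
  qed (auto simp: H_def)
  moreover have "A \<subseteq> H" using A(2) by (auto simp: H_def J_def)
  ultimately have H: "carrier M \<subseteq> H" using module_span_least[of H S M A] A(3) by simp
  have J: "finite J" using A(1,2) fin(1) unfolding J_def by blast
  have JX: "J \<subseteq> carrier X" using A(2) fin(2) unfolding J_def by blast
  show thesis
  proof (rule that[OF J JX lin])
    fix m assume m: "m \<in> carrier M"
    have "{p. q (f m) p \<noteq> \<zero>\<^bsub>S\<^esub>} \<subseteq> J" using H m by (auto simp: H_def)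
    then show "f m = finsum X (\<lambda>p. q (f m) p \<odot>\<^bsub>X\<^esub> p) J"
      using q(2)[OF linear_map_closed[OF f m]] lin_comb_superset[OF lX J, of "q (f m)" "\<lambda>p. p"] qm[OF m] JX by auto
  qed
qed

context tensor_right
begin

lemma tensor_map_comp:
  assumes X: "lmodule S X" and Y: "lmodule S Y" and Z: "lmodule S Z"
    and f: "linear_map S X Y f" and g: "linear_map S Y Z g" and z: "z \<in> carrier (tens X)"
  shows "tensor_map K R Z N g (tensor_map K R Y N f z) = tensor_map K R Z N (\<lambda>x. g (f x)) z"
  by (rule tensor_eqI[OF X linear_map_comp[OF tensor_map_linear[OF X Y f] tensor_map_linear[OF Y Z g]]
        tensor_map_linear[OF X Z linear_map_comp[OF f g]] _ z])
    (simp add: tensor_map_pure[OF X Y f] tensor_map_pure[OF Y Z g]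
      tensor_map_pure[OF X Z linear_map_comp[OF f g]] linear_map_closed[OF f])

lemma tensor_map_zero:
  assumes X: "lmodule S X" and Y: "lmodule S Y" and f: "linear_map S X Y f"
    and f0: "\<And>x. x \<in> carrier X \<Longrightarrow> f x = \<zero>\<^bsub>Y\<^esub>" and z: "z \<in> carrier (tens X)"
  shows "tensor_map K R Y N f z = \<zero>\<^bsub>tens Y\<^esub>"
  by (rule tensor_eqI[OF X tensor_map_linear[OF X Y f] linear_map_const_zero[OF lmodule_tensor[OF Y]] _ z])
    (simp add: tensor_map_pure[OF X Y f] f0 pure_zero_left[OF Y])

lemma chain_complex_tensor:
  assumes C: "chain_complex S C" shows "chain_complex K (tensor_complex K R C N)"
proof -
  note C' = chain_complexD[OF C]
  have l: "linear_map K (tens (obj C i)) (tens (obj C (i - 1))) (tensor_map K R (obj C (i - 1)) N (bd C i))" for i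
    by (rule tensor_map_linear[OF C'(1) C'(1) C'(2)])
  have "tensor_map K R (obj C (i - 2)) N (bd C (i - 1)) (tensor_map K R (obj C (i - 1)) N (bd C i) z)
    = \<zero>\<^bsub>tens (obj C (i - 2))\<^esub>"
    if z: "z \<in> carrier (tens (obj C i))" for i z
  proof -
    have d: "linear_map S (obj C (i - 1)) (obj C (i - 2)) (bd C (i - 1))" using C'(2)[of "i - 1"] by simp
    have dd: "bd C (i - 1) (bd C i x) = \<zero>\<^bsub>obj C (i - 2)\<^esub>" if "x \<in> carrier (obj C i)" for x
      using C that by (simp add: chain_complex_def)
    show ?thesis
      unfolding tensor_map_comp[OF C'(1) C'(1) C'(1) C'(2) d z]
      by (rule tensor_map_zero[OF C'(1) C'(1) linear_map_comp[OF C'(2) d] dd z])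
  qed
  then show ?thesis
    unfolding chain_complex_def using l lmodule_tensor[OF C'(1)] by (simp add: tensor_complex_def)
qed

lemma lmodule_regS: "lmodule S (regular_module S)"
  by (rule lmodule_regular[OF ring_S])

lemma ev_closed: "\<lbrakk>lmodule S X; functional X \<psi>; z \<in> carrier (tens X)\<rbrakk> \<Longrightarrow> ev X \<psi> z \<in> carrier N"
  using linear_map_closed[OF ev_linear] by fastforce

lemma ev_zero: "\<lbrakk>lmodule S X; functional X \<psi>\<rbrakk> \<Longrightarrow> ev X \<psi> \<zero>\<^bsub>tens X\<^esub> = \<zero>\<^bsub>N\<^esub>"
  using linear_map_zero[OF lmodule_tensor NK ev_linear] by simp

lemma functional_plus: "\<lbrakk>functional X \<psi>; functional X \<phi>\<rbrakk> \<Longrightarrow> functional X (\<lambda>x. \<psi> x \<oplus>\<^bsub>R\<^esub> \<phi> x)"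
  using linear_map_plus[OF lmodule_regS] by simp

text \<open>Left and right multiplication on \<open>R\<close> commute; this is what makes the dual
  of a right module a left module.\<close>

lemma functional_smult:
  assumes "functional X \<psi>" "r \<in> carrier R"
  shows "functional X (\<lambda>x. r \<otimes>\<^bsub>R\<^esub> \<psi> x)"
proof -
  have "\<psi> x \<in> carrier R" if "x \<in> carrier X" for x using linear_map_closed[OF assms(1) that] by simp
  then show ?thesis
    by (intro linear_mapI) (simp_all add: assms(2) linear_map_add[OF assms(1)] linear_map_smult[OF assms(1)]
        R.r_distr R.m_assoc)
qed

text \<open>With \<open>ev_smult\<close>: for a fixed tensor, evaluation is linear over
  \<open>R\<close> in the functional and so gives a homomorphism from the dual to
  \<open>N\<close>.\<close>

lemma ev_plus:
  assumes X: "lmodule S X" and p: "functional X \<psi>" "functional X \<phi>" and z: "z \<in> carrier (tens X)"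
  shows "ev X (\<lambda>x. \<psi> x \<oplus>\<^bsub>R\<^esub> \<phi> x) z = ev X \<psi> z \<oplus>\<^bsub>N\<^esub> ev X \<phi> z"
proof -
  have c: "\<psi> x \<in> carrier R" "\<phi> x \<in> carrier R" if "x \<in> carrier X" for x
    using p[THEN linear_map_closed] that by simp_all
  have l: "linear_map K (tens X) NK (\<lambda>z. ev X \<psi> z \<oplus>\<^bsub>N\<^esub> ev X \<phi> z)"
    using linear_map_plus[OF NK p[THEN ev_linear[OF X]]] by simp
  show ?thesis
    by (rule tensor_eqI[OF X ev_linear[OF X functional_plus[OF p]] l _ z])
      (simp add: ev_pure[OF X functional_plus[OF p]] p[THEN ev_pure[OF X]] c N.smult_l_distr)
qed

lemma ev_smult:
  assumes X: "lmodule S X" and p: "functional X \<psi>" and r: "r \<in> carrier R" and z: "z \<in> carrier (tens X)"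
  shows "ev X (\<lambda>x. r \<otimes>\<^bsub>R\<^esub> \<psi> x) z = r \<odot>\<^bsub>N\<^esub> ev X \<psi> z"
proof -
  have c: "\<psi> x \<in> carrier R" if "x \<in> carrier X" for x
    using linear_map_closed[OF p that] by simp
  have "linear_map K NK NK (\<lambda>n. r \<odot>\<^bsub>N\<^esub> n)"
    by (rule linear_mapI) (simp_all add: r N.smult_r_distr N.smult_assoc1[symmetric] kappa_closed kappa_central)
  from linear_map_comp[OF ev_linear[OF X p] this]
  have l: "linear_map K (tens X) NK (\<lambda>z. r \<odot>\<^bsub>N\<^esub> ev X \<psi> z)" .
  show ?thesis
    by (rule tensor_eqI[OF X ev_linear[OF X functional_smult[OF p r]] l _ z])
      (simp add: ev_pure[OF X functional_smult[OF p r]] ev_pure[OF X p] c r N.smult_assoc1)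
qed

section \<open>The dual module and the evaluation map\<close>

lemma carrier_dual: "carrier (dual_module R A) = {f \<in> extensional (carrier A). functional A f}"
  by (simp add: dual_module_def hom_module_def)

lemma dual_apply [simp]:
  "m \<in> carrier A \<Longrightarrow> (\<mu> \<oplus>\<^bsub>dual_module R A\<^esub> \<nu>) m = \<mu> m \<oplus>\<^bsub>R\<^esub> \<nu> m"
  "m \<in> carrier A \<Longrightarrow> (r \<odot>\<^bsub>dual_module R A\<^esub> \<mu>) m = r \<otimes>\<^bsub>R\<^esub> \<mu> m"
  "m \<in> carrier A \<Longrightarrow> \<zero>\<^bsub>dual_module R A\<^esub> m = \<zero>\<^bsub>R\<^esub>"
  by (simp_all add: dual_module_def)

context
  fixes M :: "('r, 'm) module"
  assumes M: "lmodule S M"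
begin

interpretation M: lmodule S M by (rule M)

abbreviation D where "D \<equiv> dual_module R M"

lemma dual_restrict: "functional M \<psi> \<Longrightarrow> restrict \<psi> (carrier M) \<in> carrier D"
  using linear_map_cong[OF M, where f = "restrict \<psi> (carrier M)" and g = \<psi>] by (simp add: carrier_dual)

lemma dual_functional: "\<mu> \<in> carrier D \<Longrightarrow> functional M \<mu>"
  by (simp add: carrier_dual)

lemma dual_closed: "\<lbrakk>\<mu> \<in> carrier D; m \<in> carrier M\<rbrakk> \<Longrightarrow> \<mu> m \<in> carrier R"
  using linear_map_closed[OF dual_functional] by fastforce

lemma dual_eqI: "\<lbrakk>\<mu> \<in> carrier D; \<nu> \<in> carrier D; \<And>m. m \<in> carrier M \<Longrightarrow> \<mu> m = \<nu> m\<rbrakk> \<Longrightarrow> \<mu> = \<nu>"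
  by (rule extensionalityI[of _ "carrier M"]) (auto simp: carrier_dual)

lemma lmodule_dual: "lmodule R D"
proof -
  have add: "\<mu> \<oplus>\<^bsub>D\<^esub> \<nu> \<in> carrier D" if "\<mu> \<in> carrier D" "\<nu> \<in> carrier D" for \<mu> \<nu>
    using dual_restrict[OF functional_plus[OF that[THEN dual_functional]]] by (simp add: dual_module_def)
  have sm: "r \<odot>\<^bsub>D\<^esub> \<mu> \<in> carrier D" if "r \<in> carrier R" "\<mu> \<in> carrier D" for r \<mu>
    using dual_restrict[OF functional_smult[OF dual_functional[OF that(2)] that(1)]] by (simp add: dual_module_def)
  have zero: "\<zero>\<^bsub>D\<^esub> \<in> carrier D"
    using dual_restrict[OF linear_map_const_zero[OF lmodule_regS]] by (simp add: dual_module_def)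
  have neg: "\<exists>\<nu>\<in>carrier D. \<nu> \<oplus>\<^bsub>D\<^esub> \<mu> = \<zero>\<^bsub>D\<^esub>" if m: "\<mu> \<in> carrier D" for \<mu>
  proof -
    have nu: "(\<ominus>\<^bsub>R\<^esub> \<one>\<^bsub>R\<^esub>) \<odot>\<^bsub>D\<^esub> \<mu> \<in> carrier D" using sm m by simp
    have "(\<ominus>\<^bsub>R\<^esub> \<one>\<^bsub>R\<^esub>) \<odot>\<^bsub>D\<^esub> \<mu> \<oplus>\<^bsub>D\<^esub> \<mu> = \<zero>\<^bsub>D\<^esub>"
      by (rule dual_eqI[OF add[OF nu m] zero]) (simp add: dual_closed[OF m] R.l_minus R.l_neg)
    then show ?thesis using nu by blast
  qed
  show ?thesis
  proof (intro lmodule.intro lmodule_axioms.intro abelian_groupI R.ring_axioms)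
    fix \<mu> \<nu> \<rho> assume "\<mu> \<in> carrier D" "\<nu> \<in> carrier D" "\<rho> \<in> carrier D"
    then show "\<mu> \<oplus>\<^bsub>D\<^esub> \<nu> \<oplus>\<^bsub>D\<^esub> \<rho> = \<mu> \<oplus>\<^bsub>D\<^esub> (\<nu> \<oplus>\<^bsub>D\<^esub> \<rho>)"
      by (intro dual_eqI add) (simp_all add: dual_closed R.a_assoc)
  next
    fix \<mu> \<nu> assume m: "\<mu> \<in> carrier D" "\<nu> \<in> carrier D"
    then show "\<mu> \<oplus>\<^bsub>D\<^esub> \<nu> = \<nu> \<oplus>\<^bsub>D\<^esub> \<mu>"
      by (intro dual_eqI add) (simp_all add: dual_closed R.a_comm)
    fix r assume r: "r \<in> carrier R"
    with m show "r \<odot>\<^bsub>D\<^esub> (\<mu> \<oplus>\<^bsub>D\<^esub> \<nu>) = r \<odot>\<^bsub>D\<^esub> \<mu> \<oplus>\<^bsub>D\<^esub> r \<odot>\<^bsub>D\<^esub> \<nu>"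
      by (intro dual_eqI add sm) (simp_all add: dual_closed R.r_distr)
  next
    fix \<mu> assume m: "\<mu> \<in> carrier D"
    then show "\<zero>\<^bsub>D\<^esub> \<oplus>\<^bsub>D\<^esub> \<mu> = \<mu>"
      by (intro dual_eqI add zero) (simp_all add: dual_closed)
    from m show "\<one>\<^bsub>R\<^esub> \<odot>\<^bsub>D\<^esub> \<mu> = \<mu>"
      by (intro dual_eqI sm) (simp_all add: dual_closed)
    fix r s assume r: "r \<in> carrier R" "s \<in> carrier R"
    from m r show "(r \<oplus>\<^bsub>R\<^esub> s) \<odot>\<^bsub>D\<^esub> \<mu> = r \<odot>\<^bsub>D\<^esub> \<mu> \<oplus>\<^bsub>D\<^esub> s \<odot>\<^bsub>D\<^esub> \<mu>"
      by (intro dual_eqI add sm R.a_closed) (simp_all add: dual_closed R.l_distr)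
    from m r show "(r \<otimes>\<^bsub>R\<^esub> s) \<odot>\<^bsub>D\<^esub> \<mu> = r \<odot>\<^bsub>D\<^esub> (s \<odot>\<^bsub>D\<^esub> \<mu>)"
      by (intro dual_eqI sm R.m_closed) (simp_all add: dual_closed R.m_assoc)
  qed (use add sm zero neg in simp_all)
qed

text \<open>The second map of the sequence: \<open>m \<otimes> n\<close> goes to
  \<open>\<mu> \<mapsto> \<mu>(m) n\<close>.\<close>

definition \<theta> where "\<theta> z = (\<lambda>\<mu>\<in>carrier D. ev M \<mu> z)"

lemma theta_closed:
  assumes z: "z \<in> carrier (tens M)" shows "\<theta> z \<in> carrier (hom_module R D N)"
proof -
  have e: "ev M (\<mu> \<oplus>\<^bsub>D\<^esub> \<nu>) z = ev M \<mu> z \<oplus>\<^bsub>N\<^esub> ev M \<nu> z" if m: "\<mu> \<in> carrier D" "\<nu> \<in> carrier D" for \<mu> \<nu>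
    using ev_cong[OF M functional_plus[OF m[THEN dual_functional]], of "\<mu> \<oplus>\<^bsub>D\<^esub> \<nu>", OF _ z]
      ev_plus[OF M m[THEN dual_functional] z] by simp
  have s: "ev M (r \<odot>\<^bsub>D\<^esub> \<mu>) z = r \<odot>\<^bsub>N\<^esub> ev M \<mu> z" if m: "r \<in> carrier R" "\<mu> \<in> carrier D" for r \<mu>
    using ev_cong[OF M functional_smult[OF dual_functional[OF m(2)] m(1)], of "r \<odot>\<^bsub>D\<^esub> \<mu>", OF _ z]
      ev_smult[OF M dual_functional[OF m(2)] m(1) z] by simp
  interpret D: lmodule R D by (rule lmodule_dual)
  have "linear_map R D N (\<theta> z)"
    by (rule linear_mapI) (simp_all add: \<theta>_def e s ev_closed[OF M dual_functional z])
  then show ?thesis by (simp add: hom_module_def \<theta>_def)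
qed

lemma theta_linear: "linear_map K (tens M) (hom_module R D N) \<theta>"
proof (rule linear_mapI)
  interpret T: lmodule K "tens M" by (rule lmodule_tensor[OF M])
  fix x y assume "x \<in> carrier (tens M)" "y \<in> carrier (tens M)"
  then show "\<theta> (x \<oplus>\<^bsub>tens M\<^esub> y) = \<theta> x \<oplus>\<^bsub>hom_module R D N\<^esub> \<theta> y"
    by (auto simp: hom_module_def \<theta>_def fun_eq_iff linear_map_add[OF ev_linear[OF M dual_functional]])
next
  fix c x assume "c \<in> carrier K" "x \<in> carrier (tens M)"
  then show "\<theta> (c \<odot>\<^bsub>tens M\<^esub> x) = c \<odot>\<^bsub>hom_module R D N\<^esub> \<theta> x"
    by (auto simp: hom_module_def \<theta>_def fun_eq_iff linear_map_smult[OF ev_linear[OF M dual_functional]])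
qed (rule theta_closed)

text \<open>In the dual, \<open>e\<close> after \<open>f\<close> is the combination of the
  coordinates \<open>\<phi> p\<close> with coefficients \<open>e p\<close>, and \<open>\<xi>\<close>
  is linear. Hence values of \<open>\<xi>\<close> on such functionals become evaluations of tensors
  built from the \<open>p\<close> and \<open>\<xi> (\<phi> p)\<close>.\<close>

lemma hom_dual_sum:
  assumes xi: "linear_map R D N \<xi>" and X: "lmodule S X" and J: "J \<subseteq> carrier X"
    and \<phi>: "\<And>p. functional M (\<phi> p)"
    and f: "\<And>m. m \<in> carrier M \<Longrightarrow> f m = finsum X (\<lambda>p. \<phi> p m \<odot>\<^bsub>X\<^esub> p) J" and e: "functional X e"
  shows "\<xi> (\<lambda>m\<in>carrier M. e (f m)) = finsum N (\<lambda>p. e p \<odot>\<^bsub>N\<^esub> \<xi> (restrict (\<phi> p) (carrier M))) J"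
proof -
  interpret D: lmodule R D by (rule lmodule_dual)
  interpret X: lmodule S X by fact
  let ?\<phi> = "\<lambda>p. restrict (\<phi> p) (carrier M)"
  have ec: "e p \<in> carrier R" if "p \<in> J" for p using linear_map_closed[OF e] that J by auto
  have pc: "\<phi> p m \<in> carrier R" if "m \<in> carrier M" for p m using linear_map_closed[OF \<phi> that] by simp
  have t: "(\<lambda>p. e p \<odot>\<^bsub>D\<^esub> ?\<phi> p) \<in> J \<rightarrow> carrier D" using ec dual_restrict[OF \<phi>] by auto
  have sum: "finsum D (\<lambda>p. e p \<odot>\<^bsub>D\<^esub> ?\<phi> p) J \<in> carrier D" by (rule D.M.finsum_closed[OF t])
  \<comment> \<open>Evaluation at \<open>m\<close> is linear on the dual, so the sum taken there can
    be compared pointwise.\<close>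
  have ef: "e (f m) = finsum D (\<lambda>p. e p \<odot>\<^bsub>D\<^esub> ?\<phi> p) J m" if m: "m \<in> carrier M" for m
  proof -
    have sm: "\<phi> p m \<odot>\<^bsub>X\<^esub> p \<in> carrier X" if "p \<in> J" for p using X.smult_closed[of "\<phi> p m" p] pc[OF m] J that by auto
    have "e (f m) = finsum (regular_module S) (\<lambda>p. e (\<phi> p m \<odot>\<^bsub>X\<^esub> p)) J"
      unfolding f[OF m] by (rule linear_map_finsum[OF X lmodule_regS e]) (use sm in auto)
    also have "\<dots> = finsum R (\<lambda>p. e p \<otimes>\<^bsub>R\<^esub> \<phi> p m) J"
      unfolding finsum_regular finsum_opp using pc[OF m] ec J linear_map_smult[OF e]
      by (intro R.finsum_cong') (auto simp: subset_iff)
    also have "\<dots> = finsum (regular_module R) (\<lambda>p. (e p \<odot>\<^bsub>D\<^esub> ?\<phi> p) m) J"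
      unfolding finsum_regular using m by simp
    also have "\<dots> = finsum D (\<lambda>p. e p \<odot>\<^bsub>D\<^esub> ?\<phi> p) J m"
    proof (rule linear_map_finsum[OF lmodule_dual lmodule_regular[OF R.ring_axioms] _ t, symmetric])
      show "linear_map R D (regular_module R) (\<lambda>\<mu>. \<mu> m)"
        by (rule linear_mapI) (simp_all add: m dual_closed)
    qed
    finally show ?thesis .
  qed
  have "(\<lambda>m\<in>carrier M. e (f m)) = finsum D (\<lambda>p. e p \<odot>\<^bsub>D\<^esub> ?\<phi> p) J"
    by (rule extensionalityI[of _ "carrier M"]) (use sum ef in \<open>auto simp: carrier_dual\<close>)
  then have "\<xi> (\<lambda>m\<in>carrier M. e (f m)) = finsum N (\<lambda>p. \<xi> (e p \<odot>\<^bsub>D\<^esub> ?\<phi> p)) J"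
    using linear_map_finsum[OF lmodule_dual N xi t] by simp
  also have "\<dots> = finsum N (\<lambda>p. e p \<odot>\<^bsub>N\<^esub> \<xi> (?\<phi> p)) J"
    using linear_map_smult[OF xi ec dual_restrict[OF \<phi>]] linear_map_closed[OF xi dual_restrict[OF \<phi>]] ec
    by (intro N.M.finsum_cong') auto
  finally show ?thesis .
qed

end

end

context tensor_right
begin

abbreviation tm where "tm Y f \<equiv> tensor_map K R Y N f"

text \<open>A functional that kills boundaries lives on the image of \<open>bd T (i + 1)\<close>;
  total acyclicity with coefficients in the regular module, which is projective, extends it to
  \<open>obj T i\<close>.\<close>

lemma functional_extend:
  assumes T: "totally_acyclic S T" and p: "functional (obj T (i + 1)) \<psi>"
    and z: "\<And>x. x \<in> carrier (obj T (i + 2)) \<Longrightarrow> \<psi> (bd T (i + 2) x) = \<zero>\<^bsub>R\<^esub>"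
  obtains e where "functional (obj T i) e" "\<And>x. x \<in> carrier (obj T (i + 1)) \<Longrightarrow> \<psi> x = e (bd T (i + 1) x)"
  using totally_acyclic_factor[OF T projective_regular[OF ring_S] p] z
  by (metis regular_module_simps(3) opp_ring_simps(3))

text \<open>The hypotheses record what \<open>stable_comparison\<close> extracts from the complete
  resolution and from Gorenstein projectivity. After tensoring, the error \<open>h\<close>
  disappears on cycles up to boundaries, and the error \<open>p u\<close> is controlled by
  functionals since it passes through \<open>Q\<close>. In the proof \<open>h0\<close> is a lift of
  the third map to cycles; it is a different map from \<open>h\<close>.\<close>

lemma tate_exact_sequence:
  fixes M :: "('r, 'm) module" and T :: "('r, 't) mcomplex" and Q :: "('r, 'q) module"
  assumes M: "lmodule S M" and fg: "finitely_generated S M" and tT: "totally_acyclic S T"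
    and Q: "projective S Q" and \<alpha>: "linear_map S (obj T 0) M \<alpha>"
    and \<alpha>d: "\<And>x. x \<in> carrier (obj T 1) \<Longrightarrow> \<alpha> (bd T 1 x) = \<zero>\<^bsub>M\<^esub>"
    and \<beta>: "linear_map S M (obj T (- 1)) \<beta>" and \<beta>im: "\<And>m. m \<in> carrier M \<Longrightarrow> \<beta> m \<in> bd T 0 ` carrier (obj T 0)"
    and h: "linear_map S (obj T (- 1)) (obj T 0) h" and u: "linear_map S M Q u" and p: "linear_map S Q M p"
    and \<beta>\<alpha>: "\<And>t. t \<in> carrier (obj T 0) \<Longrightarrow> \<beta> (\<alpha> t) = bd T 0 (t \<oplus>\<^bsub>obj T 0\<^esub> h (bd T 0 t))"
    and \<alpha>\<beta>: "\<And>m t. \<lbrakk>m \<in> carrier M; t \<in> carrier (obj T 0); bd T 0 t = \<beta> m\<rbrakk> \<Longrightarrow> \<alpha> t = m \<oplus>\<^bsub>M\<^esub> p (u m)"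
  shows "\<exists>f g h.
      linear_map K (tate_tor K R T N 0) (tensor K R M N) f \<and>
      linear_map K (tensor K R M N) (hom_module R (dual_module R M) N) g \<and>
      linear_map K (hom_module R (dual_module R M) N) (tate_tor K R T N (-1)) h \<and>
      inj_on f (carrier (tate_tor K R T N 0)) \<and>
      f ` carrier (tate_tor K R T N 0) =
        a_kernel (tensor K R M N) (hom_module R (dual_module R M) N) g \<and>
      g ` carrier (tensor K R M N) =
        a_kernel (hom_module R (dual_module R M) N) (tate_tor K R T N (-1)) h \<and>
      h ` carrier (hom_module R (dual_module R M) N) = carrier (tate_tor K R T N (-1))"
proof -
  define V X Y Z where "V = obj T 1" and "X = obj T 0" and "Y = obj T (- 1)" and "Z = obj T (- 2)"
  define d1 d0 d' where "d1 = bd T 1" and "d0 = bd T 0" and "d' = bd T (- 1)"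
  note defs = V_def X_def Y_def Z_def d1_def d0_def d'_def
  have cT: "chain_complex S T" and pT: "projective S (obj T i)" and aT: "cycles T i = boundaries T i" for i
    using tT by (simp_all add: totally_acyclic_def acyclic_complex_def)
  note T' = chain_complexD[OF cT]
  have V: "lmodule S V" and X: "lmodule S X" and Y: "lmodule S Y" and Z: "lmodule S Z"
    unfolding defs by (rule T'(1))+
  have pY: "projective S Y" and pZ: "projective S Z" unfolding defs by (rule pT)+
  have lQ: "lmodule S Q" by (rule projective_lmodule[OF Q])
  have d1: "linear_map S V X d1" and d0: "linear_map S X Y d0" and d': "linear_map S Y Z d'"
    using T'(2)[of 1] T'(2)[of 0] T'(2)[of "- 1"] by (simp_all add: defs)
  have dd0: "d0 (d1 x) = \<zero>\<^bsub>Y\<^esub>" if "x \<in> carrier V" for x using T'(4)[of x 0] that by (simp add: defs)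
  have dd': "d' (d0 x) = \<zero>\<^bsub>Z\<^esub>" if "x \<in> carrier X" for x using T'(4)[of x "- 1"] that by (simp add: defs)
  have ex: "t \<in> d1 ` carrier V" if "t \<in> carrier X" "d0 t = \<zero>\<^bsub>Y\<^esub>" for t
  proof -
    have "t \<in> cycles T 0" using that by (simp add: cycles_eq defs)
    then show ?thesis using aT[of 0] by (simp add: boundaries_def defs)
  qed
  have F0: "\<exists>e. functional Y e \<and> (\<forall>x\<in>carrier X. \<psi> x = e (d0 x))"
    if "functional X \<psi>" "\<And>x. x \<in> carrier V \<Longrightarrow> \<psi> (d1 x) = \<zero>\<^bsub>R\<^esub>" for \<psi>
    using functional_extend[OF tT, of "- 1" \<psi>] that by (simp add: defs) metis
  have F1: "\<exists>e. functional Z e \<and> (\<forall>x\<in>carrier Y. \<psi> x = e (d' x))"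
    if "functional Y \<psi>" "\<And>x. x \<in> carrier X \<Longrightarrow> \<psi> (d0 x) = \<zero>\<^bsub>R\<^esub>" for \<psi>
    using functional_extend[OF tT, of "- 2" \<psi>] that by (simp add: defs) metis
  note a = \<alpha>[folded defs] \<alpha>d[folded defs] \<beta>[folded defs] \<beta>im[folded defs] h[folded defs] \<beta>\<alpha>[folded defs]
    \<alpha>\<beta>[folded defs]
  interpret M: lmodule S M by (rule M)
  interpret X: lmodule S X by (rule X)
  interpret Y: lmodule S Y by (rule Y)
  interpret TX: lmodule K "tens X" by (rule lmodule_tensor[OF X])
  interpret TY: lmodule K "tens Y" by (rule lmodule_tensor[OF Y])
  interpret TM: lmodule K "tens M" by (rule lmodule_tensor[OF M])
  note ac = linear_map_closed[OF a(1)] and bc = linear_map_closed[OF a(3)] and hc = linear_map_closed[OF a(5)]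
    and d0c = linear_map_closed[OF d0] and d1c = linear_map_closed[OF d1]
  note tl = tensor_map_linear and tp = tensor_map_pure
  note la = tl[OF X M a(1)] and lb = tl[OF M Y a(3)] and lh = tl[OF Y X a(5)] and lu = tl[OF M lQ u]
    and lp = tl[OF lQ M p]
    and l1 = tl[OF V X d1] and l0 = tl[OF X Y d0] and l' = tl[OF Y Z d']
  note tpa = tp[OF X M a(1)] and tpb = tp[OF M Y a(3)] and tph = tp[OF Y X a(5)] and tpu = tp[OF M lQ u]
    and tpp = tp[OF lQ M p]
    and tp1 = tp[OF V X d1] and tp0 = tp[OF X Y d0] and tp' = tp[OF Y Z d']
  define TC where "TC = tensor_complex K R T N"
  have cTC: "chain_complex K TC" unfolding TC_def by (rule chain_complex_tensor[OF cT])
  have oTC: "obj TC i = tens (obj T i)" for i by (simp add: TC_def tensor_complex_def)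
  have cyc0: "cycles TC 0 = {x \<in> carrier (tens X). tm Y d0 x = \<zero>\<^bsub>tens Y\<^esub>}"
    and cyc1: "cycles TC (- 1) = {x \<in> carrier (tens Y). tm Z d' x = \<zero>\<^bsub>tens Z\<^esub>}"
    and bou0: "boundaries TC 0 = tm X d1 ` carrier (tens V)"
    and bou1: "boundaries TC (- 1) = tm Y d0 ` carrier (tens X)"
    by (simp_all add: cycles_eq boundaries_def TC_def tensor_complex_def defs)
  have H0: "tate_tor K R T N i = quot_module (obj TC i\<lparr>carrier := cycles TC i\<rparr>) (boundaries TC i)" for i
    by (simp add: tate_tor_def homology_def TC_def)
  have \<alpha>1: "tm M \<alpha> (tm X d1 v) = \<zero>\<^bsub>tens M\<^esub>" if "v \<in> carrier (tens V)" for v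
    unfolding tensor_map_comp[OF V X M d1 a(1) that]
    by (rule tensor_map_zero[OF V M linear_map_comp[OF d1 a(1)] a(2) that])

  \<comment> \<open>Injectivity of the first map\<close>
  have kerB: "w \<in> boundaries TC 0" if w: "w \<in> carrier (tens X)" "tm Y d0 w = \<zero>\<^bsub>tens Y\<^esub>"
    "tm M \<alpha> w = \<zero>\<^bsub>tens M\<^esub>" for w
  proof -
    define B where "B = boundaries TC 0"
    have B: "submodule B K (tens X)"
      unfolding B_def bou0 by (rule submodule_image[OF lmodule_tensor[OF V] lmodule_tensor[OF X] l1])
    let ?W = "quot_module (tens X) B"
    let ?c = "\<lambda>z. B +>\<^bsub>tens X\<^esub> z"
    have lW: "lmodule K ?W" and pr: "linear_map K (tens X) ?W ?c"
      by (rule lmodule_quot[OF lmodule_tensor[OF X] B] linear_quot[OF lmodule_tensor[OF X] B])+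
    \<comment> \<open>The class of \<open>t \<otimes> n\<close> modulo boundaries depends only on
      \<open>d0 t\<close>, as the kernel of \<open>d0\<close> is the image of \<open>d1\<close>.
      This allows \<open>G\<close> below to use chosen preimages of
      \<open>\<beta> m\<close>.\<close>
    have indep: "?c (pure X t n) = ?c (pure X s n)"
      if t: "t \<in> carrier X" "s \<in> carrier X" "d0 t = d0 s" "n \<in> carrier N" for s t n
    proof -
      have "d0 (t \<ominus>\<^bsub>X\<^esub> s) = \<zero>\<^bsub>Y\<^esub>"
        using t d0c by (simp add: linear_map_minus[OF X Y d0] Y.minus_eq_zero_iff)
      then obtain v where v: "v \<in> carrier V" "t \<ominus>\<^bsub>X\<^esub> s = d1 v" using ex[of "t \<ominus>\<^bsub>X\<^esub> s"] t by auto
      have ts: "t = d1 v \<oplus>\<^bsub>X\<^esub> s"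
        unfolding v(2)[symmetric] using t by (simp add: a_minus_def X.M.a_assoc X.M.l_neg)
      have "pure X t n = tm X d1 (pure V v n) \<oplus>\<^bsub>tens X\<^esub> pure X s n"
        unfolding ts using t v d1c[OF v(1)] by (simp add: pure_add_left[OF X] tp1)
      moreover have b: "tm X d1 (pure V v n) \<in> carrier (tens X)" "tm X d1 (pure V v n) \<in> B"
        using v t pure_closed[OF V] linear_map_closed[OF l1] by (auto simp: B_def bou0)
      ultimately have "pure X t n \<ominus>\<^bsub>tens X\<^esub> pure X s n = tm X d1 (pure V v n)"
        using pure_closed[OF X t(2,4)] by (simp add: a_minus_def TX.M.a_assoc TX.M.r_neg)
      then show ?thesis
        using TX.quot_eq_iff[OF B] pure_closed[OF X] t b(2) by simp
    qed
    have "\<forall>m\<in>carrier M. \<exists>t\<in>carrier X. d0 t = \<beta> m" using a(4) by (metis imageE)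
    then obtain t where t: "\<And>m. m \<in> carrier M \<Longrightarrow> t m \<in> carrier X" "\<And>m. m \<in> carrier M \<Longrightarrow> d0 (t m) = \<beta> m" by metis
    have "\<exists>G. linear_map K (tens M) ?W G \<and> (\<forall>m\<in>carrier M. \<forall>n\<in>carrier N. G (pure M m n) = ?c (pure X (t m) n))"
    proof (rule tensor_lift[OF M lW])
      fix m n assume m: "m \<in> carrier M" and n: "n \<in> carrier N"
      show "?c (pure X (t m) n) \<in> carrier ?W"
        by (rule linear_map_closed[OF pr pure_closed[OF X t(1)[OF m] n]])
      {
        fix m' assume m': "m' \<in> carrier M"
        have "?c (pure X (t (m \<oplus>\<^bsub>M\<^esub> m')) n) = ?c (pure X (t m \<oplus>\<^bsub>X\<^esub> t m') n)"
          using m m' n t by (intro indep) (simp_all add: linear_map_add[OF d0] linear_map_add[OF a(3)])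
        then show "?c (pure X (t (m \<oplus>\<^bsub>M\<^esub> m')) n) = ?c (pure X (t m) n) \<oplus>\<^bsub>?W\<^esub> ?c (pure X (t m') n)"
          using m m' n t pure_closed[OF X] by (simp add: pure_add_left[OF X] linear_map_add[OF pr])
      }
      {
        fix n' assume n': "n' \<in> carrier N"
        show "?c (pure X (t m) (n \<oplus>\<^bsub>N\<^esub> n')) = ?c (pure X (t m) n) \<oplus>\<^bsub>?W\<^esub> ?c (pure X (t m) n')"
          using m n n' t pure_closed[OF X] by (simp add: pure_add_right[OF X] linear_map_add[OF pr])
      }
      {
        fix r assume r: "r \<in> carrier R"
        have "?c (pure X (t (r \<odot>\<^bsub>M\<^esub> m)) n) = ?c (pure X (r \<odot>\<^bsub>X\<^esub> t m) n)"
          using m n t r M.smult_closed[of r m] X.smult_closed[of r "t m"]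
          by (intro indep) (simp_all add: linear_map_smult[OF d0] linear_map_smult[OF a(3)])
        then show "?c (pure X (t (r \<odot>\<^bsub>M\<^esub> m)) n) = ?c (pure X (t m) (r \<odot>\<^bsub>N\<^esub> n))"
          using m n t r by (simp add: pure_balanced[OF X])
      }
      {
        fix c assume c: "c \<in> carrier K"
        show "c \<odot>\<^bsub>?W\<^esub> ?c (pure X (t m) n) = ?c (pure X (t m) (\<kappa> c \<odot>\<^bsub>N\<^esub> n))"
          using m n t c pure_closed[OF X] by (simp add: pure_smult[OF X] linear_map_smult[OF pr, symmetric])
      }
    qed
    then obtain G where G: "linear_map K (tens M) ?W G"
      "\<And>m n. \<lbrakk>m \<in> carrier M; n \<in> carrier N\<rbrakk> \<Longrightarrow> G (pure M m n) = ?c (pure X (t m) n)" by blast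
    \<comment> \<open>\<open>G\<close> is \<open>\<beta>\<close> with values taken modulo boundaries
      instead of in the image of \<open>d0\<close>. After \<open>\<alpha>\<close> it is the class of
      \<open>1 + h d0\<close>, which on cycles is the plain class; so a cycle killed by
      \<open>\<alpha>\<close> is a boundary.\<close>
    have "G (tm M \<alpha> w) = ?c (w \<oplus>\<^bsub>tens X\<^esub> tm X h (tm Y d0 w))"
    proof (rule tensor_eqI[OF X linear_map_comp[OF la G(1)] linear_map_comp[OF
            linear_map_plus[OF lmodule_tensor[OF X] linear_map_ident linear_map_comp[OF l0 lh]] pr] _ w(1)])
      fix x n assume x: "x \<in> carrier X" and n: "n \<in> carrier N"
      note hx = hc[OF d0c[OF x]]
      have "G (tm M \<alpha> (pure X x n)) = ?c (pure X (t (\<alpha> x)) n)" by (simp add: tpa x n G(2) ac)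
      also have "\<dots> = ?c (pure X (x \<oplus>\<^bsub>X\<^esub> h (d0 x)) n)"
        using t(2)[OF ac[OF x]] a(6)[OF x] t(1)[OF ac[OF x]] x hx n by (intro indep) simp_all
      finally show "G (tm M \<alpha> (pure X x n)) = ?c (pure X x n \<oplus>\<^bsub>tens X\<^esub> tm X h (tm Y d0 (pure X x n)))"
        using x n hx d0c by (simp add: pure_add_left[OF X] tp0 tph)
    qed
    then have "?c w = B"
      using w linear_map_zero[OF lmodule_tensor[OF M] lW G(1)] linear_map_zero[OF lmodule_tensor[OF Y]
        lmodule_tensor[OF X] lh]
      by (simp add: zero_quot)
    then show ?thesis using TX.coset_eq_iff[OF B w(1)] by (simp add: B_def)
  qed

  \<comment> \<open>Tensor form of \<open>\<alpha>\<beta>\<close>. No linear map from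
    \<open>y\<close> to \<open>x\<close> is constructed: only existence is claimed, and existence
    passes to sums.\<close>
  have lift: "\<exists>x\<in>carrier (tens X). tm M \<alpha> x = y \<oplus>\<^bsub>tens M\<^esub> tm M p (tm Q u y) \<and> tm Y d0 x = tm Y \<beta> y"
    if y: "y \<in> carrier (tens M)" for y
    using y
  proof (induction rule: tensor_induct[OF M, consumes 1, case_names pure add])
    case (pure m n)
    obtain t where t: "t \<in> carrier X" "d0 t = \<beta> m" using a(4)[OF pure(1)] by auto
    note pc = linear_map_closed[OF p linear_map_closed[OF u pure(1)]]
    show ?case
      by (rule bexI[of _ "pure X t n"])
        (use t pure pc a(7)[OF pure(1) t] in \<open>simp_all add: tpa tp0 tpb tpu tpp linear_map_closed[OF u]
          pure_add_left[OF M] pure_closed[OF X]\<close>)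
  next
    case (add y z)
    from add(3) obtain x where x: "x \<in> carrier (tens X)" "tm M \<alpha> x = y \<oplus>\<^bsub>tens M\<^esub> tm M p (tm Q u y)"
      "tm Y d0 x = tm Y \<beta> y" by blast
    from add(4) obtain x' where x': "x' \<in> carrier (tens X)" "tm M \<alpha> x' = z \<oplus>\<^bsub>tens M\<^esub> tm M p (tm Q u z)"
      "tm Y d0 x' = tm Y \<beta> z" by blast
    have puc: "tm M p (tm Q u w) \<in> carrier (tens M)" if "w \<in> carrier (tens M)" for w
      by (rule linear_map_closed[OF linear_map_comp[OF lu lp] that])
    show ?case
      by (rule bexI[of _ "x \<oplus>\<^bsub>tens X\<^esub> x'"])
        (use x x' add(1,2) puc in \<open>simp_all add: linear_map_add[OF la] linear_map_add[OF l0] linear_map_add[OF lb]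
          linear_map_add[OF linear_map_comp[OF lu lp]] TM.M.a_ac\<close>)
  qed

  have theta_zero: "\<zero>\<^bsub>hom_module R (dual_module R M) N\<^esub> = (\<lambda>\<mu>\<in>carrier (dual_module R M). \<zero>\<^bsub>N\<^esub>)"
    by (simp add: hom_module_def)
  \<comment> \<open>\<open>\<alpha>\<close> kills the image of \<open>d1\<close>, so
    \<open>\<mu>\<close> after \<open>\<alpha>\<close> is a functional on the image of
    \<open>d0\<close> and extends to \<open>Y\<close>.\<close>
  have extend: "\<exists>e. functional Y e \<and> (\<forall>x\<in>carrier X. \<mu> (\<alpha> x) = e (d0 x))" if "functional M \<mu>" for \<mu>
    using linear_map_zero[OF M lmodule_regS that] by (intro F0 linear_map_comp[OF a(1) that]) (simp add: a(2))
  have ev_alpha: "ev M \<mu> (tm M \<alpha> x) = ev Y e (tm Y d0 x)"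
    if m: "functional M \<mu>" "functional Y e" "\<forall>x\<in>carrier X. \<mu> (\<alpha> x) = e (d0 x)" "x \<in> carrier (tens X)" for \<mu> e x
    unfolding ev_tensor_map[OF X M a(1) m(1,4)] ev_tensor_map[OF X Y d0 m(2,4)]
    by (rule ev_cong[OF X linear_map_comp[OF a(1) m(1)] _ m(4)]) (use m(3) in blast)

  \<comment> \<open>Exactness at the tensor product\<close>
  have im_f: "tm M \<alpha> ` cycles TC 0 = {y \<in> carrier (tens M). \<theta> M y = \<zero>\<^bsub>hom_module R (dual_module R M) N\<^esub>}"
  proof (intro equalityI subsetI)
    fix y assume "y \<in> tm M \<alpha> ` cycles TC 0"
    then obtain x where x: "x \<in> carrier (tens X)" "tm Y d0 x = \<zero>\<^bsub>tens Y\<^esub>" "y = tm M \<alpha> x" by (auto simp: cyc0)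
    have "ev M \<mu> y = \<zero>\<^bsub>N\<^esub>" if "\<mu> \<in> carrier (dual_module R M)" for \<mu>
    proof -
      note m = dual_functional[OF M that]
      obtain e where "functional Y e" "\<forall>x\<in>carrier X. \<mu> (\<alpha> x) = e (d0 x)" using extend[OF m] by blast
      then show ?thesis using ev_alpha[OF m _ _ x(1)] x(2,3) ev_zero[OF Y] by simp
    qed
    then have "\<theta> M y = \<zero>\<^bsub>hom_module R (dual_module R M) N\<^esub>"
      by (auto simp: \<theta>_def[OF M] theta_zero)
    then show "y \<in> {y \<in> carrier (tens M). \<theta> M y = \<zero>\<^bsub>hom_module R (dual_module R M) N\<^esub>}"
      using x linear_map_closed[OF la] by simp
  next
    fix y assume "y \<in> {y \<in> carrier (tens M). \<theta> M y = \<zero>\<^bsub>hom_module R (dual_module R M) N\<^esub>}"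
    then have y: "y \<in> carrier (tens M)" and ty: "\<theta> M y = \<zero>\<^bsub>hom_module R (dual_module R M) N\<^esub>" by auto
    \<comment> \<open>\<open>\<theta> M y\<close> sees only the extensional functionals in the dual,
      but every functional agrees on \<open>M\<close> with its restriction.\<close>
    have ev0: "ev M \<psi> y = \<zero>\<^bsub>N\<^esub>" if p: "functional M \<psi>" for \<psi>
    proof -
      note r = dual_restrict[OF M p]
      have "ev M \<psi> y = ev M (restrict \<psi> (carrier M)) y" by (rule ev_cong[OF M p _ y]) simp
      also have "\<dots> = \<theta> M y (restrict \<psi> (carrier M))" using r by (simp add: \<theta>_def[OF M])
      finally show ?thesis using r by (simp add: ty theta_zero)
    qed
    \<comment> \<open>Functionals that factor through \<open>u\<close> or \<open>\<beta>\<close>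
      annihilate \<open>y\<close> too, and \<open>Q\<close> and \<open>Y\<close> are projective, so
      both images of \<open>y\<close> vanish. Then \<open>lift\<close> provides a cycle that is
      mapped to \<open>y\<close> without error.\<close>
    have "tm Q u y = \<zero>\<^bsub>tens Q\<^esub>"
      by (rule tensor_projective_vanish[OF Q linear_map_closed[OF lu y]])
        (simp add: ev_tensor_map[OF M lQ u _ y] ev0 linear_map_comp[OF u])
    moreover have b0: "tm Y \<beta> y = \<zero>\<^bsub>tens Y\<^esub>"
      by (rule tensor_projective_vanish[OF pY linear_map_closed[OF lb y]])
        (simp add: ev_tensor_map[OF M Y a(3) _ y] ev0 linear_map_comp[OF a(3)])
    moreover obtain x where x: "x \<in> carrier (tens X)" "tm M \<alpha> x = y \<oplus>\<^bsub>tens M\<^esub> tm M p (tm Q u y)"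
      "tm Y d0 x = tm Y \<beta> y"
      using lift[OF y] by blast
    ultimately have "tm M \<alpha> x = y"
      using linear_map_zero[OF lmodule_tensor[OF lQ] lmodule_tensor[OF M] lp] y by simp
    then show "y \<in> tm M \<alpha> ` cycles TC 0" using x b0 by (auto simp: cyc0)
  qed

  \<comment> \<open>The third map, before passing to homology\<close>
  obtain J \<phi> where J: "finite J" "J \<subseteq> carrier Y" and \<phi>: "\<And>j. functional M (\<phi> j)"
    and \<beta>sum: "\<And>m. m \<in> carrier M \<Longrightarrow> \<beta> m = finsum Y (\<lambda>j. \<phi> j m \<odot>\<^bsub>Y\<^esub> j) J"
    by (rule finitely_generated_coordinates[OF M fg pY a(3)]) (rule that)
  have \<phi>c: "\<phi> j m \<in> carrier R" if "m \<in> carrier M" for j m using linear_map_closed[OF \<phi> that] by simp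
  let ?\<phi> = "\<lambda>j. restrict (\<phi> j) (carrier M)"
  let ?H = "hom_module R (dual_module R M) N"
  let ?D = "dual_module R M"
  note \<phi>D = dual_restrict[OF M \<phi>]
  interpret D: lmodule R ?D by (rule lmodule_dual[OF M])
  have H: "linear_map R ?D N \<xi>" "\<xi> \<in> extensional (carrier ?D)" if "\<xi> \<in> carrier ?H" for \<xi>
    using that by (simp_all add: hom_module_def)
  have Hc: "\<xi> \<mu> \<in> carrier N" if "\<xi> \<in> carrier ?H" "\<mu> \<in> carrier ?D" for \<xi> \<mu>
    by (rule linear_map_closed[OF H(1)[OF that(1)] that(2)])
  define h0 where "h0 \<xi> = finsum (tens Y) (\<lambda>j. pure Y j (\<xi> (?\<phi> j))) J" for \<xi>
  have pj: "(\<lambda>j. pure Y j (\<xi> (?\<phi> j))) \<in> J \<rightarrow> carrier (tens Y)" if "\<xi> \<in> carrier ?H" for \<xi>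
    using J(2) Hc[OF that \<phi>D] pure_closed[OF Y] by auto
  have h0c: "h0 \<xi> \<in> carrier (tens Y)" if "\<xi> \<in> carrier ?H" for \<xi>
    unfolding h0_def by (rule TY.M.finsum_closed[OF pj[OF that]])
  have h0lin: "linear_map K ?H (tens Y) h0"
  proof (rule linear_mapI[OF h0c])
    fix \<xi> \<eta> assume x: "\<xi> \<in> carrier ?H" and y: "\<eta> \<in> carrier ?H"
    have "(\<xi> \<oplus>\<^bsub>?H\<^esub> \<eta>) (?\<phi> j) = \<xi> (?\<phi> j) \<oplus>\<^bsub>N\<^esub> \<eta> (?\<phi> j)" for j
      using \<phi>D by (simp add: hom_module_def)
    then have "h0 (\<xi> \<oplus>\<^bsub>?H\<^esub> \<eta>) = finsum (tens Y) (\<lambda>j. pure Y j (\<xi> (?\<phi> j)) \<oplus>\<^bsub>tens Y\<^esub> pure Y j (\<eta> (?\<phi> j))) J"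
      unfolding h0_def using J(2) Hc[OF x \<phi>D] Hc[OF y \<phi>D] pj[OF x] pj[OF y]
      by (intro TY.M.finsum_cong') (auto simp: pure_add_right[OF Y] subset_iff)
    then show "h0 (\<xi> \<oplus>\<^bsub>?H\<^esub> \<eta>) = h0 \<xi> \<oplus>\<^bsub>tens Y\<^esub> h0 \<eta>"
      unfolding h0_def using TY.M.finsum_addf[OF pj[OF x] pj[OF y]] by simp
  next
    fix c \<xi> assume c: "c \<in> carrier K" and x: "\<xi> \<in> carrier ?H"
    have "(c \<odot>\<^bsub>?H\<^esub> \<xi>) (?\<phi> j) = \<kappa> c \<odot>\<^bsub>N\<^esub> \<xi> (?\<phi> j)" for j
      using \<phi>D by (simp add: hom_module_def)
    then have "h0 (c \<odot>\<^bsub>?H\<^esub> \<xi>) = finsum (tens Y) (\<lambda>j. c \<odot>\<^bsub>tens Y\<^esub> pure Y j (\<xi> (?\<phi> j))) J"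
      unfolding h0_def using J(2) Hc[OF x \<phi>D] pj[OF x] c
      by (intro TY.M.finsum_cong') (auto simp: pure_smult[OF Y] pure_closed[OF Y] kappa_closed subset_iff Pi_def)
    then show "h0 (c \<odot>\<^bsub>?H\<^esub> \<xi>) = c \<odot>\<^bsub>tens Y\<^esub> h0 \<xi>"
      unfolding h0_def using TY.smult_finsum[OF pj[OF x] c] by simp
  qed
  \<comment> \<open>Seen through functionals, \<open>h0\<close> is given by composition with
    \<open>\<beta>\<close>, whatever the coordinates. That the values are cycles, exactness at the
    Hom module and surjectivity all rely on this formula.\<close>
  have ev_h0: "ev Y e (h0 \<xi>) = \<xi> (\<lambda>m\<in>carrier M. e (\<beta> m))" if x: "\<xi> \<in> carrier ?H" and e: "functional Y e" for \<xi> e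
  proof -
    have ec: "e j \<in> carrier R" if "j \<in> J" for j using linear_map_closed[OF e, of j] J(2) that by auto
    have "ev Y e (h0 \<xi>) = finsum NK (\<lambda>j. ev Y e (pure Y j (\<xi> (?\<phi> j)))) J"
      unfolding h0_def by (rule linear_map_finsum[OF lmodule_tensor[OF Y] NK ev_linear[OF Y e] pj[OF x]])
    also have "\<dots> = finsum N (\<lambda>j. ev Y e (pure Y j (\<xi> (?\<phi> j)))) J"
      by (simp add: finsum_def finprod_def)
    also have "\<dots> = finsum N (\<lambda>j. e j \<odot>\<^bsub>N\<^esub> \<xi> (?\<phi> j)) J"
      using J(2) Hc[OF x \<phi>D] ec by (intro N.M.finsum_cong') (auto simp: ev_pure[OF Y e] subset_iff)
    also have "\<dots> = \<xi> (\<lambda>m\<in>carrier M. e (\<beta> m))"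
      by (rule hom_dual_sum[OF M H(1)[OF x] Y J(2) \<phi> \<beta>sum e, symmetric])
    finally show ?thesis .
  qed
  have h0cyc: "h0 \<xi> \<in> cycles TC (- 1)" if x: "\<xi> \<in> carrier ?H" for \<xi>
  proof -
    have "tm Z d' (h0 \<xi>) = \<zero>\<^bsub>tens Z\<^esub>"
    proof (rule tensor_projective_vanish[OF pZ linear_map_closed[OF l' h0c[OF x]]])
      fix \<psi> assume p: "functional Z \<psi>"
      have "\<psi> (d' (\<beta> m)) = \<zero>\<^bsub>R\<^esub>" if m: "m \<in> carrier M" for m
        using a(4)[OF m] dd' linear_map_zero[OF Z lmodule_regS p] by auto
      then have "(\<lambda>m\<in>carrier M. \<psi> (d' (\<beta> m))) = \<zero>\<^bsub>?D\<^esub>" by (auto simp: dual_module_def)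
      then show "ev Z \<psi> (tm Z d' (h0 \<xi>)) = \<zero>\<^bsub>N\<^esub>"
        using ev_tensor_map[OF Y Z d' p h0c[OF x]] ev_h0[OF x linear_map_comp[OF d' p]]
          linear_map_zero[OF lmodule_dual[OF M] N H(1)[OF x]] by simp
    qed
    then show ?thesis using h0c[OF x] by (simp add: cyc1)
  qed
  have h0\<theta>: "h0 (\<theta> M y) = tm Y \<beta> y" if y: "y \<in> carrier (tens M)" for y
  proof (rule tensor_eqI[OF M linear_map_comp[OF theta_linear[OF M] h0lin] lb _ y])
    fix m n assume m: "m \<in> carrier M" and n: "n \<in> carrier N"
    have t: "\<theta> M (pure M m n) (?\<phi> j) = \<phi> j m \<odot>\<^bsub>N\<^esub> n" for j
      using \<phi>D ev_pure[OF M dual_functional[OF M \<phi>D] m n] m by (simp add: \<theta>_def[OF M])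
    have sm: "\<phi> j m \<odot>\<^bsub>Y\<^esub> j \<in> carrier Y" if "j \<in> J" for j
      using Y.smult_closed[of "\<phi> j m" j] \<phi>c[OF m] J(2) that by auto
    have "h0 (\<theta> M (pure M m n)) = finsum (tens Y) (\<lambda>j. pure Y (\<phi> j m \<odot>\<^bsub>Y\<^esub> j) n) J"
      unfolding h0_def t using J(2) \<phi>c[OF m] n sm pure_closed[OF Y]
      by (intro TY.M.finsum_cong') (auto simp: pure_balanced[OF Y] subset_iff)
    also have "\<dots> = pure Y (finsum Y (\<lambda>j. \<phi> j m \<odot>\<^bsub>Y\<^esub> j) J) n"
      by (rule pure_finsum_left[OF Y sm n, symmetric])
    finally show "h0 (\<theta> M (pure M m n)) = tm Y \<beta> (pure M m n)"
      using \<beta>sum[OF m] by (simp add: tpb m n)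
  qed

  \<comment> \<open>Exactness at the Hom module\<close>
  have im_g: "\<theta> M ` carrier (tens M) = {\<xi> \<in> carrier ?H. h0 \<xi> \<in> boundaries TC (- 1)}"
  proof (intro equalityI subsetI)
    fix \<xi> assume "\<xi> \<in> \<theta> M ` carrier (tens M)"
    then obtain y where y: "y \<in> carrier (tens M)" "\<xi> = \<theta> M y" by blast
    obtain x where "x \<in> carrier (tens X)" "tm Y d0 x = tm Y \<beta> y" using lift[OF y(1)] by blast
    then have "h0 \<xi> \<in> boundaries TC (- 1)" using h0\<theta>[OF y(1)] y(2) by (force simp: bou1)
    then show "\<xi> \<in> {\<xi> \<in> carrier ?H. h0 \<xi> \<in> boundaries TC (- 1)}" using y theta_closed[OF M] by simp
  next
    fix \<xi> assume "\<xi> \<in> {\<xi> \<in> carrier ?H. h0 \<xi> \<in> boundaries TC (- 1)}"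
    then obtain x where xi: "\<xi> \<in> carrier ?H" and x: "x \<in> carrier (tens X)" "h0 \<xi> = tm Y d0 x" by (auto simp: bou1)
    obtain I \<chi> where I: "finite I" "I \<subseteq> carrier Q" and \<chi>: "\<And>j. functional M (\<chi> j)"
      and usum: "\<And>m. m \<in> carrier M \<Longrightarrow> u m = finsum Q (\<lambda>j. \<chi> j m \<odot>\<^bsub>Q\<^esub> j) I"
      by (rule finitely_generated_coordinates[OF M fg Q u]) (rule that)
    let ?\<chi> = "\<lambda>j. restrict (\<chi> j) (carrier M)"
    note \<chi>D = dual_restrict[OF M \<chi>]
    \<comment> \<open>Its evaluation at \<open>\<mu>\<close> is the value of \<open>\<xi>\<close> at
      \<open>\<mu> p u\<close>, expressed by coordinates of \<open>u\<close>. Since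
      \<open>e \<beta> = \<mu> + \<mu> p u\<close>, evaluating the image of \<open>x\<close> gives
      \<open>\<xi> \<mu>\<close> plus exactly this error, so \<open>y\<close> is subtracted.\<close>
    define y where "y = finsum (tens M) (\<lambda>k. pure M (p k) (\<xi> (?\<chi> k))) I"
    have pk: "(\<lambda>k. pure M (p k) (\<xi> (?\<chi> k))) \<in> I \<rightarrow> carrier (tens M)"
      using I(2) Hc[OF xi \<chi>D] linear_map_closed[OF p] pure_closed[OF M] by auto
    have yc: "y \<in> carrier (tens M)" unfolding y_def by (rule TM.M.finsum_closed[OF pk])
    have xc: "tm M \<alpha> x \<in> carrier (tens M)" by (rule linear_map_closed[OF la x(1)])
    have wc: "tm M \<alpha> x \<ominus>\<^bsub>tens M\<^esub> y \<in> carrier (tens M)" using xc yc by simp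
    have "\<theta> M (tm M \<alpha> x \<ominus>\<^bsub>tens M\<^esub> y) \<mu> = \<xi> \<mu>" if mu: "\<mu> \<in> carrier ?D" for \<mu>
    proof -
      note m = dual_functional[OF M mu]
      note mc = dual_closed[OF M mu]
      obtain e where e: "functional Y e" "\<forall>x\<in>carrier X. \<mu> (\<alpha> x) = e (d0 x)" using extend[OF m] by blast
      note mp = linear_map_comp[OF p m]
      have mpc: "\<mu> (p k) \<in> carrier R" if "k \<in> I" for k
        using linear_map_closed[OF mp, of k] I(2) that by auto
      have mpu: "(\<lambda>m\<in>carrier M. \<mu> (p (u m))) \<in> carrier ?D"
        by (rule dual_restrict[OF M linear_map_comp[OF u mp]])
      have "e (\<beta> m) = \<mu> m \<oplus>\<^bsub>R\<^esub> \<mu> (p (u m))" if mm: "m \<in> carrier M" for m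
      proof -
        obtain t where t: "t \<in> carrier X" "d0 t = \<beta> m" using a(4)[OF mm] by auto
        have "e (\<beta> m) = \<mu> (\<alpha> t)" using e(2) t by simp
        also have "\<dots> = \<mu> (m \<oplus>\<^bsub>M\<^esub> p (u m))" using a(7)[OF mm t] by simp
        finally show ?thesis
          using linear_map_add[OF m mm linear_map_closed[OF p linear_map_closed[OF u mm]]] by simp
      qed
      then have "(\<lambda>m\<in>carrier M. e (\<beta> m)) = \<mu> \<oplus>\<^bsub>?D\<^esub> (\<lambda>m\<in>carrier M. \<mu> (p (u m)))"
        using dual_restrict[OF M linear_map_comp[OF a(3) e(1)]] mu mpu by (intro dual_eqI[OF M]) simp_all
      then have "ev M \<mu> (tm M \<alpha> x) = \<xi> \<mu> \<oplus>\<^bsub>N\<^esub> \<xi> (\<lambda>m\<in>carrier M. \<mu> (p (u m)))"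
        using ev_alpha[OF m e x(1)] ev_h0[OF xi e(1)] x(2) linear_map_add[OF H(1)[OF xi] mu mpu] by simp
      moreover have "\<xi> (\<lambda>m\<in>carrier M. \<mu> (p (u m))) = ev M \<mu> y"
      proof -
        have "ev M \<mu> y = finsum NK (\<lambda>k. ev M \<mu> (pure M (p k) (\<xi> (?\<chi> k)))) I"
          unfolding y_def by (rule linear_map_finsum[OF lmodule_tensor[OF M] NK ev_linear[OF M m] pk])
        also have "\<dots> = finsum N (\<lambda>k. ev M \<mu> (pure M (p k) (\<xi> (?\<chi> k)))) I"
          by (simp add: finsum_def finprod_def)
        also have "\<dots> = finsum N (\<lambda>k. \<mu> (p k) \<odot>\<^bsub>N\<^esub> \<xi> (?\<chi> k)) I"
          using I(2) Hc[OF xi \<chi>D] mpc linear_map_closed[OF p]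
          by (intro N.M.finsum_cong') (auto simp: ev_pure[OF M m] subset_iff)
        also have "\<dots> = \<xi> (\<lambda>m\<in>carrier M. \<mu> (p (u m)))"
          by (rule hom_dual_sum[OF M H(1)[OF xi] lQ I(2) \<chi> usum mp, symmetric])
        finally show ?thesis by simp
      qed
      moreover have "\<theta> M (tm M \<alpha> x \<ominus>\<^bsub>tens M\<^esub> y) \<mu> = ev M \<mu> (tm M \<alpha> x) \<ominus>\<^bsub>NK\<^esub> ev M \<mu> y"
        using mu linear_map_minus[OF lmodule_tensor[OF M] NK ev_linear[OF M m] xc yc] by (simp add: \<theta>_def[OF M])
      moreover have "w \<oplus>\<^bsub>N\<^esub> v \<ominus>\<^bsub>NK\<^esub> v = w" if "w \<in> carrier N" "v \<in> carrier N" for v w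
      proof -
        interpret NK: lmodule K NK by (rule NK)
        show ?thesis using that NK.M.a_assoc[of w v "\<ominus>\<^bsub>NK\<^esub> v"] NK.M.r_neg[of v] NK.M.a_inv_closed[of v]
          by (simp add: a_minus_def)
      qed
      ultimately show ?thesis
        using Hc[OF xi mu] ev_closed[OF M m yc] by simp
    qed
    then have "\<xi> = \<theta> M (tm M \<alpha> x \<ominus>\<^bsub>tens M\<^esub> y)"
      using H(2)[OF xi] H(2)[OF theta_closed[OF M wc]] by (intro extensionalityI[of _ "carrier ?D"]) auto
    then show "\<xi> \<in> \<theta> M ` carrier (tens M)" using wc by blast
  qed

  \<comment> \<open>Surjectivity of the third map\<close>
  have surj: "\<exists>\<xi>\<in>carrier ?H. h0 \<xi> \<ominus>\<^bsub>tens Y\<^esub> z \<in> boundaries TC (- 1)" if z: "z \<in> cycles TC (- 1)" for z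
  proof -
    have zc: "z \<in> carrier (tens Y)" and dz: "tm Z d' z = \<zero>\<^bsub>tens Z\<^esub>" using z by (simp_all add: cyc1)
    \<comment> \<open>Two extensions of a functional from the image of \<open>d0\<close> differ by a
      functional pulled back along \<open>d'\<close>, and \<open>d'\<close> kills the cycle
      \<open>z\<close>.\<close>
    have uniq: "ev Y e z = ev Y e' z"
      if e: "functional Y e" "functional Y e'" "\<And>x. x \<in> carrier X \<Longrightarrow> e (d0 x) = e' (d0 x)" for e e'
    proof -
      have c: "e y \<in> carrier R" "e' y \<in> carrier R" if "y \<in> carrier Y" for y
        using e(1,2)[THEN linear_map_closed] that by simp_all
      have diff: "functional Y (\<lambda>y. e y \<ominus>\<^bsub>regular_module S\<^esub> e' y)"
        by (rule linear_map_diff[OF lmodule_regS e(1,2)])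
      interpret RS: lmodule S "regular_module S" by (rule lmodule_regS)
      have "e (d0 x) \<ominus>\<^bsub>regular_module S\<^esub> e' (d0 x) = \<zero>\<^bsub>R\<^esub>" if "x \<in> carrier X" for x
        using RS.minus_eq_zero_iff[of "e (d0 x)" "e' (d0 x)"] e(3)[OF that] c[OF d0c[OF that]] by simp
      then obtain k where k: "functional Z k" "\<forall>y\<in>carrier Y. e y \<ominus>\<^bsub>regular_module S\<^esub> e' y = k (d' y)"
        using F1[OF diff] by blast
      have ey: "e y = e' y \<oplus>\<^bsub>R\<^esub> k (d' y)" if y: "y \<in> carrier Y" for y
      proof -
        have "e' y \<oplus>\<^bsub>regular_module S\<^esub> (e y \<ominus>\<^bsub>regular_module S\<^esub> e' y) = e y"
          using c[OF y] RS.M.a_lcomm[of "e' y" "e y" "\<ominus>\<^bsub>regular_module S\<^esub> e' y"] RS.M.r_neg[of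
            "e' y"] RS.M.a_inv_closed[of "e' y"]
          by (simp add: a_minus_def)
        then show ?thesis using k(2) y by simp
      qed
      note kd = linear_map_comp[OF d' k(1)]
      have "ev Y e z = ev Y (\<lambda>y. e' y \<oplus>\<^bsub>R\<^esub> k (d' y)) z" by (rule ev_cong[OF Y e(1) ey zc])
      also have "\<dots> = ev Y e' z \<oplus>\<^bsub>N\<^esub> ev Z k (tm Z d' z)"
        unfolding ev_plus[OF Y e(2) kd zc] ev_tensor_map[OF Y Z d' k(1) zc] ..
      also have "\<dots> = ev Y e' z" using ev_closed[OF Y e(2) zc] by (simp add: dz ev_zero[OF Z k(1)])
      finally show ?thesis .
    qed
    have "\<forall>\<mu>\<in>carrier ?D. \<exists>e. functional Y e \<and> (\<forall>x\<in>carrier X. \<mu> (\<alpha> x) = e (d0 x))"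
      using extend dual_functional[OF M] by blast
    then obtain E where E: "\<And>\<mu>. \<mu> \<in> carrier ?D \<Longrightarrow> functional Y (E \<mu>)"
      "\<And>\<mu> x. \<lbrakk>\<mu> \<in> carrier ?D; x \<in> carrier X\<rbrakk> \<Longrightarrow> \<mu> (\<alpha> x) = E \<mu> (d0 x)" by metis
    \<comment> \<open>\<open>z\<close> is evaluated at an extension \<open>E \<mu>\<close> of the
      functional that \<open>\<mu>\<close> induces through \<open>\<alpha>\<close>. The chosen
      extensions need not be additive in \<open>\<mu>\<close>; \<open>uniq\<close> makes the values
      linear all the same.\<close>
    define \<xi> where "\<xi> = (\<lambda>\<mu>\<in>carrier ?D. ev Y (E \<mu>) z)"
    have "linear_map R ?D N \<xi>"
    proof (rule linear_mapI)
      fix \<mu> \<nu> assume m: "\<mu> \<in> carrier ?D" "\<nu> \<in> carrier ?D"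
      show "\<xi> \<mu> \<in> carrier N" using m ev_closed[OF Y E(1) zc] by (simp add: \<xi>_def)
      have "ev Y (E (\<mu> \<oplus>\<^bsub>?D\<^esub> \<nu>)) z = ev Y (\<lambda>y. E \<mu> y \<oplus>\<^bsub>R\<^esub> E \<nu> y) z"
        using m by (intro uniq E functional_plus) (simp_all add: E(2)[symmetric] ac)
      also have "\<dots> = ev Y (E \<mu>) z \<oplus>\<^bsub>N\<^esub> ev Y (E \<nu>) z" by (rule ev_plus[OF Y E(1)[OF m(1)] E(1)[OF m(2)] zc])
      finally show "\<xi> (\<mu> \<oplus>\<^bsub>?D\<^esub> \<nu>) = \<xi> \<mu> \<oplus>\<^bsub>N\<^esub> \<xi> \<nu>" using m by (simp add: \<xi>_def)
    next
      fix r \<mu> assume m: "r \<in> carrier R" "\<mu> \<in> carrier ?D"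
      have "ev Y (E (r \<odot>\<^bsub>?D\<^esub> \<mu>)) z = ev Y (\<lambda>y. r \<otimes>\<^bsub>R\<^esub> E \<mu> y) z"
        using m by (intro uniq E functional_smult) (simp_all add: E(2)[symmetric] ac)
      also have "\<dots> = r \<odot>\<^bsub>N\<^esub> ev Y (E \<mu>) z" by (rule ev_smult[OF Y E(1)[OF m(2)] m(1) zc])
      finally show "\<xi> (r \<odot>\<^bsub>?D\<^esub> \<mu>) = r \<odot>\<^bsub>N\<^esub> \<xi> \<mu>" using m by (simp add: \<xi>_def)
    qed
    then have xi: "\<xi> \<in> carrier ?H" by (simp add: hom_module_def \<xi>_def)
    have hz: "tm X h z \<in> carrier (tens X)" and dhz: "tm Y d0 (tm X h z) \<in> carrier (tens Y)"
      using linear_map_closed[OF lh zc] linear_map_closed[OF l0] by auto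
    \<comment> \<open>From \<open>\<beta> \<alpha> = d0 + d0 h d0\<close>, the functional
      \<open>\<psi> + \<psi> d0 h\<close> is an extension belonging to
      \<open>\<psi> \<beta>\<close>. So \<open>h0 \<xi>\<close> should be \<open>z\<close> plus the
      boundary of the image of \<open>z\<close> under \<open>h\<close>, an equality over the
      projective module \<open>Y\<close> that functionals can test.\<close>
    let ?w = "h0 \<xi> \<ominus>\<^bsub>tens Y\<^esub> (z \<oplus>\<^bsub>tens Y\<^esub> tm Y d0 (tm X h z))"
    have "?w = \<zero>\<^bsub>tens Y\<^esub>"
    proof (rule tensor_projective_vanish[OF pY])
      show "?w \<in> carrier (tens Y)" using h0c[OF xi] zc dhz by simp
      fix \<psi> assume p: "functional Y \<psi>"
      note pd = linear_map_comp[OF d0 p]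
      note pdh = linear_map_comp[OF a(5) pd]
      have pb: "(\<lambda>m\<in>carrier M. \<psi> (\<beta> m)) \<in> carrier ?D" (is "?\<mu> \<in> _")
        by (rule dual_restrict[OF M linear_map_comp[OF a(3) p]])
      have "ev Y \<psi> (h0 \<xi>) = ev Y (E ?\<mu>) z" using ev_h0[OF xi p] pb by (simp add: \<xi>_def)
      also have "\<dots> = ev Y (\<lambda>y. \<psi> y \<oplus>\<^bsub>R\<^esub> \<psi> (d0 (h y))) z"
      proof (rule uniq[OF E(1)[OF pb] functional_plus[OF p pdh]])
        fix x assume x: "x \<in> carrier X"
        have "E ?\<mu> (d0 x) = \<psi> (\<beta> (\<alpha> x))" using E(2)[OF pb x] ac[OF x] by simp
        also have "\<dots> = \<psi> (d0 x \<oplus>\<^bsub>Y\<^esub> d0 (h (d0 x)))"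
          using a(6)[OF x] linear_map_add[OF d0 x hc[OF d0c[OF x]]] by simp
        also have "\<dots> = \<psi> (d0 x) \<oplus>\<^bsub>R\<^esub> \<psi> (d0 (h (d0 x)))"
          using linear_map_add[OF p d0c[OF x] d0c[OF hc[OF d0c[OF x]]]] by simp
        finally show "E ?\<mu> (d0 x) = \<psi> (d0 x) \<oplus>\<^bsub>R\<^esub> \<psi> (d0 (h (d0 x)))" .
      qed
      also have "\<dots> = ev Y \<psi> z \<oplus>\<^bsub>N\<^esub> ev Y \<psi> (tm Y d0 (tm X h z))"
        unfolding ev_plus[OF Y p pdh zc] ev_tensor_map[OF X Y d0 p hz] ev_tensor_map[OF Y X a(5) pd zc] ..
      also have "\<dots> = ev Y \<psi> (z \<oplus>\<^bsub>tens Y\<^esub> tm Y d0 (tm X h z))"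
        using linear_map_add[OF ev_linear[OF Y p] zc dhz] by simp
      finally have e: "ev Y \<psi> (h0 \<xi>) = ev Y \<psi> (z \<oplus>\<^bsub>tens Y\<^esub> tm Y d0 (tm X h z))" .
      have wc: "z \<oplus>\<^bsub>tens Y\<^esub> tm Y d0 (tm X h z) \<in> carrier (tens Y)" using zc dhz by simp
      have "ev Y \<psi> ?w = ev Y \<psi> (h0 \<xi>) \<ominus>\<^bsub>NK\<^esub> ev Y \<psi> (z \<oplus>\<^bsub>tens Y\<^esub> tm Y d0 (tm X h z))"
        by (rule linear_map_minus[OF lmodule_tensor[OF Y] NK ev_linear[OF Y p] h0c[OF xi] wc])
      then show "ev Y \<psi> ?w = \<zero>\<^bsub>N\<^esub>"
        unfolding e using lmodule.minus_eq_zero_iff[OF NK] ev_closed[OF Y p wc] by simp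
    qed
    then have "h0 \<xi> = z \<oplus>\<^bsub>tens Y\<^esub> tm Y d0 (tm X h z)"
      using TY.minus_eq_zero_iff h0c[OF xi] zc dhz by simp
    then have "h0 \<xi> \<ominus>\<^bsub>tens Y\<^esub> z = tm Y d0 (tm X h z)"
      using zc dhz by (simp add: a_minus_def TY.M.a_comm[of z] TY.M.a_assoc TY.M.r_neg)
    then show ?thesis using xi hz by (auto simp: bou1)
  qed

  \<comment> \<open>Passage to homology classes\<close>
  let ?C0 = "obj TC 0\<lparr>carrier := cycles TC 0\<rparr>" and ?C1 = "obj TC (- 1)\<lparr>carrier := cycles TC (- 1)\<rparr>"
  have oX: "obj TC 0 = tens X" and oY: "obj TC (- 1) = tens Y" by (simp_all add: oTC defs)
  note lC0 = lmodule_cycles[OF cTC, of 0] and lC1 = lmodule_cycles[OF cTC, of "- 1"]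
    and s0 = submodule_boundaries[OF cTC, of 0] and s1 = submodule_boundaries[OF cTC, of "- 1"]
  have la0: "linear_map K ?C0 (tens M) (tm M \<alpha>)"
    unfolding oX by (rule linear_map_restrict[OF la]) (auto simp: cyc0)
  obtain f where f: "linear_map K (quot_module ?C0 (boundaries TC 0)) (tens M) f"
    "\<And>x. x \<in> carrier ?C0 \<Longrightarrow> f (boundaries TC 0 +>\<^bsub>?C0\<^esub> x) = tm M \<alpha> x"
    using quot_lift[OF lC0 lmodule_tensor[OF M] s0 la0] \<alpha>1 by (auto simp: bou0)
  define hh where "hh \<xi> = boundaries TC (- 1) +>\<^bsub>?C1\<^esub> h0 \<xi>" for \<xi>
  have h0C: "linear_map K ?H ?C1 h0"
    unfolding oY by (rule linear_map_into_submodule[OF h0lin h0cyc])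
  have hh: "linear_map K ?H (tate_tor K R T N (- 1)) hh"
    unfolding H0 hh_def by (rule linear_map_comp[OF h0C linear_quot[OF lC1 s1]])
  have cH: "carrier (tate_tor K R T N i)
    = (\<lambda>x. boundaries TC i +>\<^bsub>obj TC i\<lparr>carrier := cycles TC i\<rparr>\<^esub> x) ` cycles TC i" for i
    by (simp add: H0 carrier_quot)
  have inj: "inj_on f (carrier (tate_tor K R T N 0))"
  proof (rule inj_onI)
    fix x y assume "x \<in> carrier (tate_tor K R T N 0)" "y \<in> carrier (tate_tor K R T N 0)" and e: "f x = f y"
    then obtain v w where v: "v \<in> cycles TC 0" "x = boundaries TC 0 +>\<^bsub>?C0\<^esub> v"
      and w: "w \<in> cycles TC 0" "y = boundaries TC 0 +>\<^bsub>?C0\<^esub> w" unfolding cH by blast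
    have vw: "v \<in> carrier (tens X)" "w \<in> carrier (tens X)" using v(1) w(1) by (simp_all add: cyc0)
    have vwc: "v \<ominus>\<^bsub>tens X\<^esub> w \<in> carrier (tens X)" using vw by simp
    have "tm M \<alpha> v = tm M \<alpha> w" using e f(2)[of v] f(2)[of w] v w by simp
    then have "tm M \<alpha> (v \<ominus>\<^bsub>tens X\<^esub> w) = \<zero>\<^bsub>tens M\<^esub>"
      using linear_map_minus[OF lmodule_tensor[OF X] lmodule_tensor[OF M] la vw] linear_map_closed[OF la] vw
      by (simp add: TM.minus_eq_zero_iff)
    moreover have "tm Y d0 (v \<ominus>\<^bsub>tens X\<^esub> w) = \<zero>\<^bsub>tens Y\<^esub>"
      using linear_map_minus[OF lmodule_tensor[OF X] lmodule_tensor[OF Y] l0 vw] v(1) w(1)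
      by (simp add: cyc0 TY.minus_eq_zero_iff)
    ultimately have "v \<ominus>\<^bsub>tens X\<^esub> w \<in> boundaries TC 0" using kerB[OF vwc] by simp
    moreover have "submodule (boundaries TC 0) K (tens X)"
      unfolding bou0 by (rule submodule_image[OF lmodule_tensor[OF V] lmodule_tensor[OF X] l1])
    ultimately show "x = y"
      using TX.quot_eq_iff vw v(2) w(2) by (simp add: oX)
  qed
  have imf: "f ` carrier (tate_tor K R T N 0) = tm M \<alpha> ` cycles TC 0"
    unfolding cH image_image using f(2) by simp
  have sB1: "submodule (boundaries TC (- 1)) K (tens Y)"
    unfolding bou1 by (rule submodule_image[OF lmodule_tensor[OF X] lmodule_tensor[OF Y] l0])
  have hh0: "hh \<xi> = \<zero>\<^bsub>tate_tor K R T N (- 1)\<^esub> \<longleftrightarrow> h0 \<xi> \<in> boundaries TC (- 1)" if "\<xi> \<in> carrier ?H" for \<xi>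
    using TY.coset_eq_iff[OF sB1 h0c[OF that]] by (simp add: hh_def H0 zero_quot oY)
  have "hh ` carrier ?H = carrier (tate_tor K R T N (- 1))"
  proof
    show "hh ` carrier ?H \<subseteq> carrier (tate_tor K R T N (- 1))" using linear_map_closed[OF hh] by blast
    show "carrier (tate_tor K R T N (- 1)) \<subseteq> hh ` carrier ?H"
    proof
      fix x assume "x \<in> carrier (tate_tor K R T N (- 1))"
      then obtain z where z: "z \<in> cycles TC (- 1)" "x = boundaries TC (- 1) +>\<^bsub>?C1\<^esub> z" unfolding cH by blast
      obtain \<xi> where xi: "\<xi> \<in> carrier ?H" "h0 \<xi> \<ominus>\<^bsub>tens Y\<^esub> z \<in> boundaries TC (- 1)" using surj[OF z(1)] by blast
      have "hh \<xi> = x"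
        using TY.quot_eq_iff[OF sB1 h0c[OF xi(1)], of z] xi(2) z by (simp add: hh_def oY cyc1)
      then show "x \<in> hh ` carrier ?H" using xi(1) by blast
    qed
  qed
  moreover have "\<theta> M ` carrier (tens M) = a_kernel ?H (tate_tor K R T N (- 1)) hh"
    unfolding im_g using hh0 by (auto simp: a_kernel_def')
  moreover have "f ` carrier (tate_tor K R T N 0) = a_kernel (tens M) ?H (\<theta> M)"
    unfolding imf im_f by (simp add: a_kernel_def')
  ultimately show ?thesis
    using f(1)[folded H0] theta_linear[OF M] hh inj by blast
qed

end

theorem corollary4p7:
  fixes K :: "'k ring" and R :: "('k, 'r) module"
    and M :: "('r, 'm) module" and N :: "('r, 'n) module"
    and T :: "('r, 't) mcomplex" and P :: "('r, 'p) mcomplex"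
    and \<tau> :: "int \<Rightarrow> 't \<Rightarrow> 'p" and \<pi> :: "int \<Rightarrow> 'p \<Rightarrow> 'm"
  assumes "assoc_algebra K R" and "noetherian R"
    and "finitely_generated (opp_ring R) M"
    and "gorenstein_projective TYPE('g) (opp_ring R) M"
    and "lmodule R N"
    and "complete_projective_resolution (opp_ring R) M T \<tau> P \<pi>"
  shows "\<exists>f g h.
      linear_map K (tate_tor K R T N 0) (tensor K R M N) f \<and>
      linear_map K (tensor K R M N) (hom_module R (dual_module R M) N) g \<and>
      linear_map K (hom_module R (dual_module R M) N) (tate_tor K R T N (-1)) h \<and>
      inj_on f (carrier (tate_tor K R T N 0)) \<and>
      f ` carrier (tate_tor K R T N 0) =
        a_kernel (tensor K R M N) (hom_module R (dual_module R M) N) g \<and>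
      g ` carrier (tensor K R M N) =
        a_kernel (hom_module R (dual_module R M) N) (tate_tor K R T N (-1)) h \<and>
      h ` carrier (hom_module R (dual_module R M) N) = carrier (tate_tor K R T N (-1))"
proof -
  interpret tensor_right K R N using assms(1,5) by (rule tensor_right.intro)
  have M: "lmodule S M" using assms(4) by (simp add: gorenstein_projective_def)
  have T: "totally_acyclic S T" using assms(6) by (simp add: complete_projective_resolution_def)
  show ?thesis
    \<comment> \<open>The hypotheses of \<open>tate_exact_sequence\<close> that are still open are,
      in order, the facts delivered by \<open>stable_comparison\<close>.\<close>
    by (rule stable_comparison[OF assms(6,4)]) (rule tate_exact_sequence[OF M assms(3) T])
qed

end
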